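(* Let $\alpha,\beta\in\mathbb{C}\setminus\{0,-1,-2,\ldots\}$ with $\alpha+\beta\notin\{-2,-3,-4,\ldots\}$, and let $w$, $p_n$, $a_n$ be as in the context. Let $\Omega\subset\mathbb{C}$ be the interior of an ellipse with foci $0$ and $1$, and let $f$ be analytic in $\Omega$. Then $$f(x)=\sum_{n=0}^\infty f_n\,p_n(x)\quad (x\in\Omega),\qquad f_n=a_n^{-1}\,\mathcal{H}\!\int_0^1 f(x)\,p_n(x)\,w(x)\,dx,$$ and the series converges absolutely and uniformly on every compact subset of $\Omega$.
   Context: $w(x)=x^\alpha(1-x)^\beta$, $q(x)=x(1-x)$, $p_n(x)=\frac{1}{w(x)}\frac{d^n}{dx^n}\big(q(x)^n w(x)\big)$ for $n=0,1,2,\ldots$ (a polynomial of degree $n$), and $a_n=\frac{n!\,\Gamma(n+\alpha+1)\,\Gamma(n+\beta+1)}{(2n+\alpha+\beta+1)\,\Gamma(n+\alpha+\beta+1)}$. $\mathcal{H}\int_0^1$ denotes the Hadamard finite part of the integral: for $F$ analytic at $0$ with Taylor series $F(t)=\sum_{m\ge0}c_m t^m$ and $\gamma\notin\{0,-1,-2,\ldots\}$, $\mathcal{H}\int_0^x t^{\gamma-1}F(t)\,dt:=\sum_{m\ge0}\frac{c_m}{m+\gamma}x^{m+\gamma}$ (for small $x>0$); for $h$ analytic near $[0,1]$, $\mathcal{H}\int_0^1 x^\alpha(1-x)^\beta h(x)\,dx$ is obtained by splitting at $\tfrac12$ and applying this definition at each endpoint (at $1$ after substituting $t=1-x$). Equivalently,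 it is the analytic continuation in $(\alpha,\beta)$ of the ordinary integral from $\Re\alpha,\Re\beta>-1$.
   Formalization: For n = 0 the factor (α+β+1)Γ(α+β+1) in a_0 is read as Γ(α+β+2), since the printed formula is undefined (0 times a pole) in the allowed case α+β = −1; otherwise the value is unchanged. *)

theory Defs
  imports "HOL-Analysis.Analysis"
begin

definition jw :: "complex \<Rightarrow> complex \<Rightarrow> complex \<Rightarrow> complex" where
  "jw \<alpha> \<beta> z = z powr \<alpha> * (1 - z) powr \<beta>"

definition rodrigues :: "complex \<Rightarrow> complex \<Rightarrow> nat \<Rightarrow> complex \<Rightarrow> complex" where
  "rodrigues \<alpha> \<beta> n z =
     (deriv ^^ n) (\<lambda>t. (t * (1 - t)) ^ n * jw \<alpha> \<beta> t) z / jw \<alpha> \<beta> z"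

definition jpoly :: "complex \<Rightarrow> complex \<Rightarrow> nat \<Rightarrow> complex poly" where
  "jpoly \<alpha> \<beta> n =
     (THE p. \<forall>x::real. 0 < x \<and> x < 1 \<longrightarrow> poly p (of_real x) = rodrigues \<alpha> \<beta> n (of_real x))"

text \<open>Normalisation a_n; for n = 0 the factor (alpha+beta+1) Gamma(alpha+beta+1) is
  written as Gamma(alpha+beta+2) (same value whenever alpha+beta \<noteq> -1, and its
  continuous extension otherwise).\<close>
definition jnorm :: "complex \<Rightarrow> complex \<Rightarrow> nat \<Rightarrow> complex" where
  "jnorm \<alpha> \<beta> n =
     (if n = 0 then Gamma (\<alpha> + 1) * Gamma (\<beta> + 1) / Gamma (\<alpha> + \<beta> + 2)
      else fact n * Gamma (of_nat n + \<alpha> + 1) * Gamma (of_nat n + \<beta> + 1)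
           / ((2 * of_nat n + \<alpha> + \<beta> + 1) * Gamma (of_nat n + \<alpha> + \<beta> + 1)))"

text \<open>Finite part H int_0^x t^(gamma-1) F(t) dt = sum_m c_m/(m+gamma) x^(m+gamma),
  c_m the Taylor coefficients of F at 0.\<close>
definition hfp0 :: "complex \<Rightarrow> (complex \<Rightarrow> complex) \<Rightarrow> real \<Rightarrow> complex" where
  "hfp0 \<gamma> F x =
     (\<Sum>m. ((deriv ^^ m) F 0 / fact m) / (of_nat m + \<gamma>) * (of_real x) powr (of_nat m + \<gamma>))"

text \<open>H int_0^1 x^alpha (1-x)^beta h(x) dx: split off small neighbourhoods [0,eps],
  [1-eps,1] of the endpoints (finite parts there, substituting t = 1-x at 1),
  ordinary integral in between; the value does not depend on small eps.\<close>
definition hadamard :: "complex \<Rightarrow> complex \<Rightarrow> (complex \<Rightarrow> complex) \<Rightarrow> complex" where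
  "hadamard \<alpha> \<beta> h =
     (THE v. \<exists>e>0. \<forall>\<epsilon>::real. 0 < \<epsilon> \<and> \<epsilon> < e \<longrightarrow>
        v = hfp0 (\<alpha> + 1) (\<lambda>t. (1 - t) powr \<beta> * h t) \<epsilon>
          + integral {\<epsilon>..1 - \<epsilon>} (\<lambda>x::real. jw \<alpha> \<beta> (of_real x) * h (of_real x))
          + hfp0 (\<beta> + 1) (\<lambda>t. (1 - t) powr \<alpha> * h (1 - t)) \<epsilon>)"

end

theory Submission
  imports Defs "HOL-Complex_Analysis.Complex_Analysis"
begin

text \<open>The finite part functional \<open>L\<close> is linear, bounded by suprema over any ellipse around the
  unit interval, and annihilates \<open>(q w h)' / w\<close>. Writing the Rodrigues formula as the recursion
  \<open>p\<^sub>n\<^sub>+\<^sub>1 = (q w s\<^sub>n)' / w\<close>, with \<open>s\<^sub>n\<close> the polynomial \<open>p\<^sub>n\<close> for \<open>\<alpha> + 1, \<beta> + 1\<close>, integration by parts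
  gives \<open>L (p\<^sub>n g) = (-1)\<^sup>n L\<^sub>n (g\<^sup>(\<^sup>n\<^sup>))\<close> for polynomials \<open>g\<close>, where \<open>L\<^sub>n\<close> has parameters \<open>\<alpha> + n, \<beta> + n\<close>.
  With \<open>L 1 = B(\<alpha> + 1, \<beta> + 1)\<close> this yields orthogonality, the norms \<open>a\<^sub>n\<close>, and a three-term recurrence
  for \<open>u\<^sub>n = p\<^sub>n / n!\<close> whose coefficients converge to those of the Chebyshev recurrence. Hence \<open>u\<^sub>n\<close>
  grows at most like \<open>(R + \<epsilon>)\<^sup>n\<close> on the ellipse that is the image of the circle of radius \<open>R\<close>
  under the Joukowski map, while \<open>a\<^sub>n / (n!)\<^sup>2\<close> is subexponential.
  A function analytic inside the ellipse of radius \<open>R\<^sub>1\<close> is approximated by polynomials \<open>S\<^sub>N\<close> of degree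
  at most \<open>N\<close> with error about \<open>(R / R\<^sub>1)\<^sup>N\<close>. Since \<open>L\<close> only sees ellipses of radius close to 1,
  replacing \<open>f\<close> by \<open>f - S\<^sub>N\<close> in the coefficients makes everything converge geometrically.\<close>

text \<open>For general complex exponents \<open>L\<close> is no integral against a positive
  measure, so neither positivity nor completeness of a Hilbert space is available. Their substitute
  is nondegeneracy: for q of degree at most n, L (p_n q) is a nonzero multiple of the coefficient of
  x^n in q; this is where the condition on \<alpha> + \<beta> enters. The finite part is always
  handled as the increment of a primitive, so independence of the truncation, linearity, reflection
  and vanishing on exact derivatives each amount to exhibiting a primitive. No asymptotic formula
  for the polynomials is used: limits of recurrence coefficients give growth up to an arbitrary
  factor Q > 1 per index, and the larger ellipse on which f is analytic leaves geometric room to pay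
  for all such factors. Ellipses are sublevel sets of the sum of the focal distances, so nesting,
  convexity and distance bounds follow from the triangle inequality; \<open>jk\<close> translates
  the radius of a circle into that sum.\<close>

definition ell :: "real \<Rightarrow> complex set" where
  "ell r = {z. cmod z + cmod (z - 1) < r}"

lemma open_ell: "open (ell r)"
  unfolding ell_def by (intro open_Collect_less continuous_intros)

text \<open>Convexity later supplies primitives and the convex form of Cauchy's formula; it holds
  because the sum of the focal distances is a convex function.\<close>

lemma convex_ell: "convex (ell r)"
proof (rule convexI)
  fix x y :: complex and u v :: real
  assume xy: "x \<in> ell r" "y \<in> ell r" and uv: "0 \<le> u" "0 \<le> v" "u + v = 1"
  have e: "u *\<^sub>R x + v *\<^sub>R y - 1 = u *\<^sub>R (x - 1) + v *\<^sub>R (y - 1)"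
    using uv(3) by (simp add: algebra_simps) (metis scaleR_left_distrib scaleR_one)
  have "cmod (u *\<^sub>R x + v *\<^sub>R y) + cmod (u *\<^sub>R x + v *\<^sub>R y - 1) \<le>
     (u * cmod x + v * cmod y) + (u * cmod (x - 1) + v * cmod (y - 1))"
    unfolding e using uv(1,2)
    by (intro add_mono order_trans[OF norm_triangle_ineq]) auto
  also have "\<dots> = u * (cmod x + cmod (x-1)) + v * (cmod y + cmod (y-1))"
    by (simp add: algebra_simps)
  also have "\<dots> < r"
    using convex_bound_lt[of "cmod x + cmod (x-1)" r "cmod y + cmod (y-1)" u v] xy uv
    by (auto simp: ell_def)
  finally show "u *\<^sub>R x + v *\<^sub>R y \<in> ell r" by (simp add: ell_def)
qed

lemma ell_reflect: "1 - z \<in> ell r \<longleftrightarrow> z \<in> ell r"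
  by (simp add: ell_def norm_minus_commute add.commute)

lemma unit_interval_in_ell: "1 < r \<Longrightarrow> 0 \<le> x \<Longrightarrow> x \<le> 1 \<Longrightarrow> complex_of_real x \<in> ell r"
proof -
  assume "1 < r" "0 \<le> x" "x \<le> 1"
  moreover have "cmod (complex_of_real x - 1) = \<bar>x - 1\<bar>"
    by (metis norm_of_real of_real_1 of_real_diff)
  ultimately show ?thesis by (simp add: ell_def)
qed

text \<open>Since |t| + |t - 1| <= 2 |t| + 1; this is the origin of the radius
  \<open>erad\<close>.\<close>

lemma small_ball_in_ell: "cmod t < (r - 1) / 2 \<Longrightarrow> t \<in> ell r"
  using norm_triangle_ineq4[of t 1] by (simp add: ell_def)

lemma ell_mono: "r \<le> s \<Longrightarrow> ell r \<subseteq> ell s"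
  by (auto simp: ell_def)

section \<open>Finite parts at an endpoint\<close>

text \<open>\<open>t\<^sup>\<gamma> G\<close> is then the primitive of \<open>t\<^sup>\<gamma>\<^sup>-\<^sup>1 F\<close> without constant term, that is, its finite part.\<close>

definition fp_prim :: "complex \<Rightarrow> (complex \<Rightarrow> complex) \<Rightarrow> real \<Rightarrow> (complex \<Rightarrow> complex) \<Rightarrow> bool" where
  "fp_prim \<gamma> F e G \<longleftrightarrow>
     (\<exists>G'. \<forall>t\<in>ball 0 e. (G has_field_derivative G' t) (at t) \<and> \<gamma> * G t + t * G' t = F t)"

lemma fp_prim_holomorphic: "fp_prim \<gamma> F e G \<Longrightarrow> G holomorphic_on ball 0 e"
  unfolding fp_prim_def by (metis holomorphic_on_open open_ball)

lemma fp_prim_add: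
  assumes "fp_prim \<gamma> F e G" "fp_prim \<gamma> F2 e G2"
  shows "fp_prim \<gamma> (\<lambda>t. F t + F2 t) e (\<lambda>t. G t + G2 t)"
proof -
  from assms obtain G' G2' where
    "\<forall>t\<in>ball 0 e. (G has_field_derivative G' t) (at t) \<and> \<gamma> * G t + t * G' t = F t"
    "\<forall>t\<in>ball 0 e. (G2 has_field_derivative G2' t) (at t) \<and> \<gamma> * G2 t + t * G2' t = F2 t"
    unfolding fp_prim_def by blast
  then have D: "((\<lambda>t. G t + G2 t) has_field_derivative G' t + G2' t) (at t)"
      "(\<gamma> * G t + t * G' t) + (\<gamma> * G2 t + t * G2' t) = F t + F2 t" if "t \<in> ball 0 e" for t
    using that by (auto intro!: DERIV_add)
  have "((\<lambda>t. G t + G2 t) has_field_derivative G' t + G2' t) (at t) \<and>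
      \<gamma> * (G t + G2 t) + t * (G' t + G2' t) = F t + F2 t" if "t \<in> ball 0 e" for t
    using D(1)[OF that] D(2)[OF that, symmetric] by (simp add: algebra_simps)
  then show ?thesis unfolding fp_prim_def by (intro exI ballI)
qed

lemma fp_prim_cmult:
  assumes "fp_prim \<gamma> F e G"
  shows "fp_prim \<gamma> (\<lambda>t. c * F t) e (\<lambda>t. c * G t)"
proof -
  from assms obtain G' where
    "\<forall>t\<in>ball 0 e. (G has_field_derivative G' t) (at t) \<and> \<gamma> * G t + t * G' t = F t"
    unfolding fp_prim_def by blast
  then have D: "((\<lambda>t. c * G t) has_field_derivative c * G' t) (at t)"
      "c * (\<gamma> * G t + t * G' t) = c * F t" if "t \<in> ball 0 e" for t
    using that by (auto intro!: DERIV_cmult)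
  have "((\<lambda>t. c * G t) has_field_derivative c * G' t) (at t) \<and>
      \<gamma> * (c * G t) + t * (c * G' t) = c * F t" if "t \<in> ball 0 e" for t
    using D(1)[OF that] D(2)[OF that, symmetric] by (simp add: algebra_simps)
  then show ?thesis unfolding fp_prim_def by (intro exI ballI)
qed

text \<open>t^\<gamma> (t G) and t^(\<gamma> + 1) G are the same primitive, so a factor t can move
  between integrand and exponent without changing a finite part.\<close>

lemma fp_prim_shift:
  assumes "fp_prim (\<gamma> + 1) F e G"
  shows "fp_prim \<gamma> (\<lambda>t. t * F t) e (\<lambda>t. t * G t)"
proof -
  from assms obtain G' where
    *: "\<forall>t\<in>ball 0 e. (G has_field_derivative G' t) (at t) \<and> (\<gamma> + 1) * G t + t * G' t = F t"
    unfolding fp_prim_def by blast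
  show ?thesis unfolding fp_prim_def
  proof (intro exI[of _ "\<lambda>t. G t + t * G' t"] ballI conjI)
    fix t :: complex assume t: "t \<in> ball 0 e"
    show "((\<lambda>t. t * G t) has_field_derivative G t + t * G' t) (at t)"
      using * t by (auto intro!: derivative_eq_intros)
    show "\<gamma> * (t * G t) + t * (G t + t * G' t) = t * F t"
      using *[rule_format, OF t, THEN conjunct2, symmetric] by (simp add: algebra_simps)
  qed
qed

lemma fp_prim_cong:
  assumes "fp_prim \<gamma> F e G" "\<And>t. t \<in> ball 0 e \<Longrightarrow> F t = F2 t"
  shows "fp_prim \<gamma> F2 e G"
  using assms(1) unfolding fp_prim_def by (elim ex_forward) (simp add: assms(2)[symmetric])

text \<open>Repeated differentiation of \<gamma> G + t G' = F. At z = 0 the last term drops out and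
  the denominators m + \<gamma> of the finite part appear.\<close>

lemma fp_prim_higher_deriv:
  assumes "fp_prim \<gamma> F e G" "z \<in> ball 0 e"
  shows "(deriv ^^ m) F z = (\<gamma> + of_nat m) * (deriv ^^ m) G z + z * (deriv ^^ Suc m) G z"
  using assms(2)
proof (induction m arbitrary: z)
  case 0
  from assms(1) obtain G' where "(G has_field_derivative G' z) (at z)" "\<gamma> * G z + z * G' z = F z"
    using 0 unfolding fp_prim_def by blast
  then show ?case by (simp add: DERIV_imp_deriv)
next
  case (Suc m)
  have hG: "(deriv ^^ k) G holomorphic_on ball 0 e" for k
    by (intro holomorphic_higher_deriv fp_prim_holomorphic[OF assms(1)]) auto
  have d: "((deriv ^^ k) G has_field_derivative (deriv ^^ Suc k) G z) (at z)" for k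
    using hG[of k] Suc.prems by (simp add: holomorphic_derivI)
  let ?H = "\<lambda>z. (\<gamma> + of_nat m) * (deriv ^^ m) G z + z * (deriv ^^ Suc m) G z"
  have "((deriv ^^ m) F has_field_derivative
      (\<gamma> + of_nat m) * (deriv ^^ Suc m) G z + ((deriv ^^ Suc m) G z + z * (deriv ^^ Suc (Suc m)) G z)) (at z)"
    (is "(_ has_field_derivative ?D) _")
  proof (rule has_field_derivative_transform_within_open)
    show "(?H has_field_derivative ?D) (at z)"
      using d[of m] d[of "Suc m"] by (auto intro!: derivative_eq_intros simp del: funpow.simps)
    show "open (ball (0::complex) e)" "z \<in> ball 0 e" using Suc.prems by auto
    show "?H w = (deriv ^^ m) F w" if "w \<in> ball 0 e" for w using Suc.IH[OF that] by simp
  qed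
  then show ?case
    by (simp add: DERIV_imp_deriv algebra_simps)
qed

text \<open>The Taylor coefficients of G at 0 are those of F divided by m + \<gamma>, so the
  defining series is x^\<gamma> times the Taylor series of G.\<close>

lemma hfp0_eq_fp_prim:
  assumes P: "fp_prim \<gamma> F e G" and nz: "\<And>m::nat. of_nat m + \<gamma> \<noteq> 0" and x: "0 < x" "x < e"
  shows "hfp0 \<gamma> F x = of_real x powr \<gamma> * G (of_real x)"
proof -
  have e0: "(0::complex) \<in> ball 0 e" using x by auto
  have xe: "complex_of_real x \<in> ball 0 e" using x by auto
  have "(\<lambda>n. (deriv ^^ n) G 0 / fact n * (of_real x - 0) ^ n) sums G (of_real x)"
    by (rule holomorphic_power_series[OF fp_prim_holomorphic[OF P] xe])
  from sums_mult[OF this, of "of_real x powr \<gamma>"]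
  have "(\<lambda>m. ((deriv ^^ m) F 0 / fact m) / (of_nat m + \<gamma>) * (of_real x) powr (of_nat m + \<gamma>))
     sums (of_real x powr \<gamma> * G (of_real x))"
  proof (rule sums_cong[THEN iffD1, rotated])
    fix m
    have "(deriv ^^ m) F 0 = (of_nat m + \<gamma>) * (deriv ^^ m) G 0"
      using fp_prim_higher_deriv[OF P e0, of m] by (simp add: add.commute)
    moreover have "complex_of_real x powr (of_nat m + \<gamma>) = of_real x ^ m * of_real x powr \<gamma>"
      using x by (simp add: powr_add powr_nat')
    ultimately show "of_real x powr \<gamma> * ((deriv ^^ m) G 0 / fact m * (of_real x - 0) ^ m) =
      ((deriv ^^ m) F 0 / fact m) / (of_nat m + \<gamma>) * (of_real x) powr (of_nat m + \<gamma>)"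
      using nz[of m] by simp
  qed
  then show ?thesis unfolding hfp0_def by (simp add: sums_iff)
qed

text \<open>Only finitely many m lie near -\<gamma>; past |\<gamma>| + 1 the modulus is at least 1.
  The uniform bound makes division by m + \<gamma> harmless for convergence and estimates.\<close>

lemma nonresonant_bound:
  fixes \<gamma> :: complex
  assumes nz: "\<And>m::nat. of_nat m + \<gamma> \<noteq> 0"
  obtains d where "d > 0" "\<And>m::nat. d \<le> cmod (of_nat m + \<gamma>)"
proof -
  obtain N :: nat where N: "real N > cmod \<gamma> + 1" using reals_Archimedean2 by blast
  define d where "d = Min (insert 1 ((\<lambda>m::nat. cmod (of_nat m + \<gamma>)) ` {..N}))"
  have "d > 0" unfolding d_def using nz by (subst Min_gr_iff) auto
  moreover have "d \<le> cmod (of_nat m + \<gamma>)" for m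
  proof (cases "m \<le> N")
    case True then show ?thesis unfolding d_def by (intro Min_le) auto
  next
    case False
    have "d \<le> 1" unfolding d_def by (intro Min_le) auto
    also have "\<dots> \<le> real m - cmod \<gamma>" using False N by auto
    also have "\<dots> \<le> cmod (of_nat m + \<gamma>)"
      using norm_diff_ineq[of "of_nat m :: complex" \<gamma>] by simp
    finally show ?thesis .
  qed
  ultimately show ?thesis using that by blast
qed

text \<open>Dividing the Taylor coefficients of F by m + \<gamma> gives G on the whole disc, since
  the divisors are bounded below; the differential equation is then checked coefficientwise.\<close>

lemma fp_prim_exists:
  assumes F: "F holomorphic_on ball 0 e" and nz: "\<And>m::nat. of_nat m + \<gamma> \<noteq> 0"
  shows "\<exists>G. fp_prim \<gamma> F e G"
proof -
  obtain d where d: "d > 0" "\<And>m::nat. d \<le> cmod (of_nat m + \<gamma>)"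
    using nonresonant_bound[OF nz] by blast
  define c where "c m = (deriv ^^ m) F 0 / fact m" for m
  have F_sums: "(\<lambda>m. c m * t ^ m) sums F t" if "t \<in> ball 0 e" for t
    using holomorphic_power_series[OF F that] by (simp add: c_def)
  define G where "G t = (\<Sum>m. c m / (of_nat m + \<gamma>) * t ^ m)" for t
  have summ: "summable (\<lambda>m. c m / (of_nat m + \<gamma>) * t ^ m)" if t: "t \<in> ball 0 e" for t
  proof -
    obtain q where q: "cmod t < q" "q < e" using t dense[of "cmod t" e] by (auto simp: dist_norm)
    have q0: "q > 0" using q(1) norm_ge_zero[of t] by linarith
    then have "of_real q \<in> ball (0::complex) e" using q by simp
    then have "summable (\<lambda>m. c m * of_real q ^ m)" using F_sums sums_summable by blast
    then have s: "summable (\<lambda>m. norm (c m * t ^ m))"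
      by (rule powser_insidea) (use q0 q in auto)
    show ?thesis
    proof (rule summable_comparison_test'[OF summable_mult[OF s, of "1/d"]])
      fix m :: nat
      have "norm (c m / (of_nat m + \<gamma>) * t ^ m) = norm (c m * t ^ m) / cmod (of_nat m + \<gamma>)"
        by (simp add: norm_mult norm_divide)
      also have "\<dots> \<le> norm (c m * t ^ m) / d"
        using d(1) d(2)[of m] by (intro divide_left_mono mult_pos_pos) auto
      finally show "norm (c m / (of_nat m + \<gamma>) * t ^ m) \<le> 1 / d * norm (c m * t ^ m)" by simp
    qed
  qed
  have "\<exists>D. (G has_field_derivative D) (at t) \<and> \<gamma> * G t + t * D = F t" if t: "t \<in> ball 0 e" for t
  proof -
    obtain q where q: "cmod t < q" "q < e" using t dense[of "cmod t" e] by (auto simp: dist_norm)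
    have q0: "q > 0" using q(1) norm_ge_zero[of t] by linarith
    then have qe: "of_real q \<in> ball (0::complex) e" using q by simp
    have "summable (\<lambda>m. c m / (of_nat m + \<gamma>) * of_real (q ^ m))" using summ[OF qe] by simp
    from power_series_and_derivative_0[OF this] obtain g g' where
      g: "\<And>z. cmod z < q \<Longrightarrow> ((\<lambda>m. c m / (of_nat m + \<gamma>) * z ^ m) sums g z) \<and>
         ((\<lambda>n. of_nat n * (c n / (of_nat n + \<gamma>)) * z^(n-1)) sums g' z) \<and> (g has_field_derivative g' z) (at z)"
      by blast
    have gG: "g z = G z" if "cmod z < q" for z
      using g[OF that] by (simp add: G_def sums_iff)
    have "(G has_field_derivative g' t) (at t)"
      using g[OF q(1)]
      by (intro has_field_derivative_transform_within_open[of g _ t "ball 0 q" G])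
         (use q gG in auto)
    moreover have "\<gamma> * G t + t * g' t = F t"
    proof -
      have "(\<lambda>n. \<gamma> * (c n / (of_nat n + \<gamma>) * t ^ n) + t * (of_nat n * (c n / (of_nat n + \<gamma>)) * t^(n-1)))
         sums (\<gamma> * g t + t * g' t)"
        using g[OF q(1)] by (intro sums_add sums_mult) auto
      also have "(\<lambda>n. \<gamma> * (c n / (of_nat n + \<gamma>) * t ^ n) + t * (of_nat n * (c n / (of_nat n + \<gamma>)) * t^(n-1)))
         = (\<lambda>n. c n * t ^ n)"
      proof
        fix n
        have "t * (of_nat n * (c n / (of_nat n + \<gamma>)) * t^(n-1)) = of_nat n * (c n / (of_nat n + \<gamma>)) * t ^ n"
          by (cases n) auto
        then have "\<gamma> * (c n / (of_nat n + \<gamma>) * t ^ n) + t * (of_nat n * (c n / (of_nat n + \<gamma>)) * t^(n-1))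
          = (of_nat n + \<gamma>) * (c n / (of_nat n + \<gamma>)) * t ^ n" by (simp only:) (simp only: distrib_right mult.assoc add.commute)
        also have "\<dots> = c n * t ^ n" using nz[of n] by simp
        finally show "\<gamma> * (c n / (of_nat n + \<gamma>) * t ^ n) + t * (of_nat n * (c n / (of_nat n + \<gamma>)) * t^(n-1))
          = c n * t ^ n" .
      qed
      finally show ?thesis using F_sums[OF t] gG[OF q(1)] sums_unique2 by metis
    qed
    ultimately show ?thesis by blast
  qed
  then show ?thesis unfolding fp_prim_def by metis
qed

text \<open>Cauchy's inequality on the circle of radius 2x bounds the m-th coefficient by M /
  (2x)^m; after multiplication by x^m the bounds halve from term to term. The constant depends only
  on \<gamma> and x.\<close>

lemma hfp0_bound:
  assumes nz: "\<And>m::nat. of_nat m + \<gamma> \<noteq> 0" and x: "0 < x"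
  shows "\<exists>C\<ge>0. \<forall>F M. F holomorphic_on ball 0 (3 * x) \<longrightarrow> (\<forall>t\<in>ball 0 (3 * x). cmod (F t) \<le> M)
            \<longrightarrow> cmod (hfp0 \<gamma> F x) \<le> C * M"
proof -
  obtain d where d: "d > 0" "\<And>m::nat. d \<le> cmod (of_nat m + \<gamma>)"
    using nonresonant_bound[OF nz] by blast
  show ?thesis
  proof (intro exI[of _ "2 * x powr (Re \<gamma>) / d"] conjI allI impI)
    show "2 * x powr Re \<gamma> / d \<ge> 0" using d by auto
    fix F :: "complex \<Rightarrow> complex" and M
    assume F: "F holomorphic_on ball 0 (3 * x)" and M: "\<forall>t\<in>ball 0 (3 * x). cmod (F t) \<le> M"
    have "cmod (F 0) \<le> M" using M x by auto
    then have Mx: "M \<ge> 0" using norm_ge_zero order_trans by blast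
    define u where "u m = ((deriv ^^ m) F 0 / fact m) / (of_nat m + \<gamma>) * (of_real x) powr (of_nat m + \<gamma>)" for m
    have ub: "norm (u m) \<le> M * x powr (Re \<gamma>) / d * (1/2) ^ m" for m
    proof -
      have "norm ((deriv ^^ m) F 0) \<le> fact m * M / (2 * x) ^ m"
      proof (rule Cauchy_inequality)
        have "cball (0::complex) (2 * x) \<subseteq> ball 0 (3 * x)" using x by auto
        then show "continuous_on (cball 0 (2 * x)) F"
          using F holomorphic_on_imp_continuous_on continuous_on_subset by blast
        have "ball (0::complex) (2 * x) \<subseteq> ball 0 (3 * x)" using x by auto
        then show "F holomorphic_on ball 0 (2 * x)" using F holomorphic_on_subset by blast
        show "cmod (F y) \<le> M" if "cmod (0 - y) = 2 * x" for y using M x that by simp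
      qed (use x in simp)
      then have a: "cmod ((deriv ^^ m) F 0 / fact m) \<le> M / (2 * x) ^ m"
        by (simp add: norm_divide field_simps)
      have b: "cmod (of_real x powr (of_nat m + \<gamma>)) = x ^ m * x powr Re \<gamma>"
        using x by (simp add: powr_add powr_nat' norm_mult norm_power norm_powr_real_powr)
      have "norm (u m) = cmod ((deriv ^^ m) F 0 / fact m) / cmod (of_nat m + \<gamma>) * (x ^ m * x powr Re \<gamma>)"
        by (simp add: u_def norm_mult norm_divide b)
      also have "\<dots> \<le> (M / (2 * x) ^ m) / d * (x ^ m * x powr Re \<gamma>)"
        using d x Mx by (intro mult_right_mono frac_le a d) auto
      also have "\<dots> = M * x powr (Re \<gamma>) / d * (1/2) ^ m"
        using x by (simp add: power_mult_distrib field_simps)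
      finally show ?thesis .
    qed
    have gs: "(\<lambda>m. M * x powr (Re \<gamma>) / d * (1/2) ^ m) sums (M * x powr (Re \<gamma>) / d * (1 / (1 - 1/2)))"
      by (intro sums_mult geometric_sums) auto
    have "norm (suminf u) \<le> (\<Sum>m. M * x powr (Re \<gamma>) / d * (1/2) ^ m)"
      by (rule norm_suminf_le[OF ub sums_summable[OF gs]])
    also have "\<dots> = 2 * x powr (Re \<gamma>) / d * M" using gs by (simp add: sums_iff)
    finally show "cmod (hfp0 \<gamma> F x) \<le> 2 * x powr (Re \<gamma>) / d * M"
      unfolding hfp0_def u_def .
  qed
qed

section \<open>The Hadamard finite part integral\<close>

text \<open>The exponent c is not a negative integer: t^c times a power series then has no term 1/t,
  and its primitive no logarithm.\<close>

definition nonres :: "complex \<Rightarrow> bool" where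
  "nonres c \<longleftrightarrow> (\<forall>m::nat. of_nat m + (c + 1) \<noteq> 0)"

text \<open>The finite part integral as the increment of one primitive \<open>W\<close> of the integrand, normalised
  at 0; the radius \<open>e\<close> bounds the truncations \<open>\<epsilon>\<close> for which the defining formula is valid.\<close>

definition has_fp :: "real \<Rightarrow> complex \<Rightarrow> complex \<Rightarrow> (complex \<Rightarrow> complex) \<Rightarrow> complex \<Rightarrow> bool" where
  "has_fp e a b h v \<longleftrightarrow> (\<exists>W G0 G1.
     fp_prim (a + 1) (\<lambda>t. (1 - t) powr b * h t) e G0 \<and>
     fp_prim (b + 1) (\<lambda>t. (1 - t) powr a * h (1 - t)) e G1 \<and>
     (\<forall>x\<in>{0<..<1}. (W has_vector_derivative jw a b (of_real x) * h (of_real x)) (at x)) \<and>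
     (\<forall>x\<in>{0<..<e}. W x = of_real x powr (a + 1) * G0 (of_real x) \<and>
        W (1 - x) = v - of_real x powr (b + 1) * G1 (of_real x)))"

text \<open>The three pieces are W(x), W(1 - x) - W(x) and v - W(1 - x), which telescope; hence the
  sum does not depend on the truncation.\<close>

lemma has_fp_formula:
  assumes "has_fp e a b h v" "e \<le> 1/2" "nonres a" "nonres b" and x: "0 < x" "x < e"
  shows "v = hfp0 (a + 1) (\<lambda>t. (1 - t) powr b * h t) x
          + integral {x..1 - x} (\<lambda>x::real. jw a b (of_real x) * h (of_real x))
          + hfp0 (b + 1) (\<lambda>t. (1 - t) powr a * h (1 - t)) x"
proof -
  from assms(1) obtain W G0 G1 where
    G0: "fp_prim (a + 1) (\<lambda>t. (1 - t) powr b * h t) e G0" and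
    G1: "fp_prim (b + 1) (\<lambda>t. (1 - t) powr a * h (1 - t)) e G1" and
    W: "\<And>x. x\<in>{0<..<1} \<Longrightarrow> (W has_vector_derivative jw a b (of_real x) * h (of_real x)) (at x)" and
    W0: "\<And>x. x\<in>{0<..<e} \<Longrightarrow> W x = of_real x powr (a + 1) * G0 (of_real x) \<and>
        W (1 - x) = v - of_real x powr (b + 1) * G1 (of_real x)"
    unfolding has_fp_def by blast
  have "((\<lambda>x. jw a b (of_real x) * h (of_real x)) has_integral (W (1 - x) - W x)) {x..1 - x}"
    by (rule fundamental_theorem_of_calculus)
       (use x assms(2) in \<open>auto intro!: has_vector_derivative_at_within[OF W]\<close>)
  then have "integral {x..1 - x} (\<lambda>x::real. jw a b (of_real x) * h (of_real x)) = W (1 - x) - W x"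
    by (rule integral_unique)
  moreover have "hfp0 (a + 1) (\<lambda>t. (1 - t) powr b * h t) x = W x"
    using hfp0_eq_fp_prim[OF G0 _ x] assms(3) W0[of x] x by (simp add: nonres_def)
  moreover have "hfp0 (b + 1) (\<lambda>t. (1 - t) powr a * h (1 - t)) x = v - W (1 - x)"
    using hfp0_eq_fp_prim[OF G1 _ x] assms(4) W0[of x] x by (simp add: nonres_def)
  ultimately show ?thesis by simp
qed

lemma hadamard_eqI:
  assumes "has_fp e a b h v" "0 < e" "e \<le> 1/2" "nonres a" "nonres b"
  shows "hadamard a b h = v"
  unfolding hadamard_def
proof (rule the_equality)
  show "\<exists>e>0. \<forall>\<epsilon>::real. 0 < \<epsilon> \<and> \<epsilon> < e \<longrightarrow>
        v = hfp0 (a + 1) (\<lambda>t. (1 - t) powr b * h t) \<epsilon>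
          + integral {\<epsilon>..1 - \<epsilon>} (\<lambda>x::real. jw a b (of_real x) * h (of_real x))
          + hfp0 (b + 1) (\<lambda>t. (1 - t) powr a * h (1 - t)) \<epsilon>"
    using has_fp_formula[OF assms(1,3-5)] assms(2) by blast
next
  fix v'
  assume "\<exists>e>0. \<forall>\<epsilon>::real. 0 < \<epsilon> \<and> \<epsilon> < e \<longrightarrow>
        v' = hfp0 (a + 1) (\<lambda>t. (1 - t) powr b * h t) \<epsilon>
          + integral {\<epsilon>..1 - \<epsilon>} (\<lambda>x::real. jw a b (of_real x) * h (of_real x))
          + hfp0 (b + 1) (\<lambda>t. (1 - t) powr a * h (1 - t)) \<epsilon>"
  then obtain e' where e': "e' > 0" "\<And>\<epsilon>. 0 < \<epsilon> \<Longrightarrow> \<epsilon> < e' \<Longrightarrow>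
        v' = hfp0 (a + 1) (\<lambda>t. (1 - t) powr b * h t) \<epsilon>
          + integral {\<epsilon>..1 - \<epsilon>} (\<lambda>x::real. jw a b (of_real x) * h (of_real x))
          + hfp0 (b + 1) (\<lambda>t. (1 - t) powr a * h (1 - t)) \<epsilon>" by blast
  define x where "x = min e e' / 2"
  have "0 < x" "x < e" "x < e'" using e' assms(2) by (auto simp: x_def)
  then show "v' = v"
    using has_fp_formula[OF assms(1,3-5), of x] e'(2)[of x] by simp
qed

lemma has_fp_add:
  assumes "has_fp e a b h v" "has_fp e a b h2 v2"
  shows "has_fp e a b (\<lambda>x. h x + h2 x) (v + v2)"
proof -
  from assms(1) obtain W G0 G1 where
    G: "fp_prim (a + 1) (\<lambda>t. (1 - t) powr b * h t) e G0"
    "fp_prim (b + 1) (\<lambda>t. (1 - t) powr a * h (1 - t)) e G1"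
    "\<forall>x\<in>{0<..<1}. (W has_vector_derivative jw a b (of_real x) * h (of_real x)) (at x)"
    "\<forall>x\<in>{0<..<e}. W x = of_real x powr (a + 1) * G0 (of_real x) \<and>
        W (1 - x) = v - of_real x powr (b + 1) * G1 (of_real x)"
    unfolding has_fp_def by blast
  from assms(2) obtain W2 G02 G12 where
    G2: "fp_prim (a + 1) (\<lambda>t. (1 - t) powr b * h2 t) e G02"
    "fp_prim (b + 1) (\<lambda>t. (1 - t) powr a * h2 (1 - t)) e G12"
    "\<forall>x\<in>{0<..<1}. (W2 has_vector_derivative jw a b (of_real x) * h2 (of_real x)) (at x)"
    "\<forall>x\<in>{0<..<e}. W2 x = of_real x powr (a + 1) * G02 (of_real x) \<and>
        W2 (1 - x) = v2 - of_real x powr (b + 1) * G12 (of_real x)"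
    unfolding has_fp_def by blast
  show ?thesis unfolding has_fp_def
  proof (intro exI conjI)
    show "fp_prim (a + 1) (\<lambda>t. (1 - t) powr b * (h t + h2 t)) e (\<lambda>x. G0 x + G02 x)"
      using fp_prim_add[OF G(1) G2(1)] by (simp add: distrib_left)
    show "fp_prim (b + 1) (\<lambda>t. (1 - t) powr a * (h (1 - t) + h2 (1 - t))) e (\<lambda>x. G1 x + G12 x)"
      using fp_prim_add[OF G(2) G2(2)] by (simp add: distrib_left)
    show "\<forall>x\<in>{0<..<1}. ((\<lambda>x. W x + W2 x) has_vector_derivative
        jw a b (of_real x) * (h (of_real x) + h2 (of_real x))) (at x)"
      using G(3) G2(3) by (auto simp: distrib_left intro!: has_vector_derivative_add)
  qed (use G(4) G2(4) in \<open>auto simp: algebra_simps\<close>)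
qed

lemma has_fp_cmult:
  assumes "has_fp e a b h v"
  shows "has_fp e a b (\<lambda>x. c * h x) (c * v)"
proof -
  from assms(1) obtain W G0 G1 where
    G: "fp_prim (a + 1) (\<lambda>t. (1 - t) powr b * h t) e G0"
    "fp_prim (b + 1) (\<lambda>t. (1 - t) powr a * h (1 - t)) e G1"
    "\<forall>x\<in>{0<..<1}. (W has_vector_derivative jw a b (of_real x) * h (of_real x)) (at x)"
    "\<forall>x\<in>{0<..<e}. W x = of_real x powr (a + 1) * G0 (of_real x) \<and>
        W (1 - x) = v - of_real x powr (b + 1) * G1 (of_real x)"
    unfolding has_fp_def by blast
  show ?thesis unfolding has_fp_def
  proof (intro exI conjI)
    show "fp_prim (a + 1) (\<lambda>t. (1 - t) powr b * (c * h t)) e (\<lambda>x. c * G0 x)"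
      using fp_prim_cmult[OF G(1), of c] by (simp add: mult.left_commute)
    show "fp_prim (b + 1) (\<lambda>t. (1 - t) powr a * (c * h (1 - t))) e (\<lambda>x. c * G1 x)"
      using fp_prim_cmult[OF G(2), of c] by (simp add: mult.left_commute)
    show "\<forall>x\<in>{0<..<1}. ((\<lambda>x. c * W x) has_vector_derivative jw a b (of_real x) * (c * h (of_real x))) (at x)"
      using G(3) has_vector_derivative_mult_right[where a = c] by (fastforce simp: mult.left_commute)
  qed (use G(4) in \<open>auto simp: algebra_simps\<close>)
qed

text \<open>Reflection turns W into v - W(1 - x), a primitive normalised at the other
  endpoint.\<close>

lemma has_fp_reflect:
  assumes "has_fp e a b h v" "e \<le> 1"
  shows "has_fp e b a (\<lambda>x. h (1 - x)) v"
proof -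
  from assms(1) obtain W G0 G1 where
    G: "fp_prim (a + 1) (\<lambda>t. (1 - t) powr b * h t) e G0"
    "fp_prim (b + 1) (\<lambda>t. (1 - t) powr a * h (1 - t)) e G1"
    and W: "\<And>x. x\<in>{0<..<1} \<Longrightarrow> (W has_vector_derivative jw a b (of_real x) * h (of_real x)) (at x)"
    and E: "\<forall>x\<in>{0<..<e}. W x = of_real x powr (a + 1) * G0 (of_real x) \<and>
        W (1 - x) = v - of_real x powr (b + 1) * G1 (of_real x)"
    unfolding has_fp_def by blast
  show ?thesis unfolding has_fp_def
  proof (intro exI conjI)
    show "\<forall>x\<in>{0<..<1}. ((\<lambda>x. v - W (1 - x)) has_vector_derivative jw b a (of_real x) * h (1 - of_real x)) (at x)"
    proof
      fix x :: real assume "x \<in> {0<..<1}"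
      then have "(W has_vector_derivative jw a b (of_real (1 - x)) * h (of_real (1 - x))) (at (1 - x))"
        using W[of "1 - x"] by auto
      then have "((W \<circ> (\<lambda>x. 1 - x)) has_vector_derivative (-1) *\<^sub>R (jw a b (of_real (1 - x)) * h (of_real (1 - x)))) (at x)"
        by (intro vector_diff_chain_at) (auto intro!: derivative_eq_intros)
      from has_vector_derivative_diff[OF has_vector_derivative_const[of v] this]
      show "((\<lambda>x. v - W (1 - x)) has_vector_derivative jw b a (of_real x) * h (1 - of_real x)) (at x)"
        by (simp add: o_def jw_def mult.commute)
    qed
    show "fp_prim (b + 1) (\<lambda>t. (1 - t) powr a * h (1 - t)) e G1" by (rule G)
    show "fp_prim (a + 1) (\<lambda>t. (1 - t) powr b * h (1 - (1 - t))) e G0" using G(1) by simp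
  qed (use E in auto)
qed

text \<open>One W serves both sides; only the factor x changes place, as in
  \<open>fp_prim_shift\<close>.\<close>

lemma has_fp_shift:
  assumes "has_fp e (a + 1) b h v" "e \<le> 1/2"
  shows "has_fp e a b (\<lambda>x. x * h x) v"
proof -
  from assms(1) obtain W G0 G1 where
    G: "fp_prim (a + 1 + 1) (\<lambda>t. (1 - t) powr b * h t) e G0"
    "fp_prim (b + 1) (\<lambda>t. (1 - t) powr (a + 1) * h (1 - t)) e G1"
    and W: "\<And>x. x\<in>{0<..<1} \<Longrightarrow> (W has_vector_derivative jw (a + 1) b (of_real x) * h (of_real x)) (at x)"
    and E: "\<forall>x\<in>{0<..<e}. W x = of_real x powr (a + 1 + 1) * G0 (of_real x) \<and>
        W (1 - x) = v - of_real x powr (b + 1) * G1 (of_real x)"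
    unfolding has_fp_def by blast
  show ?thesis unfolding has_fp_def
  proof (intro exI conjI)
    show "fp_prim (a + 1) (\<lambda>t. (1 - t) powr b * (t * h t)) e (\<lambda>t. t * G0 t)"
      using fp_prim_shift[OF G(1)] by (simp add: mult.left_commute)
    show "fp_prim (b + 1) (\<lambda>t. (1 - t) powr a * ((1 - t) * h (1 - t))) e G1"
    proof (rule fp_prim_cong[OF G(2)])
      fix t :: complex assume "t \<in> ball 0 e"
      then have "1 - t \<noteq> 0" using assms(2) by auto
      then show "(1 - t) powr (a + 1) * h (1 - t) = (1 - t) powr a * ((1 - t) * h (1 - t))"
        by (simp add: powr_add)
    qed
    show "\<forall>x\<in>{0<..<1}. (W has_vector_derivative jw a b (of_real x) * (of_real x * h (of_real x))) (at x)"
    proof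
      fix x :: real assume x: "x \<in> {0<..<1}"
      then have "jw a b (of_real x) * (of_real x * h (of_real x)) = jw (a + 1) b (of_real x) * h (of_real x)"
        by (simp add: jw_def powr_add)
      then show "(W has_vector_derivative jw a b (of_real x) * (of_real x * h (of_real x))) (at x)"
        using W[OF x] by (simp only:)
    qed
    show "\<forall>x\<in>{0<..<e}. W x = of_real x powr (a + 1) * (of_real x * G0 (of_real x)) \<and>
        W (1 - x) = v - of_real x powr (b + 1) * G1 (of_real x)"
      using E by (auto simp: powr_add power2_eq_square)
  qed
qed

section \<open>Existence of the finite part by gluing primitives\<close>

lemma fp_prim_vector_derivative:
  assumes "fp_prim (a + 1) F e G" "0 < x" "x < e"
  shows "((\<lambda>x. of_real x powr (a + 1) * G (of_real x)) has_vector_derivative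
     of_real x powr a * F (of_real x)) (at x)"
proof -
  let ?x = "complex_of_real x"
  have "?x \<in> ball 0 e" using assms by auto
  then obtain D where D: "(G has_field_derivative D) (at ?x)" "(a + 1) * G ?x + ?x * D = F ?x"
    using assms(1) unfolding fp_prim_def by blast
  have x: "?x \<notin> \<real>\<^sub>\<le>\<^sub>0" using assms by (simp add: complex_nonpos_Reals_iff)
  have "((\<lambda>z. z powr (a + 1) * G z) has_field_derivative
     ((a + 1) * ?x powr (a + 1 - 1)) * G ?x + D * ?x powr (a + 1)) (at ?x)"
    by (rule DERIV_mult[OF has_field_derivative_powr[OF x] D(1)])
  also have "((a + 1) * ?x powr (a + 1 - 1)) * G ?x + D * ?x powr (a + 1) = ?x powr a * F ?x"
    using D(2)[symmetric] assms(2) by (simp add: powr_add algebra_simps)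
  finally show ?thesis
    by (rule has_vector_derivative_real_field)
qed

lemma vector_derivative_zero_imp_constant:
  fixes f :: "real \<Rightarrow> complex"
  assumes "\<And>x. x \<in> {0<..<e} \<Longrightarrow> (f has_vector_derivative 0) (at x)"
  obtains c where "\<And>x. x \<in> {0<..<e} \<Longrightarrow> f x = c"
proof -
  have "\<exists>c. \<forall>x\<in>{0<..<e}. f x = c"
    by (rule has_derivative_zero_constant)
       (use assms in \<open>auto simp: has_vector_derivative_def intro: has_derivative_at_withinI\<close>)
  then show ?thesis using that by blast
qed

text \<open>Half the excess r - 1 keeps a disc about either endpoint inside \<open>ell r\<close>;
  the cap 1/2 separates the two end intervals and keeps the discs away from the branch point of (1 -
  t)^b at t = 1.\<close>

definition erad :: "real \<Rightarrow> real" where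
  "erad r = min ((r - 1) / 2) (1 / 2)"

lemma erad_bounds: "1 < r \<Longrightarrow> 0 < erad r" "erad r \<le> 1/2"
  by (auto simp: erad_def)

lemma ball_erad_subset_ell: "ball 0 (erad r) \<subseteq> ell r"
  by (auto intro!: small_ball_in_ell simp: erad_def)

lemma one_minus_not_nonpos: "cmod t < 1 \<Longrightarrow> 1 - t \<notin> \<real>\<^sub>\<le>\<^sub>0"
  using complex_Re_le_cmod[of t] by (auto simp: complex_nonpos_Reals_iff)

lemma holomorphic_endpoint:
  assumes "h holomorphic_on ell r"
  shows "(\<lambda>t. (1 - t) powr b * h t) holomorphic_on ball 0 (erad r)"
    "(\<lambda>t. (1 - t) powr b * h (1 - t)) holomorphic_on ball 0 (erad r)"
proof -
  have p: "(\<lambda>t. (1 - t) powr b) holomorphic_on ball 0 (erad r)"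
    using erad_bounds(2)[of r]
    by (intro holomorphic_intros one_minus_not_nonpos) auto
  have h: "h holomorphic_on ball 0 (erad r)"
    using assms ball_erad_subset_ell holomorphic_on_subset by blast
  have "h \<circ> (\<lambda>t. 1 - t) holomorphic_on ball 0 (erad r)"
    by (rule holomorphic_on_compose_gen[OF _ assms])
       (use ball_erad_subset_ell ell_reflect in \<open>auto intro!: holomorphic_intros\<close>)
  then show "(\<lambda>t. (1 - t) powr b * h t) holomorphic_on ball 0 (erad r)"
    "(\<lambda>t. (1 - t) powr b * h (1 - t)) holomorphic_on ball 0 (erad r)"
    using p h by (simp_all add: holomorphic_on_mult o_def)
qed

lemma jw_holomorphic:
  "jw a b holomorphic_on {z. 0 < Re z \<and> Re z < 1}"
  unfolding jw_def by (intro holomorphic_intros) (auto simp: complex_nonpos_Reals_iff)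

text \<open>The primitives at the endpoints are rigid, while the one on the open interval has a free
  additive constant. Matching at 0 uses up that constant, and the mismatch left at 1 is the value
  v.\<close>

lemma has_fp_exists:
  assumes "1 < r" "h holomorphic_on ell r" "nonres a" "nonres b"
  shows "\<exists>v. has_fp (erad r) a b h v"
proof -
  define e where "e = erad r"
  have e: "0 < e" "e \<le> 1/2" using erad_bounds assms(1) by (auto simp: e_def)
  obtain G0 where G0: "fp_prim (a + 1) (\<lambda>t. (1 - t) powr b * h t) e G0"
    using fp_prim_exists[OF holomorphic_endpoint(1)[OF assms(2)]] assms(3)
    unfolding nonres_def e_def by metis
  obtain G1 where G1: "fp_prim (b + 1) (\<lambda>t. (1 - t) powr a * h (1 - t)) e G1"
    using fp_prim_exists[OF holomorphic_endpoint(2)[OF assms(2)]] assms(4)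
    unfolding nonres_def e_def by metis
  \<comment> \<open>On the strip 0 < Re z < 1 both powers are analytic, and the intersection with
    the ellipse is convex, so the integrand has a primitive there.\<close>
  define S where "S = ell r \<inter> {z. 0 < Re z \<and> Re z < 1}"
  have "convex {z. 0 < Re z \<and> Re z < 1}"
    using convex_Int[OF convex_halfspace_Re_gt[of 0] convex_halfspace_Re_lt[of 1]]
    by (simp add: Collect_conj_eq)
  then have S: "convex S" unfolding S_def by (intro convex_Int convex_ell)
  have "open {z. 0 < Re z \<and> Re z < 1}"
    by (intro open_Collect_conj open_halfspace_Re_gt open_halfspace_Re_lt)
  then have S': "open S" unfolding S_def by (intro open_Int open_ell)
  have "(\<lambda>z. jw a b z * h z) holomorphic_on S"
    by (intro holomorphic_on_mult holomorphic_on_subset[OF assms(2)] holomorphic_on_subset[OF jw_holomorphic])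
       (auto simp: S_def)
  from holomorphic_convex_primitive'[OF S S' this] obtain g where
    g: "\<And>x. x \<in> S \<Longrightarrow> (g has_field_derivative jw a b x * h x) (at x within S)" by blast
  have g': "((\<lambda>x. g (of_real x)) has_vector_derivative jw a b (of_real x) * h (of_real x)) (at x)"
    if "x \<in> {0<..<1}" for x :: real
  proof -
    have xS: "of_real x \<in> S" using that unit_interval_in_ell[OF assms(1), of x] by (auto simp: S_def)
    have "(g has_field_derivative jw a b (of_real x) * h (of_real x)) (at (of_real x))"
      using g[OF xS] unfolding at_within_open[OF xS S'] .
    then show ?thesis by (rule has_vector_derivative_real_field)
  qed
  have "((\<lambda>x. g (of_real x) - of_real x powr (a + 1) * G0 (of_real x)) has_vector_derivative 0) (at x)"
    if "x \<in> {0<..<e}" for x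
    using has_vector_derivative_diff[OF g'[of x] fp_prim_vector_derivative[OF G0, of x]] that e
    by (simp add: jw_def mult.assoc)
  then obtain c where c: "\<And>x. x \<in> {0<..<e} \<Longrightarrow> g (of_real x) - of_real x powr (a + 1) * G0 (of_real x) = c"
    using vector_derivative_zero_imp_constant by blast
  define W where "W x = g (of_real x) - c" for x :: real
  have W: "(W has_vector_derivative jw a b (of_real x) * h (of_real x)) (at x)" if "x \<in> {0<..<1}" for x
    using has_vector_derivative_diff[OF g'[OF that] has_vector_derivative_const[of c]] by (simp add: W_def[abs_def])
  have "((\<lambda>x. W (1 - x) + of_real x powr (b + 1) * G1 (of_real x)) has_vector_derivative 0) (at x)"
    if "x \<in> {0<..<e}" for x
  proof -
    have "((W \<circ> (\<lambda>x. 1 - x)) has_vector_derivative (-1) *\<^sub>R (jw a b (of_real (1 - x)) * h (of_real (1 - x)))) (at x)"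
      by (intro vector_diff_chain_at) (use that e W in \<open>auto intro!: derivative_eq_intros simp del: of_real_diff\<close>)
    from has_vector_derivative_add[OF this fp_prim_vector_derivative[OF G1, of x]] that
    show ?thesis by (simp add: o_def jw_def algebra_simps)
  qed
  then obtain v where "\<And>x. x \<in> {0<..<e} \<Longrightarrow> W (1 - x) + of_real x powr (b + 1) * G1 (of_real x) = v"
    using vector_derivative_zero_imp_constant by blast
  then show ?thesis unfolding has_fp_def e_def[symmetric]
    using G0 G1 W c by (intro exI[of _ v] exI[of _ W] exI[of _ G0] exI[of _ G1] conjI ballI)
       (auto simp: W_def diff_eq_eq eq_diff_eq)
qed

section \<open>Linearity, shifts and reflection of the finite part\<close>

lemma hadamard_has_fp:
  assumes "1 < r" "h holomorphic_on ell r" "nonres a" "nonres b"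
  shows "has_fp (erad r) a b h (hadamard a b h)"
  using has_fp_exists[OF assms] hadamard_eqI[OF _ erad_bounds(1)[OF assms(1)] erad_bounds(2) assms(3,4)]
  by metis

lemma hadamard_add:
  assumes "1 < r" "h holomorphic_on ell r" "h2 holomorphic_on ell r" "nonres a" "nonres b"
  shows "hadamard a b (\<lambda>x. h x + h2 x) = hadamard a b h + hadamard a b h2"
  by (rule hadamard_eqI[OF has_fp_add[OF hadamard_has_fp hadamard_has_fp] erad_bounds(1)[OF assms(1)] erad_bounds(2)])
     (use assms in auto)

lemma hadamard_cmult:
  assumes "1 < r" "h holomorphic_on ell r" "nonres a" "nonres b"
  shows "hadamard a b (\<lambda>x. c * h x) = c * hadamard a b h"
  by (rule hadamard_eqI[OF has_fp_cmult[OF hadamard_has_fp] erad_bounds(1)[OF assms(1)] erad_bounds(2)])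
     (use assms in auto)

lemma nonres_plus1: "nonres a \<Longrightarrow> nonres (a + 1)"
  unfolding nonres_def by (metis add.assoc add.commute of_nat_Suc)

lemma hadamard_shift_left:
  assumes "1 < r" "h holomorphic_on ell r" "nonres a" "nonres b"
  shows "hadamard (a + 1) b h = hadamard a b (\<lambda>x. x * h x)"
proof -
  have "has_fp (erad r) a b (\<lambda>x. x * h x) (hadamard (a + 1) b h)"
    by (intro has_fp_shift erad_bounds hadamard_has_fp nonres_plus1 assms)
  from hadamard_eqI[OF this erad_bounds(1)[OF assms(1)] erad_bounds(2) assms(3,4)]
  show ?thesis by simp
qed

lemma hadamard_reflect:
  assumes "1 < r" "h holomorphic_on ell r" "nonres a" "nonres b"
  shows "hadamard b a (\<lambda>x. h (1 - x)) = hadamard a b h"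
proof -
  have "has_fp (erad r) b a (\<lambda>x. h (1 - x)) (hadamard a b h)"
    using erad_bounds(2)[of r] by (intro has_fp_reflect hadamard_has_fp assms) auto
  from hadamard_eqI[OF this erad_bounds(1)[OF assms(1)] erad_bounds(2) assms(4,3)]
  show ?thesis by simp
qed

text \<open>Conjugation of the left shift by the reflection x -> 1 - x.\<close>

lemma hadamard_shift_right:
  assumes "1 < r" "h holomorphic_on ell r" "nonres a" "nonres b"
  shows "hadamard a (b + 1) h = hadamard a b (\<lambda>x. (1 - x) * h x)"
proof -
  have h1: "(\<lambda>x. h (1 - x)) holomorphic_on ell r"
    by (rule holomorphic_on_compose_gen[of "\<lambda>x. 1 - x" "ell r" h "ell r", unfolded o_def])
       (use assms(2) ell_reflect in \<open>auto intro!: holomorphic_intros\<close>)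
  have h2: "(\<lambda>x. (1 - x) * h x) holomorphic_on ell r"
    by (intro holomorphic_intros assms)
  have "hadamard a (b + 1) h = hadamard (b + 1) a (\<lambda>x. h (1 - x))"
    using hadamard_reflect[of r h a "b + 1"] assms nonres_plus1 by auto
  also have "\<dots> = hadamard b a (\<lambda>x. x * h (1 - x))"
    using hadamard_shift_left[OF assms(1) h1] assms by auto
  also have "\<dots> = hadamard a b (\<lambda>x. (1 - x) * h x)"
    using hadamard_reflect[OF assms(1) h2 assms(3,4)] by simp
  finally show ?thesis .
qed

section \<open>Annihilation of exact derivatives, and boundedness\<close>

lemma jw_plus1:
  assumes "z \<noteq> 0" "z \<noteq> 1"
  shows "jw (a + 1) (b + 1) z = z * (1 - z) * jw a b z"
  using assms by (simp add: jw_def powr_add)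

lemma has_field_derivative_jw_plus1:
  assumes "z \<notin> \<real>\<^sub>\<le>\<^sub>0" "1 - z \<notin> \<real>\<^sub>\<le>\<^sub>0"
  shows "(jw (a + 1) (b + 1) has_field_derivative ((a + 1) - (a + b + 2) * z) * jw a b z) (at z)"
proof -
  have nz: "z \<noteq> 0" "1 - z \<noteq> 0" using assms by auto
  have p: "w powr (c + 1) = w * w powr c" if "w \<noteq> 0" for w c :: complex
    using that by (simp add: powr_add)
  have "((\<lambda>z. (1 - z) powr (b + 1)) has_field_derivative ((b + 1) * (1 - z) powr (b + 1 - 1)) * (0 - 1)) (at z)"
    by (rule DERIV_chain2[OF has_field_derivative_powr[OF assms(2)] DERIV_diff[OF DERIV_const DERIV_ident]])
  from DERIV_mult[OF has_field_derivative_powr[OF assms(1), of "a + 1"] this]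
  have "(jw (a + 1) (b + 1) has_field_derivative (a + 1) * z powr a * (1 - z) powr (b + 1)
      - (b + 1) * (1 - z) powr b * z powr (a + 1)) (at z)"
    by (simp add: jw_def[abs_def])
  also have "(a + 1) * z powr a * (1 - z) powr (b + 1) - (b + 1) * (1 - z) powr b * z powr (a + 1)
     = ((a + 1) - (a + b + 2) * z) * jw a b z"
    unfolding p[OF nz(1)] p[OF nz(2)] jw_def by (simp add: algebra_simps)
  finally show ?thesis .
qed

text \<open>With w = x^a (1 - x)^b and q = x (1 - x) this is (q w p)' / w: the linear factor is q' +
  q w' / w, in which q cancels the poles of w' / w.\<close>

definition jT :: "complex \<Rightarrow> complex \<Rightarrow> complex poly \<Rightarrow> complex poly" where
  "jT a b p = [:0, 1, -1:] * pderiv p + [:a + 1, - (a + b + 2):] * p"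

lemma poly_jT: "poly (jT a b p) z = z * (1 - z) * poly (pderiv p) z + ((a + 1) - (a + b + 2) * z) * poly p z"
  by (simp add: jT_def algebra_simps)

lemma has_field_derivative_jT:
  assumes "z \<notin> \<real>\<^sub>\<le>\<^sub>0" "1 - z \<notin> \<real>\<^sub>\<le>\<^sub>0"
  shows "((\<lambda>z. jw (a + 1) (b + 1) z * poly p z) has_field_derivative jw a b z * poly (jT a b p) z) (at z)"
proof -
  have nz: "z \<noteq> 0" "z \<noteq> 1" using assms by auto
  show ?thesis
    using DERIV_mult[OF has_field_derivative_jw_plus1[OF assms, of a b] poly_DERIV[of p z]]
    unfolding jw_plus1[OF nz] poly_jT by (simp add: algebra_simps)
qed

text \<open>Near 0 the function q w p is t^(a + 1) times an analytic function, so it is itself the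
  primitive without constant term.\<close>

lemma fp_prim_powr_poly:
  assumes "e \<le> 1"
  shows "fp_prim (a + 1) (\<lambda>t. (1 - t) powr b * poly (jT a b p) t) e (\<lambda>t. (1 - t) powr (b + 1) * poly p t)"
  unfolding fp_prim_def
proof (intro exI ballI conjI)
  fix t :: complex assume "t \<in> ball 0 e"
  then have t: "1 - t \<notin> \<real>\<^sub>\<le>\<^sub>0" using assms by (intro one_minus_not_nonpos) auto
  have "((\<lambda>z. (1 - z) powr (b + 1)) has_field_derivative ((b + 1) * (1 - t) powr (b + 1 - 1)) * (0 - 1)) (at t)"
    by (rule DERIV_chain2[OF has_field_derivative_powr[OF t] DERIV_diff[OF DERIV_const DERIV_ident]])
  from DERIV_mult[OF this poly_DERIV]
  show "((\<lambda>t. (1 - t) powr (b + 1) * poly p t) has_field_derivative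
     ((b + 1) * (1 - t) powr (b + 1 - 1)) * (0 - 1) * poly p t + poly (pderiv p) t * (1 - t) powr (b + 1)) (at t)" .
  have "(1 - t) powr (b + 1) = (1 - t) powr b * (1 - t)" using t by (auto simp: powr_add)
  note p = this
  show "(a + 1) * ((1 - t) powr (b + 1) * poly p t) + t * (((b + 1) * (1 - t) powr (b + 1 - 1)) * (0 - 1) * poly p t
     + poly (pderiv p) t * (1 - t) powr (b + 1)) = (1 - t) powr b * poly (jT a b p) t"
    unfolding p by (simp add: poly_jT algebra_simps)
qed


lemma poly_jT_reflect:
  "poly (jT b a (pcompose p [:1, -1:])) t = - poly (jT a b p) (1 - t)"
  by (simp add: poly_jT poly_pcompose pderiv_pcompose pderiv_pCons algebra_simps)

text \<open>Here W is q w p, which has no constant term at either endpoint; hence the value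
  0.\<close>

lemma hadamard_jT:
  assumes "nonres a" "nonres b"
  shows "hadamard a b (poly (jT a b p)) = 0"
proof (rule hadamard_eqI)
  let ?q = "pcompose p [:1, -1:]"
  show "has_fp (1/2) a b (poly (jT a b p)) 0"
    unfolding has_fp_def
  proof (intro exI conjI ballI)
    show "fp_prim (a + 1) (\<lambda>t. (1 - t) powr b * poly (jT a b p) t) (1/2) (\<lambda>t. (1 - t) powr (b + 1) * poly p t)"
      by (rule fp_prim_powr_poly) auto
    \<comment> \<open>The sign comes from the orientation at 1: W(1 - x) has to equal 0 - x^(b + 1)
      G1(x).\<close>
    show "fp_prim (b + 1) (\<lambda>t. (1 - t) powr a * poly (jT a b p) (1 - t)) (1/2)
       (\<lambda>t. (- 1) * ((1 - t) powr (a + 1) * poly ?q t))"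
      using fp_prim_cmult[OF fp_prim_powr_poly[of "1/2" b a ?q], of "-1"]
      by (simp add: poly_jT_reflect)
    show "((\<lambda>x. jw (a + 1) (b + 1) (of_real x) * poly p (of_real x)) has_vector_derivative
        jw a b (of_real x) * poly (jT a b p) (of_real x)) (at x)" if "x \<in> {0<..<1}" for x :: real
      using that
      by (intro has_vector_derivative_real_field has_field_derivative_jT) (auto simp: complex_nonpos_Reals_iff)
  qed (auto simp: jw_def poly_pcompose)
qed (use assms in auto)

text \<open>With the truncation fixed once, depending on r only, the end pieces are controlled by
  Cauchy estimates and the middle one by the maximum of |w|, so the constant is uniform in
  h.\<close>

lemma hadamard_bound:
  assumes "1 < r" "nonres a" "nonres b"
  shows "\<exists>C\<ge>0. \<forall>h M. h holomorphic_on ell r \<longrightarrow> (\<forall>z\<in>ell r. cmod (h z) \<le> M) \<longrightarrow> cmod (hadamard a b h) \<le> C * M"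
proof -
  \<comment> \<open>A third of the radius, because \<open>hfp0_bound\<close> works on a disc of
    radius 3x.\<close>
  define x where "x = erad r / 3"
  have x: "0 < x" "x < erad r" "x < 1 - x" using erad_bounds[of r] assms(1) by (auto simp: x_def)
  have "\<exists>B\<ge>0. \<forall>t\<in>ball 0 (erad r). cmod ((1 - t) powr c) \<le> B" for c
  proof -
    have "continuous_on (cball 0 (1/2)) (\<lambda>t::complex. (1 - t) powr c)"
      using one_minus_not_nonpos
      by (intro holomorphic_on_imp_continuous_on holomorphic_intros) auto
    then have "bounded ((\<lambda>t::complex. (1 - t) powr c) ` cball 0 (1/2))"
      by (intro compact_imp_bounded compact_continuous_image) auto
    then obtain B where B: "\<forall>y\<in>(\<lambda>t::complex. (1 - t) powr c) ` cball 0 (1/2). cmod y \<le> B"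
      unfolding bounded_iff by blast
    have "cmod ((1 - 0) powr c) \<le> B" by (intro B[rule_format] imageI) auto
    then have "B \<ge> 0" using norm_ge_zero order_trans by blast
    moreover have "cmod ((1 - t) powr c) \<le> B" if "t \<in> ball 0 (erad r)" for t
      using that erad_bounds(2)[of r] by (intro B[rule_format] imageI) auto
    ultimately show ?thesis by blast
  qed
  then obtain B where B: "\<And>c. B c \<ge> 0" "\<And>c t. t \<in> ball 0 (erad r) \<Longrightarrow> cmod ((1 - t) powr c) \<le> B c"
    by metis
  have jc: "continuous_on {x..1 - x} (\<lambda>x. jw a b (of_real x))"
    by (rule continuous_on_compose2[OF holomorphic_on_imp_continuous_on[OF jw_holomorphic]])
       (use x in \<open>auto intro!: continuous_intros\<close>)
  then have "bounded ((\<lambda>x. jw a b (of_real x)) ` {x..1 - x})"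
    by (intro compact_imp_bounded compact_continuous_image) auto
  then obtain J where J: "\<And>t. t \<in> {x..1 - x} \<Longrightarrow> cmod (jw a b (of_real t)) \<le> J"
    unfolding bounded_iff by blast
  have J0: "J \<ge> 0" using order_trans[OF norm_ge_zero J[of x]] x by simp
  obtain C0 where C0: "C0 \<ge> 0" "\<And>F M. F holomorphic_on ball 0 (3 * x) \<Longrightarrow> (\<forall>t\<in>ball 0 (3 * x). cmod (F t) \<le> M)
            \<Longrightarrow> cmod (hfp0 (a + 1) F x) \<le> C0 * M"
    using hfp0_bound[OF _ x(1), of "a + 1"] assms(2) unfolding nonres_def by blast
  obtain C1 where C1: "C1 \<ge> 0" "\<And>F M. F holomorphic_on ball 0 (3 * x) \<Longrightarrow> (\<forall>t\<in>ball 0 (3 * x). cmod (F t) \<le> M)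
            \<Longrightarrow> cmod (hfp0 (b + 1) F x) \<le> C1 * M"
    using hfp0_bound[OF _ x(1), of "b + 1"] assms(3) unfolding nonres_def by blast
  have e3: "3 * x = erad r" by (simp add: x_def)
  show ?thesis
  proof (intro exI[of _ "C0 * B b + J * (1 - x - x) + C1 * B a"] conjI allI impI)
    show "C0 * B b + J * (1 - x - x) + C1 * B a \<ge> 0" using C0 C1 J0 B x by auto
    fix h M assume h: "h holomorphic_on ell r" and M: "\<forall>z\<in>ell r. cmod (h z) \<le> M"
    have "cmod (h (of_real 0)) \<le> M"
      by (intro M[rule_format] unit_interval_in_ell assms(1)) auto
    then have M0: "M \<ge> 0" using norm_ge_zero order_trans by blast
    let ?F0 = "\<lambda>t. (1 - t) powr b * h t" and ?F1 = "\<lambda>t. (1 - t) powr a * h (1 - t)"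
    have "hadamard a b h = hfp0 (a + 1) ?F0 x + integral {x..1 - x} (\<lambda>x. jw a b (of_real x) * h (of_real x))
       + hfp0 (b + 1) ?F1 x"
      by (rule has_fp_formula[OF hadamard_has_fp[OF assms(1) h assms(2,3)] erad_bounds(2) assms(2,3) x(1,2)])
    moreover have "cmod (hfp0 (a + 1) ?F0 x) \<le> C0 * (B b * M)"
    proof (rule C0(2), unfold e3)
      show "?F0 holomorphic_on ball 0 (erad r)" by (rule holomorphic_endpoint[OF h])
      show "\<forall>t\<in>ball 0 (erad r). cmod (?F0 t) \<le> B b * M"
        unfolding norm_mult
        by (intro ballI mult_mono B M[rule_format] subsetD[OF ball_erad_subset_ell] norm_ge_zero)
    qed
    moreover have "cmod (hfp0 (b + 1) ?F1 x) \<le> C1 * (B a * M)"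
    proof (rule C1(2), unfold e3)
      show "?F1 holomorphic_on ball 0 (erad r)" by (rule holomorphic_endpoint[OF h])
      have "1 - t \<in> ell r" if "t \<in> ball 0 (erad r)" for t
        using that ball_erad_subset_ell ell_reflect by blast
      then show "\<forall>t\<in>ball 0 (erad r). cmod (?F1 t) \<le> B a * M"
        unfolding norm_mult by (intro ballI mult_mono B M[rule_format] norm_ge_zero)
    qed
    moreover have "cmod (integral {x..1 - x} (\<lambda>x. jw a b (of_real x) * h (of_real x))) \<le> (J * M) * (1 - x - x)"
    proof (rule integral_bound)
      have hc: "continuous_on {x..1 - x} (\<lambda>x. h (of_real x))"
        by (rule continuous_on_compose2[OF holomorphic_on_imp_continuous_on[OF h]])
           (use x unit_interval_in_ell[OF assms(1)] in \<open>auto intro!: continuous_intros\<close>)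
      show "continuous_on {x..1 - x} (\<lambda>x. jw a b (of_real x) * h (of_real x))"
        by (intro continuous_on_mult jc hc)
      fix t assume t: "t \<in> {x..1 - x}"
      then have "of_real t \<in> ell r" using x unit_interval_in_ell[OF assms(1), of t] by auto
      then show "cmod (jw a b (of_real t) * h (of_real t)) \<le> J * M"
        unfolding norm_mult by (intro mult_mono J t M[rule_format] J0 norm_ge_zero)
    qed (use x in auto)
    ultimately have "cmod (hadamard a b h) \<le> C0 * (B b * M) + (J * M) * (1 - x - x) + C1 * (B a * M)"
      by (simp only:) (intro norm_triangle_mono)
    then show "cmod (hadamard a b h) \<le> (C0 * B b + J * (1 - x - x) + C1 * B a) * M"
      by (simp add: algebra_simps)
  qed
qed

section \<open>The Beta integral\<close>

text \<open>The derivative of t^a in a is t^a ln t, which is split below as (t ln t) t^(a - 1); the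
  first factor must be continuous up to t = 0. The bound |t ln t| <= 2 sqrt t comes from ln y <= y -
  1 at y = 1 / sqrt t.\<close>

lemma continuous_on_x_ln_x: "continuous_on {0..1::real} (\<lambda>t. t * ln t)"
  unfolding continuous_on_def
proof
  fix x :: real assume x: "x \<in> {0..1}"
  show "((\<lambda>t. t * ln t) \<longlongrightarrow> x * ln x) (at x within {0..1})"
  proof (cases "x = 0")
    case False
    then have "isCont (\<lambda>t. t * ln t) x" by (auto intro!: continuous_intros)
    then show ?thesis using continuous_at_imp_continuous_at_within continuous_within by blast
  next
    case True
    have b: "norm (t * ln t) \<le> 2 * sqrt t" if "t \<in> {0..1}" for t :: real
    proof (cases "t = 0")
      case False
      with that have t: "0 < t" "t \<le> 1" by auto
      have "ln (1 / sqrt t) \<le> 1 / sqrt t - 1" using t by (intro ln_le_minus_one) auto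
      then have "- ln t \<le> 2 * (1 / sqrt t - 1)" using t by (simp add: ln_div ln_sqrt)
      then have "- ln t \<le> 2 / sqrt t" by simp
      then have "t * (- ln t) \<le> t * (2 / sqrt t)" using t by (intro mult_left_mono) auto
      also have "\<dots> = 2 * sqrt t" using t by (simp add: field_simps)
      finally show ?thesis using t by (simp add: abs_mult)
    qed auto
    have "((\<lambda>t::real. t * ln t) \<longlongrightarrow> 0) (at 0 within {0..1})"
    proof (rule Lim_null_comparison)
      show "((\<lambda>t. 2 * sqrt t) \<longlongrightarrow> 0) (at 0 within {0..1})"
        using tendsto_mult[OF tendsto_const[of 2] tendsto_real_sqrt[OF tendsto_ident_at[of 0 "{0..1}"]]] by simp
      show "\<forall>\<^sub>F t in at 0 within {0..1}. norm (t * ln t) \<le> 2 * sqrt t"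
        using b unfolding eventually_at_filter by (intro always_eventually) blast
    qed
    then show ?thesis using True by simp
  qed
qed

definition beta_integral :: "complex \<Rightarrow> complex \<Rightarrow> complex" where
  "beta_integral a b = integral {0..1} (\<lambda>x::real. jw a b (of_real x))"

lemma continuous_on_jw:
  assumes "Re a > 0" "Re b > 0"
  shows "continuous_on {0..1} (\<lambda>x::real. jw a b (of_real x))"
  unfolding jw_def using assms by (intro continuous_intros) auto

text \<open>Differentiation under the integral sign; Re a > 1 makes t^(a - 1) continuous at
  0.\<close>

lemma beta_integral_holomorphic:
  assumes "Re b > 0"
  shows "(\<lambda>a. beta_integral a b) holomorphic_on {a. 1 < Re a}"
proof -
  let ?fx = "\<lambda>a t. of_real (t * ln t) * of_real t powr (a - 1) * (1 - of_real t) powr b"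
  have "(\<lambda>a. integral (cbox 0 1) (\<lambda>x::real. jw a b (of_real x))) holomorphic_on {a. 1 < Re a}"
  proof (rule leibniz_rule_holomorphic)
    fix a :: complex and t :: real assume a: "a \<in> {a. 1 < Re a}" and t: "t \<in> cbox 0 1"
    show "((\<lambda>a. jw a b (of_real t)) has_field_derivative ?fx a t) (at a within {a. 1 < Re a})"
    proof (cases "t = 0")
      case True then show ?thesis by (simp add: jw_def)
    next
      case False
      then have t0: "t > 0" using t by auto
      have "((\<lambda>a. of_real t powr a * (1 - of_real t) powr b) has_field_derivative
        Ln (of_real t) * of_real t powr a * (1 - of_real t) powr b) (at a)"
        using t0 by (auto intro!: derivative_eq_intros)
      moreover have "complex_of_real t powr a = of_real t powr (a - 1) * of_real t"
        using t0 powr_add[of "complex_of_real t" "a - 1" 1] by simp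
      moreover have "Ln (of_real t) = complex_of_real (ln t)" using t0 by (simp add: Ln_of_real)
      ultimately have "((\<lambda>a. jw a b (of_real t)) has_field_derivative ?fx a t) (at a)"
        unfolding jw_def by (simp add: mult_ac)
      then show ?thesis by (rule has_field_derivative_at_within)
    qed
  next
    fix a :: complex assume "a \<in> {a. 1 < Re a}"
    then show "(\<lambda>x. jw a b (of_real x)) integrable_on cbox 0 1"
      using continuous_on_jw[of a b] assms by (intro integrable_continuous) auto
  next
    have "continuous_on ({a. 1 < Re a} \<times> {0..1::real}) (\<lambda>p. complex_of_real (snd p * ln (snd p)))"
      by (intro continuous_intros continuous_on_compose2[OF continuous_on_x_ln_x]) auto
    then show "continuous_on ({a. 1 < Re a} \<times> cbox 0 1) (\<lambda>(a, t). ?fx a t)"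
      using assms unfolding case_prod_unfold
      by (intro continuous_on_mult continuous_on_powr_complex) (auto intro!: continuous_intros)
  qed (simp add: convex_halfspace_Re_gt)
  then show ?thesis by (simp add: beta_integral_def)
qed

lemma beta_integral_real:
  assumes "x > 0" "y > 0"
  shows "beta_integral (of_real x) (of_real y) = Beta (of_real x + 1) (of_real y + 1)"
proof -
  have "((\<lambda>t. t powr (x + 1 - 1) * (1 - t) powr (y + 1 - 1)) has_integral Beta (x + 1) (y + 1)) {0..1}"
    by (rule has_integral_Beta_real) (use assms in auto)
  from has_integral_linear[OF this bounded_linear_of_real, where 'a1 = complex]
  have "((\<lambda>t. complex_of_real (t powr x * (1 - t) powr y)) has_integral of_real (Beta (x + 1) (y + 1))) {0..1}"
    unfolding o_def add_diff_cancel_right' .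
  then have "((\<lambda>t. jw (of_real x) (of_real y) (of_real t)) has_integral of_real (Beta (x + 1) (y + 1))) {0..1}"
  proof (rule has_integral_eq[rotated])
    fix t :: real assume "t \<in> {0..1}"
    then show "complex_of_real (t powr x * (1 - t) powr y) = jw (of_real x) (of_real y) (of_real t)"
      using powr_of_real[of t x] powr_of_real[of "1 - t" y] by (simp add: jw_def)
  qed
  then have "beta_integral (of_real x) (of_real y) = of_real (Beta (x + 1) (y + 1))"
    unfolding beta_integral_def by (rule integral_unique)
  then show ?thesis using Beta_complex_of_real[of "x + 1" "y + 1"] by simp
qed

lemma not_nonpos_Int_Re: "Re z > 0 \<Longrightarrow> z \<notin> \<int>\<^sub>\<le>\<^sub>0"
  by (auto elim!: nonpos_Ints_cases)

lemma Beta_holomorphic: "(\<lambda>a. Beta (a + 1) (b + 1)) holomorphic_on {a. 1 < Re a}"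
  unfolding Beta_altdef by (intro holomorphic_intros not_nonpos_Int_Re) auto

lemma two_islimpt_reals: "(2::complex) islimpt {of_real x |x. x > 1}"
  unfolding islimpt_approachable
proof (intro allI impI)
  fix e :: real assume "e > 0"
  then show "\<exists>x'\<in>{of_real x |x. x > 1}. x' \<noteq> 2 \<and> dist x' (2::complex) < e"
    by (intro bexI[of _ "of_real (2 + e / 2)"]) (auto simp: dist_norm intro!: exI[of _ "2 + e / 2"])
qed

lemma tendsto_endpoint_zero:
  assumes "Re c > 0" "fp_prim \<gamma> F e G" "e > 0"
  shows "((\<lambda>x. of_real x powr c * G (of_real x)) \<longlongrightarrow> 0) (at_right 0)"
proof -
  have "isCont G 0"
    using fp_prim_holomorphic[OF assms(2)] assms(3)
    by (intro holomorphic_on_imp_continuous_on[THEN continuous_on_interior]) auto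
  then have G: "((\<lambda>x::real. G (of_real x)) \<longlongrightarrow> G (of_real 0)) (at_right 0)"
    by (intro isCont_tendsto_compose[of _ G] tendsto_intros) auto
  have "continuous_on {0..} (\<lambda>x::real. complex_of_real x powr c)"
    using assms(1) by (intro continuous_intros) auto
  then have "((\<lambda>x::real. complex_of_real x powr c) \<longlongrightarrow> complex_of_real 0 powr c) (at 0 within {0..})"
    unfolding continuous_on_def by (auto dest: bspec[of _ _ 0])
  then have "((\<lambda>x::real. complex_of_real x powr c) \<longlongrightarrow> complex_of_real 0 powr c) (at_right 0)"
    by (rule tendsto_within_subset) auto
  from tendsto_mult[OF this G] show ?thesis by simp
qed

lemma nonresI_Re: "Re a > -1 \<Longrightarrow> nonres a"
  unfolding nonres_def
proof (intro allI notI)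
  fix m :: nat assume a: "Re a > -1" and m: "of_nat m + (a + 1) = 0"
  have "Re (of_nat m + (a + 1)) = 0" unfolding m by simp
  then show False using a by simp
qed

text \<open>The endpoint terms x^(a + 1) G tend to 0, so the finite part is the limit of the
  truncated integrals, which is the ordinary integral.\<close>

lemma hadamard_one_eq_beta_integral:
  assumes "Re a > 0" "Re b > 0"
  shows "hadamard a b (\<lambda>_. 1) = beta_integral a b"
proof -
  have nr: "nonres a" "nonres b" using assms by (auto intro: nonresI_Re)
  define e where "e = erad 2"
  have e: "0 < e" "e \<le> 1/2" using erad_bounds[of 2] by (auto simp: e_def)
  have H: "has_fp e a b (\<lambda>_. 1) (hadamard a b (\<lambda>_. 1))"
    unfolding e_def by (rule hadamard_has_fp) (use nr in auto)
  obtain W G0 G1 where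
    G0: "fp_prim (a + 1) (\<lambda>t. (1 - t) powr b * 1) e G0" and
    G1: "fp_prim (b + 1) (\<lambda>t. (1 - t) powr a * 1) e G1" and
    W: "\<And>x. x\<in>{0<..<1} \<Longrightarrow> (W has_vector_derivative jw a b (of_real x) * 1) (at x)" and
    W0: "\<And>x. x\<in>{0<..<e} \<Longrightarrow> W x = of_real x powr (a + 1) * G0 (of_real x) \<and>
        W (1 - x) = hadamard a b (\<lambda>_. 1) - of_real x powr (b + 1) * G1 (of_real x)"
    using H unfolding has_fp_def by blast
  define \<Phi> where "\<Phi> x = integral {0..x} (\<lambda>x::real. jw a b (of_real x))" for x
  have int: "(\<lambda>x::real. jw a b (of_real x)) integrable_on {0..1}"
    using continuous_on_jw[OF assms] by (rule integrable_continuous_real)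
  have \<Phi>: "continuous_on {0..1} \<Phi>"
    unfolding \<Phi>_def by (rule indefinite_integral_continuous_1[OF int])
  have 1: "((\<lambda>x. W (1 - x) - W x) \<longlongrightarrow> hadamard a b (\<lambda>_. 1) - 0 - 0) (at_right 0)"
  proof (rule Lim_transform_eventually)
    show "((\<lambda>x. hadamard a b (\<lambda>_. 1) - of_real x powr (b + 1) * G1 (of_real x)
       - of_real x powr (a + 1) * G0 (of_real x)) \<longlongrightarrow> hadamard a b (\<lambda>_. 1) - 0 - 0) (at_right 0)"
      using assms e by (intro tendsto_diff tendsto_const tendsto_endpoint_zero[OF _ G0] tendsto_endpoint_zero[OF _ G1]) auto
    show "\<forall>\<^sub>F x in at_right 0. hadamard a b (\<lambda>_. 1) - of_real x powr (b + 1) * G1 (of_real x)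
       - of_real x powr (a + 1) * G0 (of_real x) = W (1 - x) - W x"
      using eventually_at_right_less[of 0] eventually_at_right_real[OF e(1)]
      by (auto elim!: eventually_mono simp: W0)
  qed
  have 2: "((\<lambda>x. W (1 - x) - W x) \<longlongrightarrow> \<Phi> 1 - \<Phi> 0) (at_right 0)"
  proof (rule Lim_transform_eventually)
    have "(\<Phi> \<longlongrightarrow> \<Phi> 0) (at 0 within {0..1})" "(\<Phi> \<longlongrightarrow> \<Phi> 1) (at 1 within {0..1})"
      using \<Phi> unfolding continuous_on_def by auto
    then have t: "(\<Phi> \<longlongrightarrow> \<Phi> 0) (at_right 0)" "(\<Phi> \<longlongrightarrow> \<Phi> 1) (at_left 1)"
      by (auto simp: at_within_Icc_at_right at_within_Icc_at_left)
    have "filterlim (\<lambda>x::real. 1 - x) (at_left 1) (at_right 0)"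
      by (auto simp: filterlim_at eventually_at_right_field intro!: tendsto_eq_intros exI[of _ 1])
    from filterlim_compose[OF t(2) this] t(1)
    show "((\<lambda>x. \<Phi> (1 - x) - \<Phi> x) \<longlongrightarrow> \<Phi> 1 - \<Phi> 0) (at_right 0)" by (intro tendsto_diff)
    have "\<Phi> (1 - x) - \<Phi> x = W (1 - x) - W x" if x: "x \<in> {0<..<1/2}" for x
    proof -
      have "((\<lambda>x. jw a b (of_real x) * 1) has_integral (W (1 - x) - W x)) {x..1 - x}"
        by (rule fundamental_theorem_of_calculus)
           (use x in \<open>auto intro!: has_vector_derivative_at_within[OF W[unfolded mult_1_right]]\<close>)
      then have "integral {x..1 - x} (\<lambda>x. jw a b (of_real x)) = W (1 - x) - W x"
        by (simp add: integral_unique)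
      moreover have "\<Phi> x + integral {x..1 - x} (\<lambda>x. jw a b (of_real x)) = \<Phi> (1 - x)"
        unfolding \<Phi>_def by (rule Henstock_Kurzweil_Integration.integral_combine)
          (use x int in \<open>auto intro: integrable_on_subinterval\<close>)
      ultimately show ?thesis by (metis add_diff_cancel_left')
    qed
    then show "\<forall>\<^sub>F x in at_right 0. \<Phi> (1 - x) - \<Phi> x = W (1 - x) - W x"
      using eventually_at_right_real[of 0 "1/2"] by (auto elim!: eventually_mono)
  qed
  have "hadamard a b (\<lambda>_. 1) = \<Phi> 1 - \<Phi> 0"
    using tendsto_unique[OF _ 1 2] by simp
  then show ?thesis by (simp add: \<Phi>_def beta_integral_def)
qed

lemma beta_integral_reflect:
  assumes "Re a > 0" "Re b > 0"
  shows "beta_integral a b = beta_integral b a"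
  using hadamard_reflect[of 2 "\<lambda>_. 1" a b] hadamard_one_eq_beta_integral[of a b]
    hadamard_one_eq_beta_integral[of b a] nonresI_Re[of a] nonresI_Re[of b] assms by auto

text \<open>Identity theorem in the first exponent: agreement on the reals above 1, which accumulate
  at 2, spreads to the half plane.\<close>

lemma beta_integral_eq_aux:
  assumes "Re b > 1" "\<And>x. x > 1 \<Longrightarrow> beta_integral (of_real x) b = Beta (of_real x + 1) (b + 1)" "Re a > 1"
  shows "beta_integral a b = Beta (a + 1) (b + 1)"
proof -
  have "beta_integral a b - Beta (a + 1) (b + 1) = 0"
    by (rule analytic_continuation[where f = "\<lambda>a. beta_integral a b - Beta (a + 1) (b + 1)"
          and S = "{a. 1 < Re a}", OF _ _ _ _ _ two_islimpt_reals])
       (use assms in \<open>auto intro!: holomorphic_on_diff beta_integral_holomorphic Beta_holomorphic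
          open_halfspace_Re_gt convex_connected convex_halfspace_Re_gt\<close>)
  then show ?thesis by simp
qed

lemma beta_integral_eq:
  assumes "Re a > 1" "Re b > 1"
  shows "beta_integral a b = Beta (a + 1) (b + 1)"
proof -
  \<comment> \<open>The second exponent becomes complex by exchanging the roles of a and b, so the
    continuation in one variable is applied twice.\<close>
  have r: "beta_integral a (of_real y) = Beta (a + 1) (of_real y + 1)" if "y > 1" "Re a > 1" for a y
    by (rule beta_integral_eq_aux) (use that beta_integral_real in auto)
  show ?thesis
  proof (rule beta_integral_eq_aux[OF assms(2) _ assms(1)])
    fix x :: real assume "x > 1"
    then show "beta_integral (of_real x) b = Beta (of_real x + 1) (b + 1)"
      using r[of x b] assms(2) beta_integral_reflect[of b "of_real x"] by (simp add: Beta_commute)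
  qed
qed

text \<open>The exact derivative of q w gives (a + 1) L 1 = (a + b + 2) L x, which is also the
  functional equation of the Beta function.\<close>

lemma hadamard_one_step_left:
  assumes "nonres a" "nonres b"
  shows "(a + b + 2) * hadamard (a + 1) b (\<lambda>_. 1) = (a + 1) * hadamard a b (\<lambda>_. 1)"
proof -
  define H X where "H = hadamard a b (\<lambda>_. 1)" and "X = hadamard a b (\<lambda>x. x)"
  have "hadamard a b (\<lambda>x. (a + 1) * 1 + - (a + b + 2) * x) = hadamard a b (\<lambda>x. (a + 1) * 1) + hadamard a b (\<lambda>x. - (a + b + 2) * x)"
    by (rule hadamard_add[of 2]) (use assms in \<open>auto intro!: holomorphic_intros\<close>)
  also have "hadamard a b (\<lambda>x. (a + 1) * 1) = (a + 1) * H"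
    unfolding H_def by (rule hadamard_cmult[of 2]) (use assms in auto)
  also have "hadamard a b (\<lambda>x. - (a + b + 2) * x) = - (a + b + 2) * X"
    unfolding X_def by (rule hadamard_cmult[of 2]) (use assms in auto)
  also have "(\<lambda>x. (a + 1) * 1 + - (a + b + 2) * x) = poly (jT a b 1)"
    by (auto simp: poly_jT pderiv_1 algebra_simps)
  finally have "(a + b + 2) * X = (a + 1) * H" using hadamard_jT[OF assms, of 1] by algebra
  moreover have "hadamard (a + 1) b (\<lambda>_. 1) = hadamard a b (\<lambda>x. x * 1)"
    using assms by (intro hadamard_shift_left[of 2]) auto
  ultimately show ?thesis by (simp add: H_def X_def)
qed

lemma nonres_imp_not_nonpos_Int:
  assumes "nonres a"
  shows "a + 1 \<notin> \<int>\<^sub>\<le>\<^sub>0"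
proof
  assume "a + 1 \<in> \<int>\<^sub>\<le>\<^sub>0"
  then obtain n where "a + 1 = - of_nat n" by (elim nonpos_Ints_cases')
  then show False using assms unfolding nonres_def by (auto dest: spec[of _ n])
qed

text \<open>Only a + 1 is divided out, so the case a + b + 2 = 0 is no exception.\<close>

lemma hadamard_one_Beta_step:
  assumes "nonres a" "nonres b" "hadamard (a + 1) b (\<lambda>_. 1) = Beta (a + 2) (b + 1)"
  shows "hadamard a b (\<lambda>_. 1) = Beta (a + 1) (b + 1)"
proof -
  have "(a + 1) * hadamard a b (\<lambda>_. 1) = (a + b + 2) * Beta (a + 2) (b + 1)"
    using hadamard_one_step_left[OF assms(1,2)] assms(3) by simp
  also have "\<dots> = (a + 1) * Beta (a + 1) (b + 1)"
    using Beta_plus1_left[OF nonres_imp_not_nonpos_Int[OF assms(1)], of "b + 1"] by (simp add: algebra_simps)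
  finally show ?thesis using assms(1) unfolding nonres_def by (auto dest: spec[of _ 0])
qed

text \<open>Continuation to the left by n unit steps of the functional equation, from a half plane
  where the formula is known.\<close>

lemma hadamard_one_descend:
  assumes "nonres b" "\<And>a. Re a > s + 1 \<Longrightarrow> nonres a \<Longrightarrow> hadamard a b (\<lambda>_. 1) = Beta (a + 1) (b + 1)"
  assumes "Re a + real n > s + 1" "nonres a"
  shows "hadamard a b (\<lambda>_. 1) = Beta (a + 1) (b + 1)"
  using assms(3,4)
proof (induction n arbitrary: a)
  case 0
  then show ?case using assms(2) by simp
next
  case (Suc n)
  have "hadamard (a + 1) b (\<lambda>_. 1) = Beta (a + 1 + 1) (b + 1)"
    using Suc.prems by (intro Suc.IH nonres_plus1) auto
  then show ?case using Suc.prems(2) assms(1)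
    by (intro hadamard_one_Beta_step) (simp_all only: add.assoc one_add_one)
qed

text \<open>Two descents, one per exponent: a is lowered while Re b > 1, then b is lowered with the
  roles exchanged by reflection.\<close>

lemma hadamard_one_eq_Beta:
  assumes "nonres a" "nonres b"
  shows "hadamard a b (\<lambda>_. 1) = Beta (a + 1) (b + 1)"
proof -
  have 1: "hadamard a b (\<lambda>_. 1) = Beta (a + 1) (b + 1)" if "nonres a" "Re b > 1" for a b
  proof -
    obtain n :: nat where "real n > 1 - Re a" using reals_Archimedean2 by blast
    then show ?thesis
      using that hadamard_one_eq_beta_integral beta_integral_eq
      by (intro hadamard_one_descend[of b 0 a n]) (auto intro: nonresI_Re)
  qed
  obtain n :: nat where n: "real n > 1 - Re b" using reals_Archimedean2 by blast
  have "hadamard b a (\<lambda>_. 1) = Beta (b + 1) (a + 1)"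
  proof (rule hadamard_one_descend[of a 0 b n])
    fix b' :: complex assume b': "0 + 1 < Re b'" "nonres b'"
    then show "hadamard b' a (\<lambda>_. 1) = Beta (b' + 1) (a + 1)"
      using 1[of a b'] hadamard_reflect[of 2 "\<lambda>_. 1" a b'] assms by (auto simp: Beta_commute)
  qed (use assms n in auto)
  then show ?thesis
    using hadamard_reflect[of 2 "\<lambda>_. 1" a b] assms by (auto simp: Beta_commute)
qed

section \<open>Jacobi polynomials and their orthogonality\<close>

fun jac :: "complex \<Rightarrow> complex \<Rightarrow> nat \<Rightarrow> complex poly" where
  "jac a b 0 = 1"
| "jac a b (Suc n) = jT a b (jac (a + 1) (b + 1) n)"

text \<open>Induction peels off the outermost derivative: the n inner ones leave the weight with
  exponents a + 1, b + 1 times a polynomial, to which \<open>has_field_derivative_jT\<close>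
  applies.\<close>

lemma higher_deriv_jw:
  assumes "0 < Re z" "Re z < 1"
  shows "(deriv ^^ n) (jw (a + of_nat n) (b + of_nat n)) z = jw a b z * poly (jac a b n) z"
  using assms
proof (induction n arbitrary: a b z)
  case (Suc n)
  let ?S = "{z. 0 < Re z \<and> Re z < 1}"
  have op: "open ?S"
    by (intro open_Collect_conj open_halfspace_Re_gt open_halfspace_Re_lt)
  have z: "z \<notin> \<real>\<^sub>\<le>\<^sub>0" "1 - z \<notin> \<real>\<^sub>\<le>\<^sub>0" using Suc.prems by (auto simp: complex_nonpos_Reals_iff)
  have e: "a + of_nat (Suc n) = (a + 1) + of_nat n" "b + of_nat (Suc n) = (b + 1) + of_nat n" by auto
  have "((deriv ^^ n) (jw (a + of_nat (Suc n)) (b + of_nat (Suc n))) has_field_derivative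
      jw a b z * poly (jT a b (jac (a + 1) (b + 1) n)) z) (at z)"
    unfolding e
    by (rule has_field_derivative_transform_within_open[OF has_field_derivative_jT[OF z] op])
       (use Suc in auto)
  then show ?case by (simp add: DERIV_imp_deriv)
qed auto

lemma rodrigues_eq_jac:
  assumes "0 < Re z" "Re z < 1"
  shows "rodrigues a b n z = poly (jac a b n) z"
proof -
  let ?S = "{z. 0 < Re z \<and> Re z < 1}"
  have op: "open ?S"
    by (intro open_Collect_conj open_halfspace_Re_gt open_halfspace_Re_lt)
  have "(deriv ^^ n) (\<lambda>t. (t * (1 - t)) ^ n * jw a b t) z = (deriv ^^ n) (jw (a + of_nat n) (b + of_nat n)) z"
  proof (rule higher_deriv_transform_within_open[OF _ jw_holomorphic op])
    show "(\<lambda>t. (t * (1 - t)) ^ n * jw a b t) holomorphic_on ?S"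
      by (intro holomorphic_intros jw_holomorphic)
    fix w assume w: "w \<in> ?S"
    then have "w \<noteq> 0" "1 - w \<noteq> 0" by auto
    then show "(w * (1 - w)) ^ n * jw a b w = jw (a + of_nat n) (b + of_nat n) w"
      by (simp add: jw_def powr_add powr_nat' power_mult_distrib)
  qed (use assms in auto)
  moreover have "jw a b z \<noteq> 0" using assms by (auto simp: jw_def)
  ultimately show ?thesis
    unfolding rodrigues_def using higher_deriv_jw[OF assms, of n a b] by simp
qed

text \<open>Provides the uniqueness that resolves the \<open>THE\<close> in
  \<open>jpoly\<close>.\<close>

lemma poly_eq_on_unit_interval:
  fixes p q :: "complex poly"
  assumes "\<And>x::real. 0 < x \<Longrightarrow> x < 1 \<Longrightarrow> poly p (of_real x) = poly q (of_real x)"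
  shows "p = q"
proof (rule ccontr)
  assume "p \<noteq> q"
  then have "finite {z. poly (p - q) z = 0}" by (intro poly_roots_finite) auto
  moreover have "complex_of_real ` {0<..<1} \<subseteq> {z. poly (p - q) z = 0}" using assms by auto
  ultimately have "finite (complex_of_real ` {0<..<1})" by (rule rev_finite_subset)
  then have "finite {0<..<1::real}" by (rule finite_imageD) (auto simp: inj_on_def)
  then show False using infinite_Ioo[of 0 "1::real"] by simp
qed

lemma jpoly_eq_jac: "jpoly a b n = jac a b n"
  unfolding jpoly_def
proof (rule the_equality)
  show *: "\<forall>x::real. 0 < x \<and> x < 1 \<longrightarrow> poly (jac a b n) (of_real x) = rodrigues a b n (of_real x)"
    by (auto simp: rodrigues_eq_jac)
  fix p assume "\<forall>x::real. 0 < x \<and> x < 1 \<longrightarrow> poly p (of_real x) = rodrigues a b n (of_real x)"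
  with * show "p = jac a b n" by (intro poly_eq_on_unit_interval) auto
qed

lemma coeff_jT:
  "coeff (jT a b p) 0 = (a + 1) * coeff p 0"
  "coeff (jT a b p) (Suc k) = (of_nat (Suc k) + a + 1) * coeff p (Suc k) - (of_nat k + a + b + 2) * coeff p k"
proof -
  define s where "s = a + b + 2"
  have jT: "jT a b p = pCons 0 (pderiv p) - pCons 0 (pCons 0 (pderiv p)) + smult (a + 1) p - smult s (pCons 0 p)"
    unfolding jT_def s_def[symmetric] by simp
  show "coeff (jT a b p) 0 = (a + 1) * coeff p 0"
    "coeff (jT a b p) (Suc k) = (of_nat (Suc k) + a + 1) * coeff p (Suc k) - (of_nat k + a + b + 2) * coeff p k"
    unfolding jT by (simp_all add: s_def coeff_pderiv coeff_pCons algebra_simps split: nat.splits)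
qed

lemma degree_jac: "degree (jac a b n) \<le> n"
proof (induction n arbitrary: a b)
  case (Suc n)
  show ?case
  proof (rule degree_le, intro allI impI)
    fix i assume "i > Suc n"
    then obtain k where "i = Suc k" "k > n" by (cases i) auto
    then show "coeff (jac a b (Suc n)) i = 0"
      using Suc[of "a + 1" "b + 1"] by (simp add: coeff_jT coeff_eq_0)
  qed
qed auto

text \<open>By \<open>coeff_jT\<close> a recursion step multiplies the top coefficient by -(n + a +
  b + 2); these factors assemble into a rising factorial.\<close>

lemma coeff_jac_degree: "coeff (jac a b n) n = (-1) ^ n * pochhammer (a + b + of_nat n + 1) n"
proof (induction n arbitrary: a b)
  case (Suc n)
  have "coeff (jac (a + 1) (b + 1) n) (Suc n) = 0"
    using degree_jac[of "a + 1" "b + 1" n] by (intro coeff_eq_0) auto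
  then show ?case
    by (simp add: coeff_jT Suc pochhammer_rec algebra_simps)
qed auto

text \<open>At 0 the factor q vanishes, so \<open>jT\<close> merely multiplies by a + 1. These
  values later determine the middle recurrence coefficient.\<close>

lemma poly_jac_0: "poly (jac a b n) 0 = pochhammer (a + 1) n"
  by (induction n arbitrary: a b) (simp_all add: poly_jT pochhammer_rec add_ac)

section \<open>The functional on polynomials: integration by parts, orthogonality, norms\<close>

definition Lp :: "complex \<Rightarrow> complex \<Rightarrow> complex poly \<Rightarrow> complex" where
  "Lp a b p = hadamard a b (poly p)"

lemma holomorphic_poly: "poly (p :: complex poly) holomorphic_on A"
  unfolding holomorphic_on_def field_differentiable_def
  using poly_DERIV has_field_derivative_at_within by blast

lemma Lp_add: "nonres a \<Longrightarrow> nonres b \<Longrightarrow> Lp a b (p + q) = Lp a b p + Lp a b q"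
  unfolding Lp_def using hadamard_add[of 2 "poly p" "poly q" a b]
  by (simp add: holomorphic_poly poly_add[abs_def])

lemma Lp_smult: "nonres a \<Longrightarrow> nonres b \<Longrightarrow> Lp a b (smult c p) = c * Lp a b p"
  unfolding Lp_def using hadamard_cmult[of 2 "poly p" a b c]
  by (simp add: holomorphic_poly poly_smult[abs_def])

lemma Lp_0: "nonres a \<Longrightarrow> nonres b \<Longrightarrow> Lp a b 0 = 0"
  using Lp_smult[of a b 0 0] by simp

lemma Lp_diff: "nonres a \<Longrightarrow> nonres b \<Longrightarrow> Lp a b (p - q) = Lp a b p - Lp a b q"
  using Lp_add[of a b "p - q" q] by simp

lemma Lp_shift:
  assumes "nonres a" "nonres b"
  shows "Lp (a + 1) (b + 1) p = Lp a b ([:0, 1, -1:] * p)"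
proof -
  have "Lp (a + 1) (b + 1) p = hadamard a (b + 1) (\<lambda>x. x * poly p x)"
    unfolding Lp_def using assms nonres_plus1
    by (intro hadamard_shift_left[of 2]) (auto intro!: holomorphic_intros)
  also have "\<dots> = hadamard a b (\<lambda>x. (1 - x) * (x * poly p x))"
    using assms by (intro hadamard_shift_right[of 2]) (auto intro!: holomorphic_intros)
  also have "(\<lambda>x. (1 - x) * (x * poly p x)) = poly ([:0, 1, -1:] * p)"
    by (auto simp: algebra_simps)
  finally show ?thesis unfolding Lp_def .
qed

text \<open>By the product rule \<open>jT a b (p * q)\<close> is \<open>jT a b p * q\<close> plus x
  (1 - x) p q'. The functional kills the whole, and the factor x (1 - x) is absorbed into the
  exponents.\<close>

lemma Lp_by_parts:
  assumes "nonres a" "nonres b"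
  shows "Lp a b (jT a b p * q) = - Lp (a + 1) (b + 1) (p * pderiv q)"
proof -
  have e: "jT a b (p * q) = jT a b p * q + [:0, 1, -1:] * (p * pderiv q)"
    by (simp add: jT_def pderiv_mult algebra_simps)
  have "Lp a b (jT a b (p * q)) = 0"
    unfolding Lp_def by (rule hadamard_jT[OF assms])
  then have "Lp a b (jT a b p * q) + Lp a b ([:0, 1, -1:] * (p * pderiv q)) = 0"
    unfolding e Lp_add[OF assms] .
  then show ?thesis unfolding Lp_shift[OF assms] by (simp add: add_eq_0_iff2)
qed

lemma Lp_jac_mult:
  assumes "nonres a" "nonres b"
  shows "Lp a b (jac a b n * q) = (-1) ^ n * Lp (a + of_nat n) (b + of_nat n) ((pderiv ^^ n) q)"
  using assms
proof (induction n arbitrary: a b q)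
  case (Suc n)
  have "Lp a b (jac a b (Suc n) * q) = - Lp (a + 1) (b + 1) (jac (a + 1) (b + 1) n * pderiv q)"
    using Lp_by_parts[OF Suc.prems] by simp
  also have "\<dots> = - ((-1) ^ n * Lp (a + 1 + of_nat n) (b + 1 + of_nat n) ((pderiv ^^ n) (pderiv q)))"
    using Suc.IH[of "a + 1" "b + 1" "pderiv q"] Suc.prems nonres_plus1 by simp
  also have "(pderiv ^^ n) (pderiv q) = (pderiv ^^ Suc n) q"
    by (simp add: funpow_Suc_right del: funpow.simps)
  finally show ?case by (simp add: add_ac)
qed auto

lemma higher_pderiv_degree_le:
  fixes q :: "complex poly"
  assumes "degree q \<le> n"
  shows "(pderiv ^^ n) q = [:fact n * coeff q n:]"
  using assms
proof (induction n arbitrary: q)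
  case 0
  then show ?case by (simp add: degree_0_id)
next
  case (Suc n)
  have "degree (pderiv q) \<le> n" using Suc.prems by (simp add: degree_pderiv)
  from Suc.IH[OF this] show ?case
    by (simp add: funpow_Suc_right coeff_pderiv algebra_simps del: funpow.simps)
qed

lemma nonres_plus_nat: "nonres a \<Longrightarrow> nonres (a + of_nat n)"
proof (induction n)
  case (Suc n)
  then show ?case using nonres_plus1[of "a + of_nat n"] by (simp add: add_ac)
qed auto

lemma Lp_jac_mult_degree_le:
  assumes "nonres a" "nonres b" "degree q \<le> n"
  shows "Lp a b (jac a b n * q) =
    (-1) ^ n * fact n * coeff q n * Beta (a + of_nat n + 1) (b + of_nat n + 1)"
proof -
  have nr: "nonres (a + of_nat n)" "nonres (b + of_nat n)"
    using assms nonres_plus_nat by auto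
  have "Lp (a + of_nat n) (b + of_nat n) [:fact n * coeff q n:]
     = Lp (a + of_nat n) (b + of_nat n) (smult (fact n * coeff q n) 1)" by simp
  also have "\<dots> = fact n * coeff q n * Lp (a + of_nat n) (b + of_nat n) 1"
    by (rule Lp_smult[OF nr])
  also have "Lp (a + of_nat n) (b + of_nat n) 1 = Beta (a + of_nat n + 1) (b + of_nat n + 1)"
    unfolding Lp_def using hadamard_one_eq_Beta[OF nr] by (simp add: poly_1[abs_def])
  finally show ?thesis
    unfolding Lp_jac_mult[OF assms(1,2)] higher_pderiv_degree_le[OF assms(3)] by simp
qed

text \<open>The first two conditions make the finite parts meaningful. The third says that a + b is
  none of -2, -3, ...; it keeps Beta values and leading coefficients away from 0.\<close>

definition admissible :: "complex \<Rightarrow> complex \<Rightarrow> bool" where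
  "admissible a b \<longleftrightarrow> nonres a \<and> nonres b \<and> nonres (a + b + 1)"

lemma admissibleD: "admissible a b \<Longrightarrow> nonres a" "admissible a b \<Longrightarrow> nonres b"
  by (auto simp: admissible_def)

lemma Beta_nonzero:
  assumes "admissible a b"
  shows "Beta (a + of_nat n + 1) (b + of_nat n + 1) \<noteq> 0"
proof -
  have "nonres (a + b + 1 + of_nat (2 * n))"
    using assms nonres_plus_nat unfolding admissible_def by blast
  then have "(a + of_nat n + 1) + (b + of_nat n + 1) \<notin> \<int>\<^sub>\<le>\<^sub>0"
    using nonres_imp_not_nonpos_Int by (fastforce simp: add_ac)
  moreover have "a + of_nat n + 1 \<notin> \<int>\<^sub>\<le>\<^sub>0" "b + of_nat n + 1 \<notin> \<int>\<^sub>\<le>\<^sub>0"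
    using assms nonres_plus_nat nonres_imp_not_nonpos_Int unfolding admissible_def by auto
  ultimately show ?thesis by (simp add: Beta_altdef Gamma_eq_zero_iff rGamma_eq_zero_iff)
qed

text \<open>Testing with k = degree q isolates the leading coefficient times a nonzero constant.
  This takes the place of positive definiteness.\<close>

lemma poly_eq_0_by_orthogonality:
  assumes "admissible a b" "degree q \<le> n" "\<And>k. k \<le> n \<Longrightarrow> Lp a b (jac a b k * q) = 0"
  shows "q = 0"
proof (rule ccontr)
  assume "q \<noteq> 0"
  have "Lp a b (jac a b (degree q) * q) = 0" using assms by auto
  then show False
    using Lp_jac_mult_degree_le[of a b q "degree q"] Beta_nonzero[OF assms(1), of "degree q"] \<open>q \<noteq> 0\<close>
      admissibleD[OF assms(1)] by simp
qed

text \<open>The restriction n > 0 is forced: s = -1 is permitted, and there s + n + 1 = 0 at n =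
  0.\<close>

lemma pochhammer_shifted_nonzero:
  assumes "nonres (s + 1)" "n > 0"
  shows "s + of_nat n + 1 \<notin> \<int>\<^sub>\<le>\<^sub>0"
proof -
  have "s + of_nat n + 1 = (s + 1 + of_nat (n - 1)) + 1" using assms by (cases n) auto
  then show ?thesis using nonres_imp_not_nonpos_Int[OF nonres_plus_nat[OF assms(1)]] by simp
qed

text \<open>The norm is the top coefficient times a factorial and a Beta value, up to sign; the
  rising factorial becomes a quotient of Gamma values. Index 0 is separate because
  \<open>jnorm\<close> has its own formula there.\<close>

lemma Lp_jac_jac:
  assumes "admissible a b"
  shows "Lp a b (jac a b n * jac a b n) = jnorm a b n"
proof -
  note nr = admissibleD[OF assms]
  have sgn: "(-1) ^ n * (-1) ^ n = (1::complex)" by (simp flip: power_mult_distrib)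
  have L: "Lp a b (jac a b n * jac a b n) =
    ((-1) ^ n * (-1) ^ n) * fact n * pochhammer (a + b + of_nat n + 1) n * Beta (a + of_nat n + 1) (b + of_nat n + 1)"
    using Lp_jac_mult_degree_le[OF nr degree_jac[of a b n]] by (simp add: coeff_jac_degree mult_ac)
  show ?thesis
  proof (cases "n = 0")
    case True
    then show ?thesis using L by (simp add: jnorm_def Beta_def add_ac)
  next
    case False
    define z where "z = a + b + of_nat n + 1"
    have z: "z \<notin> \<int>\<^sub>\<le>\<^sub>0" unfolding z_def
      using pochhammer_shifted_nonzero[of "a + b" n] assms False by (simp add: admissible_def)
    have z2: "z + of_nat n \<notin> \<int>\<^sub>\<le>\<^sub>0" unfolding z_def
      using pochhammer_shifted_nonzero[of "a + b" "n + n"] assms False by (simp add: admissible_def add_ac)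
    have "pochhammer z n = Gamma (z + of_nat n) / Gamma z" by (rule pochhammer_Gamma[OF z])
    moreover have "(a + of_nat n + 1) + (b + of_nat n + 1) = (z + of_nat n) + 1" by (simp add: z_def)
    moreover have "Gamma ((z + of_nat n) + 1) = (z + of_nat n) * Gamma (z + of_nat n)"
      by (rule Gamma_plus1[OF z2])
    moreover have "Gamma (z + of_nat n) \<noteq> 0" using z2 by (simp add: Gamma_eq_zero_iff)
    ultimately show ?thesis using L False sgn
      unfolding z_def[symmetric] by (simp add: jnorm_def Beta_def z_def add_ac mult_ac)
  qed
qed

lemma jnorm_nonzero:
  assumes "admissible a b"
  shows "jnorm a b n \<noteq> 0" "coeff (jac a b n) n \<noteq> 0"
proof -
  note nr = admissibleD[OF assms]
  show *: "coeff (jac a b n) n \<noteq> 0"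
  proof (cases "n = 0")
    case False
    then have "a + b + of_nat n + 1 \<notin> \<int>\<^sub>\<le>\<^sub>0"
      using pochhammer_shifted_nonzero[of "a + b" n] assms by (simp add: admissible_def)
    then show ?thesis
      by (auto simp: coeff_jac_degree pochhammer_eq_0_iff)
  qed auto
  show "jnorm a b n \<noteq> 0"
    using Lp_jac_mult_degree_le[OF nr degree_jac[of a b n]] Beta_nonzero[OF assms, of n] *
    unfolding Lp_jac_jac[OF assms] by simp
qed

section \<open>The three-term recurrence and its asymptotics\<close>

text \<open>Division by n! turns factorial growth into geometric growth, so that the recurrence
  coefficients converge.\<close>

definition ju :: "complex \<Rightarrow> complex \<Rightarrow> nat \<Rightarrow> complex poly" where
  "ju a b n = smult (1 / fact n) (jac a b n)"

definition jh :: "complex \<Rightarrow> complex \<Rightarrow> nat \<Rightarrow> complex" where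
  "jh a b n = jnorm a b n / (fact n)\<^sup>2"

definition jl :: "complex \<Rightarrow> complex \<Rightarrow> nat \<Rightarrow> complex" where
  "jl a b n = coeff (ju a b n) n"

lemma degree_ju: "degree (ju a b n) \<le> n"
  using degree_jac[of a b n] degree_smult_le[of "1 / fact n" "jac a b n"] unfolding ju_def by linarith

lemma jl_nonzero: "admissible a b \<Longrightarrow> jl a b n \<noteq> 0"
  and jh_nonzero: "admissible a b \<Longrightarrow> jh a b n \<noteq> 0"
  using jnorm_nonzero[of a b n] by (auto simp: jl_def ju_def jh_def)

text \<open>The functional is one constant times the coefficient of x^n; testing on the n-th
  polynomial itself identifies the constant.\<close>

lemma Lp_ju_mult:
  assumes "admissible a b" "degree q \<le> n"
  shows "Lp a b (ju a b n * q) = jh a b n / jl a b n * coeff q n"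
proof -
  note nr = admissibleD[OF assms(1)]
  define K where "K = (-1) ^ n * fact n * Beta (a + of_nat n + 1) (b + of_nat n + 1)"
  have K: "Lp a b (jac a b n * p) = K * coeff p n" if "degree p \<le> n" for p
    using Lp_jac_mult_degree_le[OF nr that] by (simp add: K_def)
  have "jnorm a b n = K * coeff (jac a b n) n"
    using K[OF degree_jac[of a b n]] Lp_jac_jac[OF assms(1), of n] by simp
  then have "jh a b n / jl a b n = K / fact n"
    using jnorm_nonzero(2)[OF assms(1), of n]
    by (simp add: jh_def jl_def ju_def power2_eq_square)
  moreover have "Lp a b (ju a b n * q) = K * coeff q n / fact n"
    using K[OF assms(2)] Lp_smult[OF nr, of "1 / fact n" "jac a b n * q"] by (simp add: ju_def)
  ultimately show ?thesis by simp
qed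

lemma Lp_ju_ju:
  assumes "admissible a b"
  shows "Lp a b (ju a b m * ju a b n) = (if m = n then jh a b n else 0)"
proof -
  have *: "Lp a b (ju a b m * ju a b n) = (if m = n then jh a b n else 0)" if "n \<le> m" for m n
  proof -
    have "coeff (ju a b n) m = 0" if "n < m"
      using that degree_ju[of a b n] by (intro coeff_eq_0) auto
    then show ?thesis
      using Lp_ju_mult[OF assms, of "ju a b n" m] degree_ju[of a b n] that jl_nonzero[OF assms, of n]
      by (auto simp: jl_def)
  qed
  show ?thesis
    using *[of n m] *[of m n] by (cases "n \<le> m") (auto simp: mult.commute)
qed

lemma poly_eq_0_by_ju:
  assumes "admissible a b" "degree q \<le> n" "\<And>k. k \<le> n \<Longrightarrow> Lp a b (ju a b k * q) = 0"
  shows "q = 0"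
proof (rule poly_eq_0_by_orthogonality[OF assms(1,2)])
  fix k assume "k \<le> n"
  then show "Lp a b (jac a b k * q) = 0"
    using assms(3)[of k] Lp_smult[OF admissibleD[OF assms(1)], of "1 / fact k" "jac a b k * q"]
    by (simp add: ju_def)
qed

text \<open>With A cancelling the top coefficient, the defect q has degree at most n + 1 and is
  orthogonal to all \<open>ju\<close> up to that index: k = n + 1 fixes B, k = n fixes C, smaller k
  give 0 by degree. The middle coefficient stays unevaluated.\<close>

lemma ju_recurrence:
  assumes "admissible a b"
  shows "[:0, 1:] * ju a b (Suc n) =
     smult (jl a b (Suc n) / jl a b (Suc (Suc n))) (ju a b (Suc (Suc n)))
     + smult (Lp a b (ju a b (Suc n) * ([:0, 1:] * ju a b (Suc n))) / jh a b (Suc n)) (ju a b (Suc n))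
     + smult (jl a b n / jl a b (Suc n) * (jh a b (Suc n) / jh a b n)) (ju a b n)"
    (is "?X = smult ?A ?U2 + smult ?B ?U1 + smult ?C ?U0")
proof -
  note nr = admissibleD[OF assms]
  define A B C where "A = ?A" and "B = ?B" and "C = ?C"
  define q where "q = ?X - smult A ?U2 - smult B ?U1 - smult C ?U0"
  have c: "coeff (ju a b k) m = 0" if "k < m" for k m
    using that degree_ju[of a b k] by (intro coeff_eq_0) auto
  have "degree q \<le> Suc n"
  proof (rule degree_le, intro allI impI)
    fix i assume i: "i > Suc n"
    then obtain k where k: "i = Suc k" "k \<ge> Suc n" by (cases i) auto
    show "coeff q i = 0"
    proof (cases "k = Suc n")
      case True
      then show ?thesis using k jl_nonzero[OF assms, of "Suc (Suc n)"]
        by (simp add: q_def c A_def flip: jl_def)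
    next
      case False
      then show ?thesis using k by (simp add: q_def c)
    qed
  qed
  moreover have "Lp a b (ju a b k * q) = 0" if k: "k \<le> Suc n" for k
  proof -
    \<comment> \<open>Multiplication by x is moved from the polynomial of index n + 1 to the one of
      index k.\<close>
    have e: "ju a b k * q = ju a b (Suc n) * ([:0, 1:] * ju a b k) - smult A (ju a b k * ?U2)
       - smult B (ju a b k * ?U1) - smult C (ju a b k * ?U0)"
      by (simp add: q_def algebra_simps)
    have "Lp a b (ju a b k * q) = Lp a b (ju a b (Suc n) * ([:0, 1:] * ju a b k)) - A * 0
       - B * (if k = Suc n then jh a b (Suc n) else 0) - C * (if k = n then jh a b n else 0)"
      unfolding e Lp_diff[OF nr] Lp_smult[OF nr] using k by (simp add: Lp_ju_ju[OF assms])
    also have "\<dots> = 0"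
    proof (cases "k = Suc n")
      case True
      then show ?thesis using jh_nonzero[OF assms, of "Suc n"] by (simp add: B_def)
    next
      case False
      then have kn: "k \<le> n" using k by simp
      have "degree ([:0, 1:] * ju a b k) \<le> Suc n"
        using degree_mult_le[of "[:0, 1:]" "ju a b k"] degree_ju[of a b k] kn by simp
      then have "Lp a b (ju a b (Suc n) * ([:0, 1:] * ju a b k)) = jh a b (Suc n) / jl a b (Suc n) * coeff (ju a b k) n"
        using Lp_ju_mult[OF assms, of "[:0, 1:] * ju a b k" "Suc n"] by simp
      then show ?thesis
        using False kn jh_nonzero[OF assms, of n] c[of k n] by (cases "k = n") (auto simp: C_def jl_def)
    qed
    finally show ?thesis .
  qed
  ultimately have "q = 0" by (rule poly_eq_0_by_ju[OF assms])
  then have "?X = smult A ?U2 + smult B ?U1 + smult C ?U0" unfolding q_def by (simp add: algebra_simps)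
  then show ?thesis unfolding A_def B_def C_def .
qed

lemma tendsto_linear_ratio: "(\<lambda>n. (of_nat n + c) / (of_nat n + d)) \<longlonglongrightarrow> (1::complex)"
proof -
  have 1: "(\<lambda>n. 1 + c / of_nat n) \<longlonglongrightarrow> 1 + 0" for c :: complex
    by (intro tendsto_add tendsto_const lim_const_over_n)
  have "(\<lambda>n. (1 + c / of_nat n) / (1 + d / of_nat n)) \<longlonglongrightarrow> (1 + 0) / (1 + 0)"
    by (intro tendsto_divide 1) auto
  then have "(\<lambda>n. (1 + c / of_nat n) / (1 + d / of_nat n)) \<longlonglongrightarrow> 1" by simp
  then show ?thesis
  proof (rule Lim_transform_eventually)
    show "\<forall>\<^sub>F n in sequentially. (1 + c / of_nat n) / (1 + d / of_nat n) = (of_nat n + c) / (of_nat n + d)"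
      using eventually_gt_at_top[of 0]
    proof eventually_elim
      case (elim n)
      then have n: "(of_nat n :: complex) \<noteq> 0" by simp
      have "1 + c / of_nat n = (of_nat n + c) / of_nat n" "1 + d / of_nat n = (of_nat n + d) / of_nat n"
        using n by (auto simp: field_simps)
      then show ?case using n by simp
    qed
  qed
qed

text \<open>The quotient of the rising factorials has two linear factors of slope 2 over one of
  slope 1; pulling out both 2s leaves ratios fit for \<open>tendsto_linear_ratio\<close> and the
  factor -4.\<close>

lemma jl_ratio:
  assumes "admissible a b" "n > 0"
  shows "jl a b (Suc n) / jl a b n =
    - 4 * ((of_nat n + (a + b + 1) / 2) / (of_nat n + (a + b + 1))) * ((of_nat n + (a + b + 2) / 2) / (of_nat n + 1))"
proof -
  define s where "s = a + b"
  have s: "s + of_nat n + 1 \<notin> \<int>\<^sub>\<le>\<^sub>0"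
    using pochhammer_shifted_nonzero[of s n] assms by (simp add: admissible_def s_def)
  then have s0: "s + of_nat n + 1 \<noteq> 0" by auto
  have p0: "pochhammer (s + of_nat n + 1) n \<noteq> 0"
    using s by (auto simp: pochhammer_eq_0_iff)
  \<comment> \<open>The rising factorial of length n + 2 from s + n + 1 is read twice: with its
    first factor split off, and with its last two split off.\<close>
  have "(s + of_nat n + 1) * pochhammer (s + of_nat (Suc n) + 1) (Suc n) = pochhammer (s + of_nat n + 1) (Suc (Suc n))"
    by (simp add: pochhammer_rec[of _ "Suc n"] add_ac)
  also have "\<dots> = pochhammer (s + of_nat n + 1) n * (s + 2 * of_nat n + 1) * (s + 2 * of_nat n + 2)"
    by (simp add: pochhammer_Suc add_ac)
  finally have r: "pochhammer (s + of_nat (Suc n) + 1) (Suc n) / pochhammer (s + of_nat n + 1) n =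
     (s + 2 * of_nat n + 1) * (s + 2 * of_nat n + 2) / (s + of_nat n + 1)"
    using s0 p0 by (simp add: field_simps)
  have cancel: "- (2 * p * (2 * q) / w) / k = - 4 * (p / w) * (q / k)" for p q w k :: complex
    by simp
  have "jl a b (Suc n) / jl a b n = - ((s + 2 * of_nat n + 1) * (s + 2 * of_nat n + 2) / (s + of_nat n + 1)) / of_nat (Suc n)"
  proof -
    define P0 P1 where "P0 = pochhammer (s + of_nat n + 1) n" and "P1 = pochhammer (s + of_nat (Suc n) + 1) (Suc n)"
    have "jl a b (Suc n) = - ((-1) ^ n * P1) / (of_nat (Suc n) * fact n)" "jl a b n = ((-1) ^ n * P0) / fact n"
      unfolding jl_def ju_def coeff_smult coeff_jac_degree P0_def P1_def s_def by simp_all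
    moreover have "P0 \<noteq> 0" using p0 by (simp add: P0_def)
    ultimately have "jl a b (Suc n) / jl a b n = - (P1 / P0) / of_nat (Suc n)"
      by (simp del: of_nat_Suc)
    then show ?thesis using r by (simp only: P0_def P1_def)
  qed
  also have "s + 2 * of_nat n + 1 = 2 * (of_nat n + (s + 1) / 2)" by (simp add: field_simps)
  also have "s + 2 * of_nat n + 2 = 2 * (of_nat n + (s + 2) / 2)" by (simp add: field_simps)
  also have "- (2 * (of_nat n + (s + 1) / 2) * (2 * (of_nat n + (s + 2) / 2)) / (s + of_nat n + 1)) / of_nat (Suc n)
    = - 4 * ((of_nat n + (s + 1) / 2) / (s + of_nat n + 1)) * ((of_nat n + (s + 2) / 2) / of_nat (Suc n))"
    using cancel by blast
  finally show ?thesis by (simp only: s_def add_ac of_nat_Suc)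
qed

lemma jl_ratio_tendsto:
  assumes "admissible a b"
  shows "(\<lambda>n. jl a b (Suc n) / jl a b n) \<longlonglongrightarrow> -4"
proof (rule Lim_transform_eventually)
  show "(\<lambda>n. - 4 * ((of_nat n + (a + b + 1) / 2) / (of_nat n + (a + b + 1))) * ((of_nat n + (a + b + 2) / 2) / (of_nat n + 1)))
     \<longlonglongrightarrow> -4"
    by (rule tendsto_eq_rhs[OF tendsto_mult[OF tendsto_mult[OF tendsto_const tendsto_linear_ratio] tendsto_linear_ratio]]) simp
  show "\<forall>\<^sub>F n in sequentially. - 4 * ((of_nat n + (a + b + 1) / 2) / (of_nat n + (a + b + 1))) * ((of_nat n + (a + b + 2) / 2) / (of_nat n + 1)) = jl a b (Suc n) / jl a b n"
    using eventually_gt_at_top[of 0] by eventually_elim (simp only: jl_ratio[OF assms])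
qed

lemma jh_ratio:
  assumes "admissible a b" "n > 0"
  shows "jh a b (Suc n) / jh a b n =
    ((of_nat n + (a + 1)) / (of_nat n + 1)) * ((of_nat n + (b + 1)) / (of_nat n + (a + b + 1)))
     * ((of_nat n + (a + b + 1) / 2) / (of_nat n + (a + b + 3) / 2))"
proof -
  define s where "s = a + b"
  have nr: "nonres (a + of_nat n)" "nonres (b + of_nat n)"
    using admissibleD[OF assms(1)] nonres_plus_nat by auto
  have s: "of_nat n + s + 1 \<notin> \<int>\<^sub>\<le>\<^sub>0"
    using pochhammer_shifted_nonzero[of s n] assms by (simp add: admissible_def s_def add_ac)
  have s2: "2 * of_nat n + s + 1 \<notin> \<int>\<^sub>\<le>\<^sub>0"
    using pochhammer_shifted_nonzero[of s "n + n"] assms by (simp add: admissible_def s_def add_ac)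
  define ga gb gs where "ga = Gamma (of_nat n + a + 1)" and "gb = Gamma (of_nat n + b + 1)" and "gs = Gamma (of_nat n + s + 1)"
  have an: "of_nat n + a + 1 \<notin> \<int>\<^sub>\<le>\<^sub>0" "of_nat n + b + 1 \<notin> \<int>\<^sub>\<le>\<^sub>0"
    using nr[THEN nonres_imp_not_nonpos_Int] by (simp_all add: add_ac)
  have nz: "ga \<noteq> 0" "gb \<noteq> 0" "gs \<noteq> 0" "of_nat n + s + 1 \<noteq> 0" "2 * of_nat n + s + 1 \<noteq> 0"
    using s an s2 by (auto simp: ga_def gb_def gs_def Gamma_eq_zero_iff)
  have G: "Gamma (of_nat (Suc n) + a + 1) = (of_nat n + a + 1) * ga"
    "Gamma (of_nat (Suc n) + b + 1) = (of_nat n + b + 1) * gb"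
    "Gamma (of_nat (Suc n) + s + 1) = (of_nat n + s + 1) * gs"
    using Gamma_plus1[OF an(1)] Gamma_plus1[OF an(2)] Gamma_plus1[OF s]
    by (simp_all add: ga_def gb_def gs_def add_ac)
  have n0: "jnorm a b n = fact n * ga * gb / ((2 * of_nat n + s + 1) * gs)"
    using assms(2) by (simp add: jnorm_def ga_def gb_def gs_def s_def add_ac)
  have n1: "jnorm a b (Suc n) = fact (Suc n) * ((of_nat n + a + 1) * ga) * ((of_nat n + b + 1) * gb)
     / ((2 * of_nat n + s + 3) * ((of_nat n + s + 1) * gs))"
    unfolding G[symmetric] by (simp add: jnorm_def s_def add_ac)
  have f: "(fact (Suc n) :: complex) = of_nat (Suc n) * fact n" "(of_nat (Suc n) :: complex) \<noteq> 0"
    by (simp_all del: of_nat_Suc)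
  have cancel: "(x * y * (2 * p)) / (k * (2 * q) * w) = (x / k) * (y / w) * (p / q)" for x y p k q w :: complex
    by (simp add: mult_ac)
  have "jh a b (Suc n) / jh a b n = (of_nat n + a + 1) * (of_nat n + b + 1) * (2 * of_nat n + s + 1)
     / (of_nat (Suc n) * (2 * of_nat n + s + 3) * (of_nat n + s + 1))"
    unfolding jh_def n0 n1 f(1) using nz f(2)
    by (simp add: divide_simps power2_eq_square del: of_nat_Suc)
  also have "2 * of_nat n + s + 1 = 2 * (of_nat n + (s + 1) / 2)" by (simp add: field_simps)
  also have "2 * of_nat n + s + 3 = 2 * (of_nat n + (s + 3) / 2)" by (simp add: field_simps)
  also have "(of_nat n + a + 1) * (of_nat n + b + 1) * (2 * (of_nat n + (s + 1) / 2))
     / (of_nat (Suc n) * (2 * (of_nat n + (s + 3) / 2)) * (of_nat n + s + 1)) =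
     ((of_nat n + a + 1) / of_nat (Suc n)) * ((of_nat n + b + 1) / (of_nat n + s + 1))
     * ((of_nat n + (s + 1) / 2) / (of_nat n + (s + 3) / 2))"
    using cancel by blast
  finally show ?thesis by (simp only: s_def add_ac of_nat_Suc)
qed

lemma jh_ratio_tendsto:
  assumes "admissible a b"
  shows "(\<lambda>n. jh a b (Suc n) / jh a b n) \<longlonglongrightarrow> 1"
proof (rule Lim_transform_eventually)
  show "(\<lambda>n. ((of_nat n + (a + 1)) / (of_nat n + 1)) * ((of_nat n + (b + 1)) / (of_nat n + (a + b + 1)))
     * ((of_nat n + (a + b + 1) / 2) / (of_nat n + (a + b + 3) / 2))) \<longlonglongrightarrow> 1"
    by (rule tendsto_eq_rhs[OF tendsto_mult[OF tendsto_mult[OF tendsto_linear_ratio tendsto_linear_ratio] tendsto_linear_ratio]]) simp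
  show "\<forall>\<^sub>F n in sequentially. ((of_nat n + (a + 1)) / (of_nat n + 1)) * ((of_nat n + (b + 1)) / (of_nat n + (a + b + 1)))
     * ((of_nat n + (a + b + 1) / 2) / (of_nat n + (a + b + 3) / 2)) = jh a b (Suc n) / jh a b n"
    using eventually_gt_at_top[of 0] by eventually_elim (simp only: jh_ratio[OF assms])
qed

lemma ju_at_0_ratio:
  "poly (ju a b (Suc n)) 0 = ((of_nat n + (a + 1)) / (of_nat n + 1)) * poly (ju a b n) 0"
  by (simp add: ju_def poly_jac_0 pochhammer_Suc add_ac del: jac.simps)

lemma ju_at_0_nonzero: "nonres a \<Longrightarrow> poly (ju a b n) 0 \<noteq> 0"
  using nonres_imp_not_nonpos_Int[of a] by (auto simp: ju_def poly_jac_0 pochhammer_eq_0_iff)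

text \<open>The limits are those of u_{n+2} = (2 - 4z) u_{n+1} - u_n, the Chebyshev recurrence in 1
  - 2z. The middle coefficient is never computed from its definition: the polynomials have known
  values at z = 0, and these determine it.\<close>

lemma ju_recurrence_asymptotics:
  assumes "admissible a b"
  obtains \<alpha> \<beta> \<gamma> where "\<alpha> \<longlonglongrightarrow> -4" "\<beta> \<longlonglongrightarrow> 2" "\<gamma> \<longlonglongrightarrow> -1"
    "\<And>n z. poly (ju a b (Suc (Suc n))) z = (\<alpha> n * z + \<beta> n) * poly (ju a b (Suc n)) z + \<gamma> n * poly (ju a b n) z"
proof -
  define \<alpha> where "\<alpha> n = jl a b (Suc (Suc n)) / jl a b (Suc n)" for n
  define B where "B n = Lp a b (ju a b (Suc n) * ([:0, 1:] * ju a b (Suc n))) / jh a b (Suc n)" for n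
  define C where "C n = jl a b n / jl a b (Suc n) * (jh a b (Suc n) / jh a b n)" for n
  define \<beta> where "\<beta> n = - \<alpha> n * B n" for n
  define \<gamma> where "\<gamma> n = - \<alpha> n * C n" for n
  have rec: "poly (ju a b (Suc (Suc n))) z = (\<alpha> n * z + \<beta> n) * poly (ju a b (Suc n)) z + \<gamma> n * poly (ju a b n) z" for n z
  proof -
    have nz: "jl a b (Suc n) \<noteq> 0" "jl a b (Suc (Suc n)) \<noteq> 0" using jl_nonzero[OF assms] by auto
    have "z * poly (ju a b (Suc n)) z = (1 / \<alpha> n) * poly (ju a b (Suc (Suc n))) z + B n * poly (ju a b (Suc n)) z + C n * poly (ju a b n) z"
      using arg_cong[OF ju_recurrence[OF assms, of n], of "\<lambda>p. poly p z"] by (simp add: \<alpha>_def B_def C_def)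
    then have "\<alpha> n * (z * poly (ju a b (Suc n)) z) = \<alpha> n * ((1 / \<alpha> n) * poly (ju a b (Suc (Suc n))) z + B n * poly (ju a b (Suc n)) z + C n * poly (ju a b n) z)"
      by simp
    also have "\<dots> = poly (ju a b (Suc (Suc n))) z - \<beta> n * poly (ju a b (Suc n)) z - \<gamma> n * poly (ju a b n) z"
      using nz by (simp add: \<alpha>_def \<beta>_def \<gamma>_def algebra_simps)
    finally show ?thesis by (simp add: algebra_simps)
  qed
  have \<alpha>: "\<alpha> \<longlonglongrightarrow> -4" unfolding \<alpha>_def using jl_ratio_tendsto[OF assms] by (rule LIMSEQ_Suc)
  have "(\<lambda>n. - \<alpha> n * (inverse (jl a b (Suc n) / jl a b n) * (jh a b (Suc n) / jh a b n))) \<longlonglongrightarrow> - (-4) * (inverse (-4) * 1)"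
    by (intro tendsto_intros \<alpha> jl_ratio_tendsto[OF assms] jh_ratio_tendsto[OF assms]) auto
  then have \<gamma>: "\<gamma> \<longlonglongrightarrow> -1" unfolding \<gamma>_def C_def by simp
  define \<rho> where "\<rho> n = (of_nat n + (a + 1)) / (of_nat n + 1)" for n :: nat
  have \<rho>: "\<rho> \<longlonglongrightarrow> 1" unfolding \<rho>_def by (rule tendsto_linear_ratio)
  \<comment> \<open>The recurrence at z = 0, divided by the value of the polynomial of index n +
    1.\<close>
  have \<beta>_eq: "\<beta> n = \<rho> (Suc n) - \<gamma> n * inverse (\<rho> n)" for n
  proof -
    have v: "poly (ju a b n) 0 \<noteq> 0" "poly (ju a b (Suc n)) 0 \<noteq> 0"
      using ju_at_0_nonzero admissibleD[OF assms] by auto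
    have r: "poly (ju a b (Suc n)) 0 = \<rho> n * poly (ju a b n) 0" "poly (ju a b (Suc (Suc n))) 0 = \<rho> (Suc n) * (\<rho> n * poly (ju a b n) 0)"
      unfolding \<rho>_def ju_at_0_ratio[symmetric] by auto
    have "\<rho> n \<noteq> 0" using v r by auto
    moreover have "\<rho> (Suc n) * (\<rho> n * poly (ju a b n) 0) = \<beta> n * (\<rho> n * poly (ju a b n) 0) + \<gamma> n * poly (ju a b n) 0"
      using rec[of n 0] r by simp
    then have "poly (ju a b n) 0 * (\<rho> (Suc n) * \<rho> n) = poly (ju a b n) 0 * (\<beta> n * \<rho> n + \<gamma> n)" by (simp add: algebra_simps)
    then have "\<rho> (Suc n) * \<rho> n = \<beta> n * \<rho> n + \<gamma> n" using v(1) by simp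
    ultimately show ?thesis by (simp add: field_simps)
  qed
  have "(\<lambda>n. \<rho> (Suc n) - \<gamma> n * inverse (\<rho> n)) \<longlonglongrightarrow> 1 - (-1) * inverse 1"
    by (intro tendsto_intros \<gamma> \<rho> LIMSEQ_Suc[OF \<rho>]) auto
  then have "\<beta> \<longlonglongrightarrow> 2" by (simp add: \<beta>_eq[abs_def])
  with \<alpha> \<gamma> rec show ?thesis by (intro that)
qed

section \<open>Confocal ellipses and growth of the polynomials\<close>

text \<open>The Joukowski map (s + 1/s) / 2, carried from the foci -1, 1 to the foci 0, 1.\<close>

definition jouk :: "complex \<Rightarrow> complex" where
  "jouk s = (1 + s)\<^sup>2 / (4 * s)"

text \<open>The sum of the focal distances on the image of the circle of radius R, hence the
  parameter to be given to \<open>ell\<close>.\<close>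

definition jk :: "real \<Rightarrow> real" where
  "jk R = (R + 1 / R) / 2"

lemma jouk_altdef: "s \<noteq> 0 \<Longrightarrow> jouk s = (s + 1 / s + 2) / 4"
  by (simp add: jouk_def field_simps power2_eq_square)

text \<open>As jouk s - 1 = (1 - s)^2 / (4s), the sum is that of |1 + s|^2 and |1 - s|^2 over 4 |s|,
  evaluated by the parallelogram law.\<close>

lemma cmod_jouk:
  assumes "s \<noteq> 0"
  shows "cmod (jouk s) + cmod (jouk s - 1) = jk (cmod s)"
proof -
  have "jouk s - 1 = (1 - s)\<^sup>2 / (4 * s)"
    using assms by (simp add: jouk_def field_simps power2_eq_square)
  then have "cmod (jouk s) + cmod (jouk s - 1) = ((cmod (1 + s))\<^sup>2 + (cmod (1 - s))\<^sup>2) / (4 * cmod s)"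
    by (simp add: jouk_def norm_divide norm_power norm_mult add_divide_distrib)
  also have "(cmod (1 + s))\<^sup>2 + (cmod (1 - s))\<^sup>2 = 2 + 2 * (cmod s)\<^sup>2"
    unfolding cmod_power2 by (simp add: power2_eq_square algebra_simps)
  also have "(2 + 2 * (cmod s)\<^sup>2) / (4 * cmod s) = jk (cmod s)"
    using assms by (simp add: jk_def field_simps power2_eq_square)
  finally show ?thesis .
qed

lemma jk_strict_mono:
  assumes "1 \<le> x" "x < y"
  shows "jk x < jk y"
proof -
  have "1 * y \<le> x * y" using assms by (intro mult_right_mono) auto
  then have "x * y > 1" using assms by linarith
  then have "(y - x) * (1 - 1 / (x * y)) > 0" using assms by (intro mult_pos_pos) (auto simp: field_simps)
  also have "(y - x) * (1 - 1 / (x * y)) = 2 * (jk y - jk x)"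
    using assms by (simp add: jk_def field_simps)
  finally show ?thesis by simp
qed

text \<open>The equation s + 1/s = 4z - 2 has roots with product 1, so one of them lies on or
  outside the unit circle.\<close>

lemma jouk_surj:
  obtains s where "s \<noteq> 0" "1 \<le> cmod s" "z = jouk s"
proof -
  define w where "w = 2 * z - 1"
  define c where "c = csqrt (w\<^sup>2 - 1)"
  have "c\<^sup>2 = w\<^sup>2 - 1" by (simp add: c_def)
  then have m: "(w + c) * (w - c) = 1" by (simp add: algebra_simps power2_eq_square)
  then have nz: "w + c \<noteq> 0" "w - c \<noteq> 0" by auto
  have i: "1 / (w + c) = w - c" "1 / (w - c) = w + c"
    using m nz by (auto simp: field_simps)
  have z: "jouk (w + c) = z" "jouk (w - c) = z"
    unfolding jouk_altdef[OF nz(1)] jouk_altdef[OF nz(2)] i by (simp_all add: w_def)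
  have "cmod (w + c) * cmod (w - c) = 1" using m by (metis norm_mult norm_one)
  moreover have "cmod (w + c) * cmod (w - c) < 1" if "cmod (w + c) < 1" "cmod (w - c) < 1"
    using mult_right_mono[of "cmod (w + c)" 1 "cmod (w - c)"] that by simp
  ultimately have "1 \<le> cmod (w + c) \<or> 1 \<le> cmod (w - c)" by force
  then show ?thesis using that nz z by metis
qed

lemma ell_jk_imp_jouk:
  assumes "z \<in> ell (jk R)" "1 \<le> R"
  obtains s where "s \<noteq> 0" "1 \<le> cmod s" "cmod s \<le> R" "z = jouk s"
proof -
  obtain s where s: "s \<noteq> 0" "1 \<le> cmod s" "z = jouk s" using jouk_surj by blast
  have "jk (cmod s) < jk R" using assms(1) cmod_jouk[OF s(1)] s(3) by (simp add: ell_def)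
  then have "cmod s \<le> R" using jk_strict_mono[of R "cmod s"] assms(2) by force
  then show ?thesis using that s by blast
qed

lemma poly_bounded_on_ell:
  fixes p :: "complex poly"
  obtains B where "B \<ge> 0" "\<And>z. z \<in> ell r \<Longrightarrow> cmod (poly p z) \<le> B"
proof -
  have "continuous_on (cball 0 r) (poly p)" by (intro holomorphic_on_imp_continuous_on holomorphic_poly)
  then have "bounded (poly p ` cball 0 r)"
    by (intro compact_imp_bounded compact_continuous_image) auto
  then obtain B where B: "\<And>z. z \<in> cball 0 r \<Longrightarrow> cmod (poly p z) \<le> B"
    unfolding bounded_iff by blast
  have e: "ell r \<subseteq> cball 0 r"
  proof
    fix z assume "z \<in> ell r"
    then have "cmod z + cmod (z - 1) < r" by (simp add: ell_def)
    moreover have "0 \<le> cmod (z - 1)" by (rule norm_ge_zero)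
    ultimately have "cmod z \<le> r" by linarith
    then show "z \<in> cball 0 r" by simp
  qed
  show ?thesis
  proof (rule that[of "\<bar>B\<bar>"])
    fix z assume "z \<in> ell r"
    then show "cmod (poly p z) \<le> \<bar>B\<bar>" using B[of z] e by fastforce
  qed simp
qed

text \<open>The quantity \<open>|w\<^sub>1 - t w\<^sub>0| + \<delta> |w\<^sub>1|\<close> triangularises the companion matrix uniformly in \<open>t\<close>,
  also near \<open>t = \<plusminus>1\<close> where the two characteristic roots \<open>t\<close> and \<open>1 / t\<close> collide.\<close>

lemma perturbed_recurrence_step:
  fixes w0 w1 w2 t :: complex
  assumes t: "t \<noteq> 0" "1 \<le> cmod t" "cmod t \<le> R" and d: "0 < \<delta>" "0 \<le> \<epsilon>"
    and w: "cmod (w2 - (t + 1 / t) * w1 + w0) \<le> \<epsilon> * (cmod w1 + cmod w0)"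
    and P: "(1 + \<delta>) * (1 + \<epsilon>) \<le> P" "R * \<delta> + 2 * (1 + \<delta>) * \<epsilon> \<le> P * \<delta>"
  shows "cmod (w2 - t * w1) + \<delta> * cmod w2 \<le> P * (cmod (w1 - t * w0) + \<delta> * cmod w1)"
proof -
  define v0 v1 where "v0 = w1 - t * w0" and "v1 = w2 - t * w1"
  have "cmod w0 \<le> cmod t * cmod w0" using t by (simp add: mult_le_cancel_right1)
  also have "\<dots> = cmod (w1 - v0)" by (simp add: v0_def norm_mult)
  also have "\<dots> \<le> cmod w1 + cmod v0" by (rule norm_triangle_ineq4)
  finally have w0: "cmod w0 \<le> cmod w1 + cmod v0" .
  have "v1 = (1 / t) * v0 + (w2 - (t + 1 / t) * w1 + w0)"
    using t(1) by (simp add: v0_def v1_def field_simps)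
  then have "cmod v1 \<le> cmod ((1 / t) * v0) + cmod (w2 - (t + 1 / t) * w1 + w0)"
    by (metis norm_triangle_ineq)
  also have "cmod ((1 / t) * v0) \<le> 1 * cmod v0"
    unfolding norm_mult using t by (intro mult_right_mono) (auto simp: norm_divide)
  finally have "cmod v1 \<le> cmod v0 + \<epsilon> * (cmod w1 + cmod w0)" using w by simp
  also have "\<epsilon> * (cmod w1 + cmod w0) \<le> \<epsilon> * (cmod w1 + (cmod w1 + cmod v0))"
    using w0 d by (intro mult_left_mono) auto
  finally have v1: "cmod v1 \<le> (1 + \<epsilon>) * cmod v0 + 2 * \<epsilon> * cmod w1" by (simp add: algebra_simps)
  have "w2 = t * w1 + v1" by (simp add: v1_def)
  then have "cmod w2 \<le> cmod t * cmod w1 + cmod v1" by (metis norm_mult norm_triangle_ineq)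
  also have "cmod t * cmod w1 \<le> R * cmod w1" using t by (intro mult_right_mono) auto
  finally have "\<delta> * cmod w2 \<le> \<delta> * (R * cmod w1 + cmod v1)" using d by (intro mult_left_mono) auto
  then have "cmod v1 + \<delta> * cmod w2 \<le> (1 + \<delta>) * cmod v1 + R * \<delta> * cmod w1" by (simp add: algebra_simps)
  also have "(1 + \<delta>) * cmod v1 \<le> (1 + \<delta>) * ((1 + \<epsilon>) * cmod v0 + 2 * \<epsilon> * cmod w1)"
    using v1 d by (intro mult_left_mono) auto
  also have "\<dots> + R * \<delta> * cmod w1 = (1 + \<delta>) * (1 + \<epsilon>) * cmod v0 + (R * \<delta> + 2 * (1 + \<delta>) * \<epsilon>) * cmod w1"
    by (simp add: algebra_simps)
  also have "\<dots> \<le> P * cmod v0 + P * \<delta> * cmod w1"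
    using P by (intro add_mono mult_right_mono) auto
  finally show ?thesis by (simp add: v0_def v1_def algebra_simps)
qed

text \<open>On the ellipse the limiting recurrence has characteristic roots t, 1/t of modulus at
  most R. Past an index N independent of z the coefficients deviate so little that the quantity of
  \<open>perturbed_recurrence_step\<close> grows by at most the factor R Q per step.\<close>

lemma ju_growth:
  assumes "admissible a b" "1 \<le> R" "1 < Q"
  shows "\<exists>C\<ge>0. \<forall>n. \<forall>z\<in>ell (jk R). cmod (poly (ju a b n) z) \<le> C * (R * Q) ^ n"
proof -
  obtain \<alpha> \<beta> \<gamma> where lim: "\<alpha> \<longlonglongrightarrow> -4" "\<beta> \<longlonglongrightarrow> 2" "\<gamma> \<longlonglongrightarrow> -1" and
    rec: "\<And>n z. poly (ju a b (Suc (Suc n))) z = (\<alpha> n * z + \<beta> n) * poly (ju a b (Suc n)) z + \<gamma> n * poly (ju a b n) z"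
    using ju_recurrence_asymptotics[OF assms(1)] by blast
  \<comment> \<open>With 1 + \<delta> = (Q + 1) / 2, the two bounds in \<epsilon> are exactly those
    giving (1 + \<delta>)(1 + \<epsilon>) <= Q and 2 (1 + \<delta>) \<epsilon> <= (Q - 1)
    \<delta>.\<close>
  define \<delta> where "\<delta> = (Q - 1) / 2"
  define \<epsilon> where "\<epsilon> = min ((Q - 1) / (Q + 1)) ((Q - 1)\<^sup>2 / (2 * (Q + 1)))"
  define M where "M = jk R"
  define P where "P = R * Q"
  have d: "\<delta> > 0" "\<epsilon> > 0" using assms(3) by (auto simp: \<delta>_def \<epsilon>_def)
  have P1: "P \<ge> 1" using assms(2,3) mult_mono[of 1 R 1 Q] by (simp add: P_def)
  have "(1 + \<delta>) * (1 + \<epsilon>) \<le> (1 + \<delta>) * (1 + (Q - 1) / (Q + 1))"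
    using d by (intro mult_left_mono) (auto simp: \<epsilon>_def)
  also have "\<dots> = 1 * Q" using assms(3) by (simp add: \<delta>_def field_simps)
  also have "\<dots> \<le> P" unfolding P_def using assms by (intro mult_right_mono) auto
  finally have Pa: "(1 + \<delta>) * (1 + \<epsilon>) \<le> P" .
  have "2 * (1 + \<delta>) * \<epsilon> \<le> 2 * (1 + \<delta>) * ((Q - 1)\<^sup>2 / (2 * (Q + 1)))"
    using d by (intro mult_left_mono) (auto simp: \<epsilon>_def)
  also have "\<dots> = 1 * (Q - 1) * \<delta>" using assms(3) by (simp add: \<delta>_def field_simps power2_eq_square)
  also have "\<dots> \<le> R * (Q - 1) * \<delta>" using assms d by (intro mult_right_mono) auto
  finally have Pb: "R * \<delta> + 2 * (1 + \<delta>) * \<epsilon> \<le> P * \<delta>" by (simp add: P_def algebra_simps)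
  have "(\<lambda>n. cmod (\<alpha> n - (-4)) * M + cmod (\<beta> n - 2)) \<longlonglongrightarrow> cmod ((-4) - (-4)) * M + cmod (2 - 2)"
    by (intro tendsto_intros lim)
  then have e1: "eventually (\<lambda>n. cmod (\<alpha> n + 4) * M + cmod (\<beta> n - 2) < \<epsilon>) sequentially"
    using order_tendstoD(2)[of _ 0 sequentially \<epsilon>] d by simp
  have "(\<lambda>n. cmod (\<gamma> n - (-1))) \<longlonglongrightarrow> cmod ((-1) - (-1))"
    by (intro tendsto_intros lim)
  then have e2: "eventually (\<lambda>n. cmod (\<gamma> n + 1) < \<epsilon>) sequentially"
    using order_tendstoD(2)[of _ 0 sequentially \<epsilon>] d by simp
  from eventually_conj[OF e1 e2] obtain N where
    N: "\<And>n. n \<ge> N \<Longrightarrow> cmod (\<alpha> n + 4) * M + cmod (\<beta> n - 2) < \<epsilon> \<and> cmod (\<gamma> n + 1) < \<epsilon>"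
    unfolding eventually_sequentially by blast
  have "\<exists>B\<ge>0. \<forall>z\<in>ell (jk R). cmod (poly (ju a b n) z) \<le> B" for n
    using poly_bounded_on_ell[of "jk R" "ju a b n"] by metis
  then obtain B where B: "\<And>n. B n \<ge> 0" "\<And>n z. z \<in> ell (jk R) \<Longrightarrow> cmod (poly (ju a b n) z) \<le> B n"
    by metis
  define K where "K = B (Suc N) + R * B N + \<delta> * B (Suc N)"
  have K0: "K \<ge> 0" using B(1) d assms by (auto simp: K_def)
  \<comment> \<open>K / \<delta> serves the indices above N, because \<delta> |u| is part of the
    controlled quantity; the sum serves the others.\<close>
  define C where "C = K / \<delta> + (\<Sum>n\<le>N. B n)"
  have S0: "(\<Sum>n\<le>N. B n) \<ge> 0" using B(1) by (intro sum_nonneg) auto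
  have C0: "C \<ge> 0" using K0 d S0 by (auto simp: C_def)
  have "cmod (poly (ju a b n) z) \<le> C * P ^ n" if z: "z \<in> ell (jk R)" for n z
  proof -
    define u where "u n = poly (ju a b n) z" for n
    obtain s where s: "s \<noteq> 0" "1 \<le> cmod s" "cmod s \<le> R" "z = jouk s"
      using ell_jk_imp_jouk[OF z assms(2)] by blast
    \<comment> \<open>The sign turns s + 1/s = 4z - 2 into the characteristic equation t + 1/t = 2 -
      4z of the limiting recurrence.\<close>
    define t where "t = - s"
    have t: "t \<noteq> 0" "1 \<le> cmod t" "cmod t \<le> R" using s by (auto simp: t_def)
    have tz: "t + 1 / t = 2 - 4 * z" using s by (simp add: t_def jouk_altdef field_simps)
    have "cmod z + cmod (z - 1) < M" using z by (simp add: ell_def M_def)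
    moreover have "0 \<le> cmod (z - 1)" by (rule norm_ge_zero)
    ultimately have zM: "cmod z \<le> M" by linarith
    have M0: "M \<ge> 0" using zM norm_ge_zero order_trans by blast
    define X where "X n = cmod (u (Suc n) - t * u n) + \<delta> * cmod (u (Suc n))" for n
    have step: "X (Suc n) \<le> P * X n" if n: "n \<ge> N" for n
      unfolding X_def
    proof (rule perturbed_recurrence_step[OF t d(1) _ _ Pa Pb])
      show "0 \<le> \<epsilon>" using d by simp
      have "u (Suc (Suc n)) - (t + 1 / t) * u (Suc n) + u n = ((\<alpha> n + 4) * z + (\<beta> n - 2)) * u (Suc n) + (\<gamma> n + 1) * u n"
        unfolding tz u_def rec[of n z] by (simp add: algebra_simps)
      also have "cmod \<dots> \<le> cmod ((\<alpha> n + 4) * z + (\<beta> n - 2)) * cmod (u (Suc n)) + cmod (\<gamma> n + 1) * cmod (u n)"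
        by (metis norm_mult norm_triangle_ineq)
      also have "\<dots> \<le> \<epsilon> * cmod (u (Suc n)) + \<epsilon> * cmod (u n)"
      proof (intro add_mono mult_right_mono)
        have "cmod ((\<alpha> n + 4) * z + (\<beta> n - 2)) \<le> cmod (\<alpha> n + 4) * cmod z + cmod (\<beta> n - 2)"
          by (metis norm_mult norm_triangle_ineq)
        also have "\<dots> \<le> cmod (\<alpha> n + 4) * M + cmod (\<beta> n - 2)"
          using zM by (intro add_mono mult_left_mono) auto
        finally show "cmod ((\<alpha> n + 4) * z + (\<beta> n - 2)) \<le> \<epsilon>" using N[OF n] by simp
      qed (use N[OF n] in auto)
      finally show "cmod (u (Suc (Suc n)) - (t + 1 / t) * u (Suc n) + u n) \<le> \<epsilon> * (cmod (u (Suc n)) + cmod (u n))"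
        by (simp add: algebra_simps)
    qed
    have XN: "X N \<le> K"
    proof -
      have "cmod (u (Suc N) - t * u N) \<le> cmod (u (Suc N)) + cmod t * cmod (u N)"
        by (metis norm_mult norm_triangle_ineq4)
      also have "\<dots> \<le> B (Suc N) + R * B N"
        unfolding u_def using t assms(2) by (intro add_mono mult_mono B z) auto
      finally show ?thesis
        unfolding X_def K_def u_def using d by (intro add_mono mult_left_mono B z) auto
    qed
    have Xk: "X (N + k) \<le> P ^ k * K" for k
    proof (induction k)
      case (Suc k)
      have "X (N + Suc k) \<le> P * X (N + k)" using step[of "N + k"] by simp
      also have "\<dots> \<le> P * (P ^ k * K)" using Suc P1 by (intro mult_left_mono) auto
      finally show ?case by simp
    qed (use XN in simp)
    show ?thesis
    proof (cases "n \<le> N")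
      case True
      have "cmod (poly (ju a b n) z) \<le> B n" using B(2)[OF z] .
      also have "\<dots> \<le> (\<Sum>n\<le>N. B n)" using True B(1) by (intro member_le_sum) auto
      also have "\<dots> \<le> C" using K0 d by (simp add: C_def)
      also have "\<dots> = C * 1" by simp
      also have "\<dots> \<le> C * P ^ n" using C0 P1 by (intro mult_left_mono one_le_power) auto
      finally show ?thesis .
    next
      case False
      then obtain k where k: "n = Suc (N + k)" using less_natE by (metis not_le)
      have "\<delta> * cmod (u n) \<le> X (N + k)" by (simp add: X_def k)
      also have "\<dots> \<le> P ^ k * K" by (rule Xk)
      also have "\<dots> \<le> P ^ n * K" using P1 K0 k by (intro mult_right_mono power_increasing) auto
      finally have "cmod (u n) \<le> K / \<delta> * P ^ n" using d by (simp add: field_simps)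
      also have "\<dots> \<le> C * P ^ n" using P1 S0 by (intro mult_right_mono) (auto simp: C_def)
      finally show ?thesis by (simp add: u_def)
    qed
  qed
  then show ?thesis using C0 unfolding P_def by blast
qed

text \<open>Eventually each ratio has modulus below Q, and the constant absorbs the start. Used for
  the inverse norms and for the factor n + 2.\<close>

lemma ratio_limit_one_growth:
  fixes x :: "nat \<Rightarrow> complex"
  assumes nz: "\<And>n. x n \<noteq> 0" and lim: "(\<lambda>n. x (Suc n) / x n) \<longlonglongrightarrow> 1" and Q: "1 < Q"
  shows "\<exists>C\<ge>0. \<forall>n. cmod (x n) \<le> C * Q ^ n"
proof -
  have "(\<lambda>n. cmod (x (Suc n) / x n)) \<longlonglongrightarrow> cmod 1" by (intro tendsto_norm lim)
  then have "eventually (\<lambda>n. cmod (x (Suc n) / x n) < Q) sequentially"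
    using order_tendstoD(2)[of _ "cmod 1" sequentially Q] Q by simp
  then obtain N where N: "\<And>n. n \<ge> N \<Longrightarrow> cmod (x (Suc n) / x n) < Q"
    unfolding eventually_sequentially by blast
  have step: "cmod (x (Suc n)) \<le> Q * cmod (x n)" if "n \<ge> N" for n
    using N[OF that] nz[of n] by (simp add: norm_divide field_simps)
  define C where "C = (\<Sum>n\<le>N. cmod (x n))"
  have C0: "C \<ge> 0" unfolding C_def by (intro sum_nonneg) auto
  have le: "cmod (x n) \<le> C" if "n \<le> N" for n
    unfolding C_def using that by (intro member_le_sum) auto
  have "cmod (x (N + k)) \<le> C * Q ^ k" for k
  proof (induction k)
    case (Suc k)
    have "cmod (x (N + Suc k)) \<le> Q * cmod (x (N + k))" using step[of "N + k"] by simp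
    also have "\<dots> \<le> Q * (C * Q ^ k)" using Suc Q by (intro mult_left_mono) auto
    finally show ?case by (simp add: mult_ac)
  qed (use le in simp)
  note big = this
  have "cmod (x n) \<le> C * Q ^ n" for n
  proof (cases "n \<le> N")
    case True
    have "cmod (x n) \<le> C * 1" using le[OF True] by simp
    also have "\<dots> \<le> C * Q ^ n" using C0 Q by (intro mult_left_mono one_le_power) auto
    finally show ?thesis .
  next
    case False
    then obtain k where k: "n = N + k" using le_Suc_ex by (metis nat_le_linear)
    have "cmod (x n) \<le> C * Q ^ k" using big k by simp
    also have "\<dots> \<le> C * Q ^ n" using C0 Q k by (intro mult_left_mono power_increasing) auto
    finally show ?thesis .
  qed
  then show ?thesis using C0 by blast
qed

lemma inverse_jh_growth:
  assumes "admissible a b" "1 < Q"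
  shows "\<exists>C\<ge>0. \<forall>n. cmod (1 / jh a b n) \<le> C * Q ^ n"
proof (rule ratio_limit_one_growth[OF _ _ assms(2)])
  show "1 / jh a b n \<noteq> 0" for n using jh_nonzero[OF assms(1)] by simp
  have "(\<lambda>n. inverse (jh a b (Suc n) / jh a b n)) \<longlonglongrightarrow> inverse 1"
    by (intro tendsto_intros jh_ratio_tendsto[OF assms(1)]) auto
  then show "(\<lambda>n. 1 / jh a b (Suc n) / (1 / jh a b n)) \<longlonglongrightarrow> 1"
    by (simp add: field_simps)
qed

section \<open>Polynomial approximation inside an ellipse\<close>

text \<open>Chebyshev polynomials of the second kind on the unit interval: their values at
  \<open>jouk s\<close> are the coefficients of the expansion of \<open>1 / (jouk \<sigma> - jouk s)\<close> in powers of \<open>1 / \<sigma>\<close>.\<close>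

fun chU :: "nat \<Rightarrow> complex poly" where
  "chU 0 = 1"
| "chU (Suc 0) = [:-2, 4:]"
| "chU (Suc (Suc n)) = [:-2, 4:] * chU (Suc n) - chU n"

lemma degree_chU: "degree (chU n) \<le> n"
proof (induction n rule: chU.induct)
  case (3 n)
  have "degree ([:-2, 4:] * chU (Suc n)) \<le> Suc (Suc n)"
    using degree_mult_le[of "[:-2, 4 :: complex:]" "chU (Suc n)"] 3 by simp
  then show ?case using 3 by (auto intro!: degree_diff_le)
qed auto

text \<open>The closed form (s^(n+1) - s^(-n-1)) / (s - 1/s) breaks down at s = 1 and s = -1; this
  first-order relation holds there too.\<close>

lemma poly_chU_jouk:
  assumes "s \<noteq> 0"
  shows "poly (chU (Suc n)) (jouk s) = s * poly (chU n) (jouk s) + (1 / s) ^ Suc n"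
proof (induction n)
  case 0
  have "poly (chU (Suc 0)) (jouk s) = 4 * jouk s - 2" by (simp add: algebra_simps)
  also have "\<dots> = s + 1 / s" unfolding jouk_altdef[OF assms] by (simp add: field_simps)
  finally show ?case by simp
next
  case (Suc n)
  define U0 U1 where "U0 = poly (chU n) (jouk s)" and "U1 = poly (chU (Suc n)) (jouk s)"
  have IH: "U1 = s * U0 + (1 / s) ^ Suc n" using Suc by (simp add: U0_def U1_def)
  have c: "4 * jouk s - 2 = s + 1 / s" unfolding jouk_altdef[OF assms] by (simp add: field_simps)
  have "poly (chU (Suc (Suc n))) (jouk s) = (4 * jouk s - 2) * U1 - U0"
    by (simp add: U0_def U1_def algebra_simps)
  also have "\<dots> = s * U1 + ((1 / s) * U1 - U0)" unfolding c by (simp add: algebra_simps)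
  also have "(1 / s) * U1 - U0 = (1 / s) ^ Suc (Suc n)"
    unfolding IH using assms by (simp add: field_simps)
  finally show ?case by (simp add: U1_def)
qed

text \<open>At \<open>jouk s\<close> the value is a sum of n + 1 powers of s, each of modulus at
  most R^n.\<close>

lemma chU_bound:
  assumes "z \<in> ell (jk R)" "1 \<le> R"
  shows "cmod (poly (chU n) z) \<le> of_nat (Suc n) * R ^ n"
proof -
  obtain s where s: "s \<noteq> 0" "1 \<le> cmod s" "cmod s \<le> R" "z = jouk s"
    using ell_jk_imp_jouk[OF assms] by blast
  show ?thesis
  proof (induction n)
    case (Suc n)
    have "cmod (poly (chU (Suc n)) z) \<le> cmod (s * poly (chU n) z) + cmod ((1 / s) ^ Suc n)"
      unfolding s(4) poly_chU_jouk[OF s(1)] by (rule norm_triangle_ineq)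
    also have "cmod (s * poly (chU n) z) \<le> R * (of_nat (Suc n) * R ^ n)"
      unfolding norm_mult using s Suc by (intro mult_mono) auto
    also have "cmod ((1 / s) ^ Suc n) \<le> 1"
      unfolding norm_power using s by (intro power_le_one) (auto simp: norm_divide)
    also have "(1::real) \<le> R ^ Suc n" using assms(2) by (rule one_le_power)
    finally show ?case by (simp add: algebra_simps)
  qed simp
qed

text \<open>The truncated generating function of 1 / (1 - (4z - 2) x + x^2) with its exact
  remainder.\<close>

lemma chU_kernel:
  "(1 - (4 * z - 2) * x + x\<^sup>2) * (\<Sum>k\<le>N. poly (chU k) z * x ^ k) =
    1 - poly (chU (Suc N)) z * x ^ Suc N + poly (chU N) z * x ^ Suc (Suc N)"
proof (induction N)
  case 0
  show ?case by (simp add: algebra_simps power2_eq_square)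
next
  case (Suc N)
  define A U0 U1 y where "A = (\<Sum>k\<le>N. poly (chU k) z * x ^ k)" and "U0 = poly (chU N) z"
    and "U1 = poly (chU (Suc N)) z" and "y = x ^ Suc N"
  have U2: "poly (chU (Suc (Suc N))) z = (4 * z - 2) * U1 - U0"
    by (simp add: U0_def U1_def algebra_simps)
  have IH: "(1 - (4 * z - 2) * x + x\<^sup>2) * A = 1 - U1 * y + U0 * (x * y)"
    using Suc by (simp add: A_def U0_def U1_def y_def)
  have "(1 - (4 * z - 2) * x + x\<^sup>2) * (A + U1 * y) = (1 - U1 * y + U0 * (x * y)) + (1 - (4 * z - 2) * x + x\<^sup>2) * (U1 * y)"
    unfolding IH[symmetric] by (simp add: algebra_simps)
  also have "\<dots> = 1 - ((4 * z - 2) * U1 - U0) * (x * y) + U1 * (x * (x * y))"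
    by (simp add: algebra_simps power2_eq_square)
  finally show ?case unfolding U2 by (simp add: A_def U1_def y_def)
qed

lemma jouk_deriv:
  assumes "s \<noteq> 0"
  shows "(jouk has_field_derivative (1 - 1 / s\<^sup>2) / 4) (at s)"
proof (rule has_field_derivative_transform_within_open[of "\<lambda>s. (s + 1 / s + 2) / 4" _ s "- {0}"])
  show "((\<lambda>s. (s + 1 / s + 2) / 4) has_field_derivative (1 - 1 / s\<^sup>2) / 4) (at s)"
    using assms by (auto intro!: derivative_eq_intros simp: power2_eq_square)
qed (use assms in \<open>auto simp: jouk_altdef\<close>)

lemma jouk_holomorphic: "jouk holomorphic_on - {0}"
  using jouk_deriv by (metis ComplD field_differentiable_def field_differentiable_at_within holomorphic_onI singletonI)

lemma jouk_analytic: "jouk analytic_on - {0}"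
  using jouk_holomorphic analytic_on_open[of "- {0}" jouk] by blast

lemma jouk_circle_in_ell:
  assumes "cmod \<sigma> = R1" "1 < R1" "R1 < R0"
  shows "jouk \<sigma> \<in> ell (jk R0)"
proof -
  have "\<sigma> \<noteq> 0" using assms by auto
  then show ?thesis using cmod_jouk[of \<sigma>] jk_strict_mono[of R1 R0] assms by (simp add: ell_def)
qed

lemma jouk_diff:
  assumes "s \<noteq> 0" "\<sigma> \<noteq> 0"
  shows "jouk \<sigma> - jouk s = (\<sigma> - s) * (\<sigma> - 1 / s) / (4 * \<sigma>)"
  using assms by (simp add: jouk_altdef field_simps)

text \<open>The sum of the focal distances changes by at most twice the distance moved, so the gap
  between \<open>jk R1\<close> and \<open>jk R\<close> forces a separation.\<close>

lemma jouk_dist_ell: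
  assumes "cmod \<sigma> = R1" "R1 > 0" "z \<in> ell (jk R)"
  shows "cmod (jouk \<sigma> - z) > (jk R1 - jk R) / 2"
proof -
  have "\<sigma> \<noteq> 0" using assms by auto
  then have "jk R1 = cmod (jouk \<sigma>) + cmod (jouk \<sigma> - 1)" using cmod_jouk assms by simp
  moreover have "cmod z + cmod (z - 1) < jk R" using assms(3) by (simp add: ell_def)
  moreover have "cmod (jouk \<sigma>) \<le> cmod (jouk \<sigma> - z) + cmod z"
    using norm_triangle_ineq[of "jouk \<sigma> - z" z] by simp
  moreover have "cmod (jouk \<sigma> - 1) \<le> cmod (jouk \<sigma> - z) + cmod (z - 1)"
    using norm_triangle_ineq[of "jouk \<sigma> - z" "z - 1"] by simp
  ultimately show ?thesis by (simp add: field_simps)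
qed

text \<open>Pulled back to the circle, jouk' / (jouk - z) is 1/(u - s) + 1/(u - 1/s) - 1/u. All
  three poles lie inside, so the winding number is 1 + 1 - 1.\<close>

lemma jouk_circle_winding:
  assumes "1 < R1" "z \<in> ell (jk R1)"
  shows "contour_integral (jouk \<circ> circlepath 0 R1) (\<lambda>w. 1 / (w - z)) = 2 * pi * \<i>"
proof -
  let ?c = "circlepath 0 R1"
  obtain s where s: "s \<noteq> 0" "1 \<le> cmod s" "z = jouk s" using jouk_surj by blast
  have "jk (cmod s) < jk R1" using assms(2) cmod_jouk[OF s(1)] s(3) by (simp add: ell_def)
  then have sR: "cmod s < R1" using jk_strict_mono[of R1 "cmod s"] assms(1) by (cases "cmod s = R1") force+
  have "cmod (1 / s) \<le> 1" using s by (simp add: norm_divide)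
  then have s1: "cmod (1 / s) < R1" using assms(1) by linarith
  have "contour_integral (jouk \<circ> ?c) (\<lambda>w. 1 / (w - z)) = contour_integral ?c (\<lambda>\<sigma>. deriv jouk \<sigma> * (1 / (jouk \<sigma> - z)))"
    by (rule contour_integral_comp_analyticW[of _ "- {0}"])
       (use assms jouk_analytic in auto)
  also have "\<dots> = 2 * pi * \<i>"
  proof (rule contour_integral_unique)
    have c: "((\<lambda>u. 1 / (u - w)) has_contour_integral 2 * of_real pi * \<i> * 1) ?c" if "cmod w < R1" for w
      using Cauchy_integral_circlepath_simple[of "\<lambda>_. 1" 0 R1 w] that by simp
    have "((\<lambda>u. 1 / (u - s) + 1 / (u - 1 / s) - 1 / (u - 0)) has_contour_integral
       2 * of_real pi * \<i> * 1 + 2 * of_real pi * \<i> * 1 - 2 * of_real pi * \<i> * 1) ?c"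
      using assms by (intro has_contour_integral_add has_contour_integral_diff c sR s1) auto
    then have "((\<lambda>u. 1 / (u - s) + 1 / (u - 1 / s) - 1 / (u - 0)) has_contour_integral 2 * of_real pi * \<i>) ?c"
      by (simp only: mult_1_right add_diff_cancel_right')
    then have "((\<lambda>\<sigma>. deriv jouk \<sigma> * (1 / (jouk \<sigma> - z))) has_contour_integral 2 * of_real pi * \<i>) ?c"
    proof (rule has_contour_integral_eq)
      fix u assume "u \<in> path_image ?c"
      then have "cmod u = R1" using assms by simp
      then have nz: "u \<noteq> 0" "u - s \<noteq> 0" "u - 1 / s \<noteq> 0" using assms sR s1 by auto
      have d: "deriv jouk u = (1 - 1 / u\<^sup>2) / 4" using jouk_deriv[OF nz(1)] by (rule DERIV_imp_deriv)
      define p q where "p = u - s" and "q = u - 1 / s"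
      have "(u - s) * (u - v) = u * ((u - s) + (u - v)) - u\<^sup>2 + s * v" for v
        by (simp add: algebra_simps power2_eq_square)
      from this[of "1 / s"] have pq: "p * q = u * (p + q) - u\<^sup>2 + 1"
        using s(1) by (simp only: p_def q_def) simp
      have "1 / p + 1 / q - 1 / u = (u * (p + q) - p * q) / (u * (p * q))"
        using nz by (simp add: p_def[symmetric] q_def[symmetric] field_simps)
      also have "u * (p + q) - p * q = u\<^sup>2 - 1" unfolding pq by simp
      also have "(u\<^sup>2 - 1) / (u * (p * q)) = (1 - 1 / u\<^sup>2) / 4 * (1 / (p * q / (4 * u)))"
        using nz by (simp add: p_def[symmetric] q_def[symmetric] field_simps power2_eq_square)
      finally show "1 / (u - s) + 1 / (u - 1 / s) - 1 / (u - 0) = deriv jouk u * (1 / (jouk u - z))"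
        unfolding s(3) jouk_diff[OF s(1) nz(1)] d p_def q_def by simp
    qed
    then show "((\<lambda>\<sigma>. deriv jouk \<sigma> * (1 / (jouk \<sigma> - z))) has_contour_integral 2 * pi * \<i>) ?c" by simp
  qed
  finally show ?thesis .
qed

text \<open>Cauchy's formula along the image ellipse, rewritten over the circle so that the kernel
  can be expanded in powers of 1/\<sigma>.\<close>

lemma jouk_Cauchy_formula:
  assumes "1 < R1" "R1 < R0" "f holomorphic_on ell (jk R0)" "z \<in> ell (jk R1)"
  shows "contour_integral (circlepath 0 R1) (\<lambda>\<sigma>. deriv jouk \<sigma> * (f (jouk \<sigma>) / (jouk \<sigma> - z))) = 2 * pi * \<i> * f z"
proof -
  let ?c = "circlepath 0 R1"
  define \<gamma> where "\<gamma> = jouk \<circ> ?c"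
  have pi0: "path_image ?c \<subseteq> - {0}" using assms(1) by auto
  have vp: "valid_path \<gamma>" unfolding \<gamma>_def
    by (rule valid_path_compose_holomorphic[OF _ jouk_holomorphic _ pi0]) auto
  have im: "path_image \<gamma> \<subseteq> ell (jk R0) - {z}"
  proof
    fix w assume "w \<in> path_image \<gamma>"
    then obtain \<sigma> where \<sigma>: "cmod \<sigma> = R1" "w = jouk \<sigma>"
      using assms(1) by (auto simp: \<gamma>_def path_image_compose)
    have "w \<in> ell (jk R0)"
      unfolding \<sigma>(2) by (rule jouk_circle_in_ell[OF \<sigma>(1) assms(1,2)])
    moreover have "w \<noteq> z" using jouk_dist_ell[OF \<sigma>(1) _ assms(4)] assms(1) \<sigma> by auto
    ultimately show "w \<in> ell (jk R0) - {z}" by simp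
  qed
  have z0: "z \<in> ell (jk R0)"
    using assms(4) ell_mono[of "jk R1" "jk R0"] jk_strict_mono[of R1 R0] assms(1,2) by auto
  have zi: "z \<in> interior (ell (jk R0))" using z0 interior_open[OF open_ell] by simp
  have loop: "pathfinish \<gamma> = pathstart \<gamma>" by (simp add: \<gamma>_def pathfinish_compose pathstart_compose)
  have "winding_number \<gamma> z = 1 / (2 * pi * \<i>) * contour_integral \<gamma> (\<lambda>w. 1 / (w - z))"
    using winding_number_valid_path[OF vp, of z] im by auto
  also have "\<dots> = 1" unfolding \<gamma>_def jouk_circle_winding[OF assms(1,4)] by simp
  finally have w: "winding_number \<gamma> z = 1" .
  have "contour_integral \<gamma> (\<lambda>w. f w / (w - z)) = 2 * pi * \<i> * f z"
    using Cauchy_integral_formula_convex_simple[OF convex_ell assms(3) zi vp im loop]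
    by (simp add: w contour_integral_unique)
  moreover have "contour_integral \<gamma> (\<lambda>w. f w / (w - z)) = contour_integral ?c (\<lambda>\<sigma>. deriv jouk \<sigma> * (f (jouk \<sigma>) / (jouk \<sigma> - z)))"
    unfolding \<gamma>_def by (rule contour_integral_comp_analyticW[of _ "- {0}"])
       (use pi0 jouk_analytic in auto)
  ultimately show ?thesis by simp
qed

text \<open>Expanding the Cauchy kernel by \<open>chU_kernel\<close> makes the truncation a
  polynomial in z. The sequence S is chosen before R, since one S must later serve two ellipses at
  once.\<close>

lemma polynomial_approximation_ell:
  assumes "1 < R1" "R1 < R0" "f holomorphic_on ell (jk R0)"
  shows "\<exists>S. (\<forall>N. degree (S N) \<le> N) \<and> (\<forall>R. 1 \<le> R \<longrightarrow> R < R1 \<longrightarrow>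
     (\<exists>C\<ge>0. \<forall>N. \<forall>z\<in>ell (jk R). cmod (f z - poly (S N) z) \<le> C * of_nat (N + 2) * (R / R1) ^ N))"
proof -
  let ?c = "circlepath 0 R1"
  define F where "F \<sigma> = deriv jouk \<sigma> * f (jouk \<sigma>)" for \<sigma>
  have sph: "sphere 0 R1 \<subseteq> - {0::complex}" using assms(1) by auto
  have jc: "continuous_on (sphere 0 R1) jouk"
    using continuous_on_subset[OF holomorphic_on_imp_continuous_on[OF jouk_holomorphic] sph] .
  have js: "jouk \<sigma> \<in> ell (jk R0)" if "\<sigma> \<in> sphere 0 R1" for \<sigma>
    using that by (intro jouk_circle_in_ell[OF _ assms(1,2)]) simp
  have "deriv jouk holomorphic_on - {0}" by (intro holomorphic_deriv jouk_holomorphic) auto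
  then have dc: "continuous_on (sphere 0 R1) (deriv jouk)"
    using continuous_on_subset[OF holomorphic_on_imp_continuous_on sph] by blast
  have Fc: "continuous_on (sphere 0 R1) F" unfolding F_def
    by (intro continuous_on_mult dc continuous_on_compose2[OF holomorphic_on_imp_continuous_on[OF assms(3)] jc])
       (use js in auto)
  then have "bounded (F ` sphere 0 R1)" by (intro compact_imp_bounded compact_continuous_image) auto
  then obtain M where M: "\<And>\<sigma>. \<sigma> \<in> sphere 0 R1 \<Longrightarrow> cmod (F \<sigma>) \<le> M" unfolding bounded_iff by blast
  have "cmod (F (of_real R1)) \<le> M" by (rule M) (use assms in auto)
  then have M0: "M \<ge> 0" using norm_ge_zero order_trans by blast
  \<comment> \<open>The 4 and the exponent k + 1 come from 1 / (jouk \<sigma> - z) = 4x / (1 - (4z -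
    2) x + x^2) with x = 1/\<sigma>.\<close>
  define c where "c k = contour_integral ?c (\<lambda>\<sigma>. F \<sigma> * (4 * (1 / \<sigma>) ^ Suc k)) / (2 * pi * \<i>)" for k
  define S where "S N = (\<Sum>k\<le>N. smult (c k) (chU k))" for N
  have deg: "degree (S N) \<le> N" for N unfolding S_def
  proof (rule degree_sum_le)
    fix k assume "k \<in> {..N}"
    then show "degree (smult (c k) (chU k)) \<le> N"
      using degree_smult_le[of "c k" "chU k"] degree_chU[of k] by simp
  qed simp
  have ci: "g contour_integrable_on ?c" if "continuous_on (sphere 0 R1) g" for g
    using that assms(1) by (intro contour_integrable_continuous_circlepath) simp
  have "\<exists>C\<ge>0. \<forall>N. \<forall>z\<in>ell (jk R). cmod (f z - poly (S N) z) \<le> C * of_nat (N + 2) * (R / R1) ^ N"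
    if R: "1 \<le> R" "R < R1" for R
  proof -
    define d where "d = (jk R1 - jk R) / 2"
    have d: "d > 0" using jk_strict_mono[OF R] by (simp add: d_def)
    have "cmod (f z - poly (S N) z) \<le> (2 * R1 * M / d) * of_nat (N + 2) * (R / R1) ^ N" if z: "z \<in> ell (jk R)" for z N
    proof -
      have z1: "z \<in> ell (jk R1)" using z ell_mono[of "jk R" "jk R1"] jk_strict_mono[OF R] by auto
      define U where "U k = poly (chU k) z" for k
      have dist: "cmod (jouk \<sigma> - z) > d" if "\<sigma> \<in> sphere 0 R1" for \<sigma>
        using jouk_dist_ell[of \<sigma> R1 z R] that z assms(1) by (simp add: d_def)
      define G where "G \<sigma> = F \<sigma> / (jouk \<sigma> - z)" for \<sigma>
      define H where "H \<sigma> = (\<Sum>k\<le>N. F \<sigma> * (4 * (1 / \<sigma>) ^ Suc k) * U k)" for \<sigma>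
      have Gc: "continuous_on (sphere 0 R1) G" unfolding G_def
        using dist d by (intro continuous_on_divide Fc continuous_on_diff jc continuous_on_const) force
      have kc: "continuous_on (sphere 0 R1) (\<lambda>\<sigma>. F \<sigma> * (4 * (1 / \<sigma>) ^ Suc k))" for k
        using sph by (intro continuous_on_mult Fc continuous_on_const continuous_on_power continuous_on_divide continuous_on_id) auto
      have Hc: "continuous_on (sphere 0 R1) H" unfolding H_def
        by (intro continuous_on_sum continuous_on_mult[OF kc continuous_on_const])
      have "contour_integral ?c H = (\<Sum>k\<le>N. contour_integral ?c (\<lambda>\<sigma>. F \<sigma> * (4 * (1 / \<sigma>) ^ Suc k) * U k))"
        unfolding H_def by (intro contour_integral_sum ci continuous_on_mult[OF kc continuous_on_const]) auto
      also have "\<dots> = (\<Sum>k\<le>N. (2 * pi * \<i> * c k) * U k)"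
        using contour_integral_rmul[OF ci[OF kc]] by (simp add: c_def)
      also have "\<dots> = 2 * pi * \<i> * poly (S N) z"
        by (simp add: S_def U_def poly_sum sum_distrib_left mult_ac)
      finally have HS: "contour_integral ?c H = 2 * pi * \<i> * poly (S N) z" .
      have GS: "contour_integral ?c G = 2 * pi * \<i> * f z"
        using jouk_Cauchy_formula[OF assms z1] by (simp add: G_def[abs_def] F_def)
      have "((\<lambda>\<sigma>. G \<sigma> - H \<sigma>) has_contour_integral (2 * pi * \<i> * f z - 2 * pi * \<i> * poly (S N) z)) ?c"
        unfolding GS[symmetric] HS[symmetric]
        by (intro has_contour_integral_diff has_contour_integral_integral ci Gc Hc)
      then have "cmod (2 * pi * \<i> * f z - 2 * pi * \<i> * poly (S N) z) \<le> (2 * M / d * of_nat (N + 2) * (R / R1) ^ N) * (2 * pi * R1)"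
      proof (rule has_contour_integral_bound_circlepath)
        show "0 \<le> 2 * M / d * of_nat (N + 2) * (R / R1) ^ N" using M0 d R assms(1) by auto
        show "R1 > 0" using assms(1) by simp
        fix \<sigma> :: complex assume "cmod (\<sigma> - 0) = R1"
        then have \<sigma>: "cmod \<sigma> = R1" "\<sigma> \<in> sphere 0 R1" "\<sigma> \<noteq> 0" using assms(1) by auto
        define x where "x = 1 / \<sigma>"
        define D where "D = 1 - (4 * z - 2) * x + x\<^sup>2"
        have x0: "x \<noteq> 0" using \<sigma> by (simp add: x_def)
        have jD: "jouk \<sigma> - z = D / (4 * x)"
          using \<sigma>(3) by (simp add: D_def x_def jouk_altdef field_simps power2_eq_square)
        have D0: "D \<noteq> 0" using dist[OF \<sigma>(2)] d unfolding jD by auto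
        define A where "A = (\<Sum>k\<le>N. U k * x ^ k)"
        have H: "H \<sigma> = F \<sigma> * (4 * x) * A"
          by (simp add: H_def A_def x_def sum_distrib_left mult_ac)
        \<comment> \<open>The truncation error is the kernel times the exact remainder of the
          generating function.\<close>
        have "G \<sigma> - H \<sigma> = G \<sigma> * (1 - D * A)"
          unfolding H G_def jD using D0 x0 by (simp add: field_simps)
        also have "1 - D * A = U (Suc N) * x ^ Suc N - U N * x ^ Suc (Suc N)"
          using chU_kernel[of z x N] by (simp add: D_def A_def U_def del: chU.simps)
        finally have "cmod (G \<sigma> - H \<sigma>) = cmod (G \<sigma>) * cmod (U (Suc N) * x ^ Suc N - U N * x ^ Suc (Suc N))"
          by (simp add: norm_mult)
        also have "\<dots> \<le> (M / d) * (2 * (of_nat (N + 2) * (R / R1) ^ N))"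
        proof (rule mult_mono)
          show "cmod (G \<sigma>) \<le> M / d" unfolding G_def norm_divide
            using M[OF \<sigma>(2)] dist[OF \<sigma>(2)] d M0 by (intro frac_le) auto
          have xN: "cmod (x ^ k) = 1 / R1 ^ k" for k
            using \<sigma> by (simp add: x_def norm_power norm_divide power_divide)
          have q: "R / R1 \<ge> 0" "R / R1 \<le> 1" using R assms(1) by auto
          have "cmod (U (Suc N) * x ^ Suc N) \<le> (of_nat (Suc (Suc N)) * R ^ Suc N) * (1 / R1 ^ Suc N)"
            unfolding norm_mult xN U_def using assms(1) by (intro mult_right_mono chU_bound z R(1)) auto
          also have "\<dots> = of_nat (N + 2) * (R / R1) ^ Suc N" by (simp add: power_divide)
          also have "\<dots> \<le> of_nat (N + 2) * (R / R1) ^ N"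
            using q by (intro mult_left_mono power_decreasing) auto
          finally have a: "cmod (U (Suc N) * x ^ Suc N) \<le> of_nat (N + 2) * (R / R1) ^ N" .
          have "cmod (U N * x ^ Suc (Suc N)) \<le> (of_nat (Suc N) * R ^ N) * (1 / R1 ^ Suc (Suc N))"
            unfolding norm_mult xN U_def using assms(1) by (intro mult_right_mono chU_bound z R(1)) auto
          also have "\<dots> \<le> (of_nat (N + 2) * R ^ N) * (1 / R1 ^ N)"
            using assms(1) R by (intro mult_mono divide_left_mono power_increasing) auto
          also have "\<dots> = of_nat (N + 2) * (R / R1) ^ N" by (simp add: power_divide)
          finally have b: "cmod (U N * x ^ Suc (Suc N)) \<le> of_nat (N + 2) * (R / R1) ^ N" .
          show "cmod (U (Suc N) * x ^ Suc N - U N * x ^ Suc (Suc N)) \<le> 2 * (of_nat (N + 2) * (R / R1) ^ N)"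
            using norm_triangle_ineq4[of "U (Suc N) * x ^ Suc N" "U N * x ^ Suc (Suc N)"] a b by linarith
        qed (use M0 d in auto)
        also have "\<dots> = 2 * M / d * of_nat (N + 2) * (R / R1) ^ N" by simp
        finally show "cmod (G \<sigma> - H \<sigma>) \<le> 2 * M / d * of_nat (N + 2) * (R / R1) ^ N" .
      qed
      also have "2 * pi * \<i> * f z - 2 * pi * \<i> * poly (S N) z = 2 * pi * \<i> * (f z - poly (S N) z)"
        by (rule right_diff_distrib[symmetric])
      also have "cmod \<dots> = 2 * pi * cmod (f z - poly (S N) z)"
        unfolding norm_mult by simp
      also have "(2 * M / d * x * y) * (2 * pi * R1) = 2 * pi * ((2 * R1 * M / d) * x * y)" for x y
        by simp
      finally have "2 * pi * cmod (f z - poly (S N) z) \<le> 2 * pi * ((2 * R1 * M / d) * of_nat (N + 2) * (R / R1) ^ N)" .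
      then show ?thesis by (subst (asm) mult_le_cancel_left_pos) auto
    qed
    moreover have "2 * R1 * M / d \<ge> 0" using M0 d assms(1) by auto
    ultimately show ?thesis by blast
  qed
  then show ?thesis using deg by blast
qed

section \<open>Convergence of the expansion\<close>

text \<open>Both sides pair equally with every \<open>ju\<close> up to index N, so nondegeneracy
  makes them equal.\<close>

lemma ju_expansion_of_poly:
  assumes "admissible a b" "degree q \<le> N"
  shows "q = (\<Sum>n\<le>N. smult (Lp a b (ju a b n * q) / jh a b n) (ju a b n))"
proof -
  note nr = admissibleD[OF assms(1)]
  define c where "c n = Lp a b (ju a b n * q) / jh a b n" for n
  have Lsum: "Lp a b (\<Sum>n\<in>A. smult (c n) (ju a b k * ju a b n)) = (\<Sum>n\<in>A. c n * Lp a b (ju a b k * ju a b n))"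
    if "finite A" for A k
    using that by (induction A rule: finite_induct) (simp_all add: Lp_0[OF nr] Lp_add[OF nr] Lp_smult[OF nr])
  have "q - (\<Sum>n\<le>N. smult (c n) (ju a b n)) = 0"
  proof (rule poly_eq_0_by_ju[OF assms(1), of _ N])
    have "degree (\<Sum>n\<le>N. smult (c n) (ju a b n)) \<le> N"
    proof (rule degree_sum_le)
      fix n assume "n \<in> {..N}"
      then show "degree (smult (c n) (ju a b n)) \<le> N"
        using degree_smult_le[of "c n" "ju a b n"] degree_ju[of a b n] by simp
    qed simp
    then show "degree (q - (\<Sum>n\<le>N. smult (c n) (ju a b n))) \<le> N"
      using assms(2) by (intro degree_diff_le)
    fix k assume k: "k \<le> N"
    have "Lp a b (ju a b k * (q - (\<Sum>n\<le>N. smult (c n) (ju a b n)))) =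
       Lp a b (ju a b k * q) - Lp a b (\<Sum>n\<le>N. smult (c n) (ju a b k * ju a b n))"
      by (simp add: right_diff_distrib sum_distrib_left Lp_diff[OF nr])
    also have "Lp a b (\<Sum>n\<le>N. smult (c n) (ju a b k * ju a b n)) = (\<Sum>n\<le>N. if n = k then c n * jh a b k else 0)"
      unfolding Lsum[OF finite_atMost] by (intro sum.cong) (auto simp: Lp_ju_ju[OF assms(1)])
    also have "\<dots> = c k * jh a b k" using k by (simp add: sum.delta)
    finally show "Lp a b (ju a b k * (q - (\<Sum>n\<le>N. smult (c n) (ju a b n)))) = 0"
      using jh_nonzero[OF assms(1), of k] by (simp add: c_def)
  qed
  then show ?thesis by (simp add: c_def)
qed

definition jcoef :: "complex \<Rightarrow> complex \<Rightarrow> (complex \<Rightarrow> complex) \<Rightarrow> nat \<Rightarrow> complex" where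
  "jcoef a b f n = hadamard a b (\<lambda>x. f x * poly (ju a b n) x) / jh a b n"

lemma jcoef_diff_poly:
  assumes "admissible a b" "1 < r" "f holomorphic_on ell r"
  shows "jcoef a b f n = jcoef a b (\<lambda>x. f x - poly q x) n + Lp a b (ju a b n * q) / jh a b n"
proof -
  note nr = admissibleD[OF assms(1)]
  have "hadamard a b (\<lambda>x. (f x - poly q x) * poly (ju a b n) x + poly (ju a b n * q) x)
     = hadamard a b (\<lambda>x. (f x - poly q x) * poly (ju a b n) x) + hadamard a b (poly (ju a b n * q))"
    by (rule hadamard_add[OF assms(2) _ _ nr]) (intro holomorphic_intros assms(3) holomorphic_poly)+
  also have "(\<lambda>x. (f x - poly q x) * poly (ju a b n) x + poly (ju a b n * q) x) = (\<lambda>x. f x * poly (ju a b n) x)"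
    by (rule ext) (simp add: algebra_simps)
  finally show ?thesis unfolding jcoef_def Lp_def by (simp only: add_divide_distrib)
qed

text \<open>The factors n! from the coefficient and from the polynomial cancel the (n!)^2 by which
  \<open>jh\<close> differs from \<open>jnorm\<close>.\<close>

lemma jacobi_term_eq:
  assumes "admissible a b" "1 < r" "f holomorphic_on ell r"
  shows "hadamard a b (\<lambda>x. f x * poly (jpoly a b n) x) / jnorm a b n * poly (jpoly a b n) z =
    jcoef a b f n * poly (ju a b n) z"
proof -
  note nr = admissibleD[OF assms(1)]
  have "(\<lambda>x. f x * poly (jac a b n) x) = (\<lambda>x. fact n * (f x * poly (ju a b n) x))"
    by (simp add: ju_def)
  moreover have "hadamard a b (\<lambda>x. fact n * (f x * poly (ju a b n) x)) = fact n * hadamard a b (\<lambda>x. f x * poly (ju a b n) x)"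
    by (rule hadamard_cmult[OF assms(2) _ nr]) (intro holomorphic_intros assms(3) holomorphic_poly)
  ultimately show ?thesis
    unfolding jpoly_eq_jac jcoef_def by (simp add: ju_def jh_def power2_eq_square)
qed

lemma Suc_Suc_le_geometric:
  assumes "1 < (Q::real)"
  shows "\<exists>C\<ge>0. \<forall>n. of_nat (n + 2) \<le> C * Q ^ n"
proof -
  have "\<exists>C\<ge>0. \<forall>n. cmod (of_nat n + 2) \<le> C * Q ^ n"
  proof (rule ratio_limit_one_growth[OF _ _ assms])
    show "(of_nat n + 2 :: complex) \<noteq> 0" for n
      by (metis add_2_eq_Suc' nat.distinct(1) of_nat_add of_nat_eq_0_iff of_nat_numeral)
    show "(\<lambda>n. (of_nat (Suc n) + 2) / (of_nat n + 2 :: complex)) \<longlonglongrightarrow> 1"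
      using tendsto_linear_ratio[of 3 2] by (simp add: add_ac)
  qed
  moreover have "cmod (of_nat n + 2) = of_nat (n + 2)" for n
    by (metis norm_of_nat of_nat_add of_nat_numeral)
  ultimately show ?thesis by simp
qed

lemma jacobi_expansion_estimates:
  assumes adm: "admissible a b" and R: "1 \<le> R" "R < R0" and f: "f holomorphic_on ell (jk R0)"
  obtains C \<theta> where "0 \<le> \<theta>" "\<theta> < 1"
    "\<And>n z. z \<in> ell (jk R) \<Longrightarrow> cmod (jcoef a b f (Suc n) * poly (ju a b (Suc n)) z) \<le> C * \<theta> ^ n"
    "\<And>N z. z \<in> ell (jk R) \<Longrightarrow> cmod ((\<Sum>n<Suc N. jcoef a b f n * poly (ju a b n) z) - f z) \<le> C * \<theta> ^ N"
proof -
  note nr = admissibleD[OF adm]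
  define R1 where "R1 = (R + R0) / 2"
  have R1: "R < R1" "R1 < R0" "1 < R1" using R by (auto simp: R1_def)
  \<comment> \<open>Cost per index: approximation on the thin ellipse Q / R1, the polynomial there
    Q^2, the inverse norm Q, the polynomial at z a factor R Q, and the linear factors N + 2 and N +
    1 together Q^2. The total is Q^7 R / R1 = \<theta>; with a ninth root this is Q^(-2) <
    1.\<close>
  define Q where "Q = root 9 (R1 / R)"
  have "R1 / R > 1" using R R1 by simp
  then have Q1: "Q > 1" and Q9: "Q ^ 9 = R1 / R" by (auto simp: Q_def)
  have Q9R: "Q ^ 9 * R = R1" using Q9 R by simp
  have "Q ^ 7 * R < Q ^ 9 * R" using Q1 R by (intro mult_strict_right_mono power_strict_increasing) auto
  then have Q7: "Q ^ 7 * R < R1" using Q9R by simp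
  have "Q * 1 \<le> Q * (Q ^ 6 * R)" using Q1 R mult_mono[of 1 "Q ^ 6" 1 R] one_le_power[of Q 6]
    by (intro mult_left_mono) auto
  then have QR1: "Q < R1" using Q7 by (simp add: power_Suc[symmetric] eval_nat_numeral mult_ac)
  define \<theta> where "\<theta> = Q ^ 7 * R / R1"
  have \<theta>: "0 \<le> \<theta>" "\<theta> < 1" using Q7 Q1 R R1 by (auto simp: \<theta>_def)
  obtain S where S: "\<And>N. degree (S N) \<le> N" and S': "\<And>R. 1 \<le> R \<Longrightarrow> R < R1 \<Longrightarrow>
     \<exists>C\<ge>0. \<forall>N. \<forall>z\<in>ell (jk R). cmod (f z - poly (S N) z) \<le> C * of_nat (N + 2) * (R / R1) ^ N"
    using polynomial_approximation_ell[OF R1(3,2) f] by blast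
  obtain C1 where C1: "C1 \<ge> 0" "\<And>N z. z \<in> ell (jk Q) \<Longrightarrow> cmod (f z - poly (S N) z) \<le> C1 * of_nat (N + 2) * (Q / R1) ^ N"
    using S'[of Q] Q1 QR1 by auto
  obtain C2 where C2: "C2 \<ge> 0" "\<And>N z. z \<in> ell (jk R) \<Longrightarrow> cmod (f z - poly (S N) z) \<le> C2 * of_nat (N + 2) * (R / R1) ^ N"
    using S'[of R] R R1 by auto
  obtain C3 where C3: "C3 \<ge> 0" "\<And>n z. z \<in> ell (jk Q) \<Longrightarrow> cmod (poly (ju a b n) z) \<le> C3 * (Q * Q) ^ n"
    using ju_growth[OF adm, of Q Q] Q1 by auto
  obtain C4 where C4: "C4 \<ge> 0" "\<And>n z. z \<in> ell (jk R) \<Longrightarrow> cmod (poly (ju a b n) z) \<le> C4 * (R * Q) ^ n"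
    using ju_growth[OF adm, of R Q] Q1 R by auto
  obtain C5 where C5: "C5 \<ge> 0" "\<And>n. cmod (1 / jh a b n) \<le> C5 * Q ^ n"
    using inverse_jh_growth[OF adm Q1] by auto
  have jkQ: "1 < jk Q" using jk_strict_mono[of 1 Q] Q1 by (simp add: jk_def)
  obtain C6 where C6: "C6 \<ge> 0" "\<And>h M. h holomorphic_on ell (jk Q) \<Longrightarrow> (\<forall>z\<in>ell (jk Q). cmod (h z) \<le> M) \<Longrightarrow> cmod (hadamard a b h) \<le> C6 * M"
    using hadamard_bound[OF jkQ nr] by blast
  obtain C7 where C7: "C7 \<ge> 0" "\<And>n. of_nat (n + 2) \<le> C7 * Q ^ n"
    using Suc_Suc_le_geometric[OF Q1] by blast
  have fQ: "f holomorphic_on ell (jk Q)"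
    using f holomorphic_on_subset ell_mono[of "jk Q" "jk R0"] jk_strict_mono[of Q R0] Q1 QR1 R1 by auto
  define K where "K = C6 * C1 * C3 * C5 * C4"
  have K0: "K \<ge> 0" using C1(1) C3(1) C4(1) C5(1) C6(1) by (simp add: K_def)
  have err: "cmod (jcoef a b (\<lambda>x. f x - poly (S N) x) n * poly (ju a b n) z) \<le> K * of_nat (N + 2) * (Q / R1) ^ N * (Q ^ 4 * R) ^ n"
    if z: "z \<in> ell (jk R)" for N n z
  proof -
    have b: "cmod (hadamard a b (\<lambda>x. (f x - poly (S N) x) * poly (ju a b n) x)) \<le> C6 * ((C1 * of_nat (N + 2) * (Q / R1) ^ N) * (C3 * (Q * Q) ^ n))"
    proof (rule C6(2))
      show "(\<lambda>x. (f x - poly (S N) x) * poly (ju a b n) x) holomorphic_on ell (jk Q)"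
        by (intro holomorphic_intros fQ holomorphic_poly)
      show "\<forall>z\<in>ell (jk Q). cmod ((f z - poly (S N) z) * poly (ju a b n) z) \<le> (C1 * of_nat (N + 2) * (Q / R1) ^ N) * (C3 * (Q * Q) ^ n)"
        unfolding norm_mult using C1(1) Q1 R1 by (intro ballI mult_mono C1(2) C3(2)) auto
    qed
    have "cmod (jcoef a b (\<lambda>x. f x - poly (S N) x) n * poly (ju a b n) z) =
      cmod (hadamard a b (\<lambda>x. (f x - poly (S N) x) * poly (ju a b n) x)) * cmod (1 / jh a b n) * cmod (poly (ju a b n) z)"
      by (simp add: jcoef_def norm_mult norm_divide)
    also have "\<dots> \<le> (C6 * ((C1 * of_nat (N + 2) * (Q / R1) ^ N) * (C3 * (Q * Q) ^ n))) * (C5 * Q ^ n) * (C4 * (R * Q) ^ n)"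
      using b C1(1) C3(1) C5(1) C6(1) Q1 R1 by (intro mult_mono C5(2) C4(2) z) auto
    also have "\<dots> = K * of_nat (N + 2) * (Q / R1) ^ N * ((Q * Q) ^ n * Q ^ n * (R * Q) ^ n)"
      by (simp only: K_def mult_ac)
    also have "(Q * Q) ^ n * Q ^ n * (R * Q) ^ n = (Q ^ 4 * R) ^ n"
      by (simp add: power_mult_distrib[symmetric] eval_nat_numeral mult_ac)
    finally show ?thesis .
  qed
  have q1: "Q ^ 4 * R \<ge> 1" using mult_mono[of 1 "Q ^ 4" 1 R] one_le_power[of Q 4] Q1 R by simp
  have le\<theta>: "(Q / R1) ^ N * (Q ^ 4 * R) ^ N * (Q ^ N * Q ^ N) = \<theta> ^ N" for N
    unfolding power_mult_distrib[symmetric] \<theta>_def by (simp add: eval_nat_numeral mult_ac)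
  define C where "C = K * C7 * (Q ^ 4 * R) + (C2 * C7 + K * C7 * C7)"
  have A0: "K * C7 * (Q ^ 4 * R) \<ge> 0" "C2 * C7 + K * C7 * C7 \<ge> 0"
    using K0 C7(1) C2(1) q1 by auto
  have N2: "of_nat (N + 1) \<le> C7 * Q ^ N" for N using C7(2)[of N] by simp
  have Qn: "1 \<le> Q ^ n" for n using Q1 by (intro one_le_power) auto
  show ?thesis
  proof (rule that[OF \<theta>, of C])
    fix n z assume z: "z \<in> ell (jk R)"
    \<comment> \<open>Degree n against index n + 1: orthogonality removes S n, and the coefficient
      sees only the approximation error. Hence the term bounds begin at index 1.\<close>
    have "Lp a b (ju a b (Suc n) * S n) = 0"
      using Lp_ju_mult[OF adm, of "S n" "Suc n"] S[of n] by (simp add: coeff_eq_0)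
    then have "jcoef a b f (Suc n) = jcoef a b (\<lambda>x. f x - poly (S n) x) (Suc n)"
      using jcoef_diff_poly[OF adm jkQ fQ, of "Suc n" "S n"] by simp
    then have "cmod (jcoef a b f (Suc n) * poly (ju a b (Suc n)) z) \<le> K * of_nat (n + 2) * (Q / R1) ^ n * (Q ^ 4 * R) ^ Suc n"
      using err[OF z, of n "Suc n"] by simp
    also have "\<dots> \<le> K * (C7 * Q ^ n) * (Q / R1) ^ n * (Q ^ 4 * R) ^ Suc n"
      using K0 Q1 R1 q1 by (intro mult_right_mono mult_left_mono C7(2)) auto
    also have "\<dots> = K * C7 * (Q ^ 4 * R) * ((Q / R1) ^ n * (Q ^ 4 * R) ^ n * (Q ^ n * 1))"
      by (simp only: power_Suc mult_ac mult_1_right)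
    \<comment> \<open>A spare factor Q^n >= 1 is inserted to reach the common ratio
      \<theta>.\<close>
    also have "\<dots> \<le> K * C7 * (Q ^ 4 * R) * ((Q / R1) ^ n * (Q ^ 4 * R) ^ n * (Q ^ n * Q ^ n))"
      using K0 C7(1) R(1) Q1 R1 q1 Qn by (intro mult_left_mono mult_nonneg_nonneg) auto
    also have "\<dots> = K * C7 * (Q ^ 4 * R) * \<theta> ^ n" unfolding le\<theta> ..
    also have "\<dots> \<le> C * \<theta> ^ n" unfolding C_def using A0 \<theta> by (intro mult_right_mono) auto
    finally show "cmod (jcoef a b f (Suc n) * poly (ju a b (Suc n)) z) \<le> C * \<theta> ^ n" .
  next
    fix N z assume z: "z \<in> ell (jk R)"
    \<comment> \<open>The first N + 1 terms reproduce S N exactly, so the error of the partial sum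
      for f is the partial sum for f - S N minus f - S N itself.\<close>
    have "poly (S N) z = (\<Sum>n\<le>N. Lp a b (ju a b n * S N) / jh a b n * poly (ju a b n) z)"
      using arg_cong[OF ju_expansion_of_poly[OF adm S[of N]], of "\<lambda>p. poly p z"] by (simp add: poly_sum)
    moreover have "(\<Sum>n<Suc N. jcoef a b f n * poly (ju a b n) z) =
       (\<Sum>n\<le>N. jcoef a b (\<lambda>x. f x - poly (S N) x) n * poly (ju a b n) z) + (\<Sum>n\<le>N. Lp a b (ju a b n * S N) / jh a b n * poly (ju a b n) z)"
      unfolding lessThan_Suc_atMost sum.distrib[symmetric]
      by (intro sum.cong refl) (subst jcoef_diff_poly[OF adm jkQ fQ, of _ "S N"], simp only: distrib_right)
    ultimately have "(\<Sum>n<Suc N. jcoef a b f n * poly (ju a b n) z) - f z =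
       (\<Sum>n\<le>N. jcoef a b (\<lambda>x. f x - poly (S N) x) n * poly (ju a b n) z) - (f z - poly (S N) z)" by simp
    also have "cmod \<dots> \<le> cmod (\<Sum>n\<le>N. jcoef a b (\<lambda>x. f x - poly (S N) x) n * poly (ju a b n) z) + cmod (f z - poly (S N) z)"
      by (rule norm_triangle_ineq4)
    also have "\<dots> \<le> K * C7 * C7 * \<theta> ^ N + C2 * C7 * \<theta> ^ N"
    proof (rule add_mono)
      have "cmod (\<Sum>n\<le>N. jcoef a b (\<lambda>x. f x - poly (S N) x) n * poly (ju a b n) z)
         \<le> (\<Sum>n\<le>N. K * of_nat (N + 2) * (Q / R1) ^ N * (Q ^ 4 * R) ^ N)"
      proof (rule sum_norm_le)
        fix n assume n: "n \<in> {..N}"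
        have "cmod (jcoef a b (\<lambda>x. f x - poly (S N) x) n * poly (ju a b n) z) \<le> K * of_nat (N + 2) * (Q / R1) ^ N * (Q ^ 4 * R) ^ n"
          by (rule err[OF z])
        also have "\<dots> \<le> K * of_nat (N + 2) * (Q / R1) ^ N * (Q ^ 4 * R) ^ N"
          using n K0 Q1 R1 q1 by (intro mult_left_mono power_increasing) auto
        finally show "cmod (jcoef a b (\<lambda>x. f x - poly (S N) x) n * poly (ju a b n) z) \<le> K * of_nat (N + 2) * (Q / R1) ^ N * (Q ^ 4 * R) ^ N" .
      qed
      also have "\<dots> = K * ((Q / R1) ^ N * (Q ^ 4 * R) ^ N) * (of_nat (N + 2) * of_nat (N + 1))"
        by (simp add: mult_ac)
      also have "\<dots> \<le> K * ((Q / R1) ^ N * (Q ^ 4 * R) ^ N) * ((C7 * Q ^ N) * (C7 * Q ^ N))"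
        using K0 Q1 R1 q1 C7 N2 by (intro mult_left_mono mult_mono C7(2) N2) auto
      also have "\<dots> = K * C7 * C7 * ((Q / R1) ^ N * (Q ^ 4 * R) ^ N * (Q ^ N * Q ^ N))" by (simp only: mult_ac)
      also have "\<dots> = K * C7 * C7 * \<theta> ^ N" unfolding le\<theta> ..
      finally show "cmod (\<Sum>n\<le>N. jcoef a b (\<lambda>x. f x - poly (S N) x) n * poly (ju a b n) z) \<le> K * C7 * C7 * \<theta> ^ N" .
      have "cmod (f z - poly (S N) z) \<le> C2 * of_nat (N + 2) * (R / R1) ^ N" by (rule C2(2)[OF z])
      also have "\<dots> \<le> C2 * (C7 * Q ^ N) * (R / R1) ^ N"
        using C2(1) R R1 by (intro mult_right_mono mult_left_mono C7(2)) auto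
      also have "\<dots> = C2 * C7 * (Q * R / R1) ^ N" by (simp add: power_mult_distrib power_divide mult_ac)
      also have "\<dots> \<le> C2 * C7 * \<theta> ^ N"
      proof (intro mult_left_mono power_mono)
        have "Q * R \<le> Q ^ 7 * R" using Q1 R power_increasing[of 1 7 Q] by (intro mult_right_mono) auto
        then show "Q * R / R1 \<le> \<theta>" unfolding \<theta>_def using R1 by (intro divide_right_mono) auto
      qed (use Q1 R R1 C2(1) C7(1) in auto)
      finally show "cmod (f z - poly (S N) z) \<le> C2 * C7 * \<theta> ^ N" .
    qed
    also have "\<dots> = (C2 * C7 + K * C7 * C7) * \<theta> ^ N" by (simp add: algebra_simps)
    also have "\<dots> \<le> C * \<theta> ^ N" unfolding C_def using A0 \<theta> by (intro mult_right_mono) auto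
    finally show "cmod ((\<Sum>n<Suc N. jcoef a b f n * poly (ju a b n) z) - f z) \<le> C * \<theta> ^ N" .
  qed
qed

section \<open>From compact subsets to confocal ellipses, and the conclusion\<close>

lemma jk_surj:
  assumes "1 < r"
  obtains R where "1 < R" "jk R = r"
proof -
  \<comment> \<open>r + q is the root above 1 of R^2 - 2 r R + 1 = 0.\<close>
  define q where "q = sqrt (r\<^sup>2 - 1)"
  have r2: "r\<^sup>2 > 1" using assms by (simp add: one_less_power)
  have q: "q\<^sup>2 = r\<^sup>2 - 1" "q > 0" using r2 by (auto simp: q_def)
  have m: "(r + q) * (r - q) = 1" using q(1) by (simp add: algebra_simps power2_eq_square)
  have p: "r + q > 1" using q assms by simp
  then have "1 / (r + q) = r - q" using m by (simp add: field_simps)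
  then have "jk (r + q) = r" by (simp add: jk_def)
  with p that show ?thesis by blast
qed

text \<open>The sum of the focal distances attains its maximum on a nonempty compact set, strictly
  below r.\<close>

lemma compact_subset_smaller_ell:
  assumes "1 < r" "compact K" "K \<subseteq> ell r"
  obtains r' where "1 < r'" "r' < r" "K \<subseteq> ell r'"
proof (cases "K = {}")
  case True
  then show ?thesis using that[of "(1 + r) / 2"] assms(1) by auto
next
  case False
  have "continuous_on K (\<lambda>z. cmod z + cmod (z - 1))" by (intro continuous_intros)
  from continuous_attains_sup[OF assms(2) False this] obtain w where
    w: "w \<in> K" "\<And>z. z \<in> K \<Longrightarrow> cmod z + cmod (z - 1) \<le> cmod w + cmod (w - 1)" by blast
  define m where "m = cmod w + cmod (w - 1)"
  have m: "m < r" using w(1) assms(3) by (auto simp: ell_def m_def)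
  show ?thesis
  proof (rule that[of "(max 1 m + r) / 2"])
    show "K \<subseteq> ell ((max 1 m + r) / 2)"
      using w(2) m assms(1) unfolding ell_def m_def[symmetric] by fastforce
  qed (use m assms(1) in auto)
qed

theorem theorem1p2:
  fixes \<alpha> \<beta> :: complex and r :: real and f :: "complex \<Rightarrow> complex"
  assumes "\<forall>k::nat. \<alpha> \<noteq> - of_nat k"
    and "\<forall>k::nat. \<beta> \<noteq> - of_nat k"
    and "\<forall>k::nat. k \<ge> 2 \<longrightarrow> \<alpha> + \<beta> \<noteq> - of_nat k"
    and "r > 1"
    and "f analytic_on {z. cmod z + cmod (z - 1) < r}"
  shows
    "(\<forall>z \<in> {z. cmod z + cmod (z - 1) < r}.
        (\<lambda>n. hadamard \<alpha> \<beta> (\<lambda>x. f x * poly (jpoly \<alpha> \<beta> n) x) / jnorm \<alpha> \<beta> n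
              * poly (jpoly \<alpha> \<beta> n) z) sums f z)
     \<and> (\<forall>K. compact K \<and> K \<subseteq> {z. cmod z + cmod (z - 1) < r} \<longrightarrow>
          uniform_limit K
            (\<lambda>N z. \<Sum>n<N. hadamard \<alpha> \<beta> (\<lambda>x. f x * poly (jpoly \<alpha> \<beta> n) x) / jnorm \<alpha> \<beta> n
                          * poly (jpoly \<alpha> \<beta> n) z) f sequentially
          \<and> uniformly_convergent_on K
            (\<lambda>N z. \<Sum>n<N. norm (hadamard \<alpha> \<beta> (\<lambda>x. f x * poly (jpoly \<alpha> \<beta> n) x) / jnorm \<alpha> \<beta> n
                          * poly (jpoly \<alpha> \<beta> n) z)))"
proof -
  have nonresI: "nonres c" if "\<And>m::nat. c \<noteq> - of_nat (Suc m)" for c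
    unfolding nonres_def
  proof (intro allI notI)
    fix m :: nat assume "of_nat m + (c + 1) = 0"
    then have "c + of_nat (Suc m) = 0" by (simp add: add_ac)
    then have "c = - of_nat (Suc m)" by (simp only: eq_neg_iff_add_eq_0)
    then show False using that by blast
  qed
  have adm: "admissible \<alpha> \<beta>"
    unfolding admissible_def
  proof (intro conjI nonresI)
    show "\<alpha> \<noteq> - of_nat (Suc m)" "\<beta> \<noteq> - of_nat (Suc m)" for m using assms(1,2) by blast+
    have "\<alpha> + \<beta> \<noteq> - of_nat (Suc (Suc m))" for m
      using assms(3)[rule_format, of "Suc (Suc m)"] by simp
    then show "\<alpha> + \<beta> + 1 \<noteq> - of_nat (Suc m)" for m
      unfolding eq_neg_iff_add_eq_0 by (simp add: add_ac)
  qed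
  have hol: "f holomorphic_on ell r"
    using assms(5) unfolding ell_def by (rule analytic_imp_holomorphic)
  define T where "T n z = jcoef \<alpha> \<beta> f n * poly (ju \<alpha> \<beta> n) z" for n z
  have T: "hadamard \<alpha> \<beta> (\<lambda>x. f x * poly (jpoly \<alpha> \<beta> n) x) / jnorm \<alpha> \<beta> n * poly (jpoly \<alpha> \<beta> n) z = T n z" for n z
    unfolding T_def by (rule jacobi_term_eq[OF adm assms(4) hol])
  obtain R0 where R0: "1 < R0" "jk R0 = r" using jk_surj[OF assms(4)] by blast
  have main: "uniform_limit K (\<lambda>N z. \<Sum>n<N. T n z) f sequentially \<and>
      uniformly_convergent_on K (\<lambda>N z. \<Sum>n<N. norm (T n z))" if K: "compact K" "K \<subseteq> ell r" for K
  proof -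
    obtain r' where r': "1 < r'" "r' < r" "K \<subseteq> ell r'"
      using compact_subset_smaller_ell[OF assms(4) K] by blast
    obtain R where R: "1 < R" "jk R = r'" using jk_surj[OF r'(1)] by blast
    have RR: "R < R0"
      using jk_strict_mono[of R0 R] R R0 r' by (cases "R = R0") force+
    have hol0: "f holomorphic_on ell (jk R0)" using hol R0(2) by simp
    obtain C \<theta> where \<theta>: "0 \<le> \<theta>" "\<theta> < 1" and
      C1: "\<And>n z. z \<in> ell (jk R) \<Longrightarrow> cmod (jcoef \<alpha> \<beta> f (Suc n) * poly (ju \<alpha> \<beta> (Suc n)) z) \<le> C * \<theta> ^ n" and
      C2: "\<And>N z. z \<in> ell (jk R) \<Longrightarrow> cmod ((\<Sum>n<Suc N. jcoef \<alpha> \<beta> f n * poly (ju \<alpha> \<beta> n) z) - f z) \<le> C * \<theta> ^ N"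
      by (rule jacobi_expansion_estimates[OF adm less_imp_le[OF R(1)] RR hol0]) (rule that)
    have KR: "z \<in> ell (jk R)" if "z \<in> K" for z using that r' R by auto
    have geo: "(\<lambda>N. C * \<theta> ^ N) \<longlonglongrightarrow> 0"
      using \<theta> by (intro tendsto_mult_right_zero LIMSEQ_power_zero) auto
    have "uniform_limit K (\<lambda>N z. \<Sum>n<Suc N. T n z) f sequentially"
    proof (rule uniform_limitI)
      fix e :: real assume "e > 0"
      then have "eventually (\<lambda>N. C * \<theta> ^ N < e) sequentially" using order_tendstoD(2)[OF geo] by blast
      then show "\<forall>\<^sub>F N in sequentially. \<forall>z\<in>K. dist (\<Sum>n<Suc N. T n z) (f z) < e"
      proof eventually_elim
        case (elim N)
        show ?case unfolding dist_norm T_def using C2[OF KR] elim le_less_trans by blast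
      qed
    qed
    \<comment> \<open>The estimate concerns N + 1 terms; the index is shifted back.\<close>
    then have "uniform_limit K (\<lambda>N z. \<Sum>n<N. T n z) f sequentially"
      by (subst (asm) filterlim_sequentially_Suc[of "\<lambda>N z. \<Sum>n<N. T n z"])
    moreover have "uniform_limit K (\<lambda>N z. \<Sum>n<N. norm (T n z)) (\<lambda>z. \<Sum>n. norm (T n z)) sequentially"
    proof (rule Weierstrass_m_test_ev)
      \<comment> \<open>The bound is available from index 1 only, hence the exponent n - 1 and a
        majorant that holds eventually.\<close>
      show "\<forall>\<^sub>F n in sequentially. \<forall>z\<in>K. norm (norm (T n z)) \<le> C * \<theta> ^ (n - 1)"
        using eventually_gt_at_top[of 0]
      proof eventually_elim
        case (elim n)
        then obtain m where "n = Suc m" by (cases n) auto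
        then show ?case using C1[OF KR, of _ m] by (simp add: T_def)
      qed
      have "summable (\<lambda>n. C * \<theta> ^ (Suc n - 1))"
        using \<theta> by (auto intro!: summable_mult summable_geometric)
      then show "summable (\<lambda>n. C * \<theta> ^ (n - 1))"
        by (subst (asm) summable_Suc_iff)
    qed
    ultimately show ?thesis by (auto simp: uniformly_convergent_on_def)
  qed
  have "(\<lambda>n. T n z) sums f z" if "z \<in> ell r" for z
  proof -
    have "uniform_limit {z} (\<lambda>N z. \<Sum>n<N. T n z) f sequentially" using main[of "{z}"] that by simp
    then show ?thesis unfolding sums_def by (rule tendsto_uniform_limitI) simp
  qed
  then show ?thesis unfolding T ell_def[symmetric] using main by blast
qed

end
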